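(* Let $\mathbb{K}$ be a field, $n\ge 2$, $\mathcal{L}$ a Leibniz algebra over $\mathbb{K}$, and $\mathcal{M}$ a trivial co-representation of $\mathcal{L}$ (a vector space with zero actions), also regarded as a trivial co-representation of the Leibniz $n$-algebra $\mathfrak{U}_n(\mathcal{L})$. The linear maps \[ h_k:\mathcal{M}\otimes\mathcal{L}\otimes(\mathcal{L}^{\otimes(n-1)})^{\otimes k}\to\mathcal{M}\otimes\mathcal{L}\otimes\mathcal{L}^{\otimes k}, \] \[ h_k\big(m\otimes l\otimes(l_1^1\otimes\cdots\otimes l_{n-1}^1)\otimes\cdots\otimes(l_1^k\otimes\cdots\otimes l_{n-1}^k)\big)=m\otimes l\otimes[l_1^1,[l_2^1,\dots[l_{n-2}^1,l_{n-1}^1]\dots]]\otimes\cdots\otimes[l_1^k,[l_2^k,\dots[l_{n-2}^k,l_{n-1}^k]\dots]] \] induce a homomorphism in homology \[ \overline{h}_*:{}_nHL_*(\mathfrak{U}_n(\mathcal{L}),\mathcal{M})\longrightarrow{}_2HL_*(\mathcal{L},\mathcal{M}), \] with $\overline{h}_0$ an epimorphism. Moreover, if $\mathcal{L}$ is a perfect Leibniz algebra, then $\overline{h}_0$ is the identity map and $\overline{h}_1$ is an epimorphism.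
   Context: A Leibniz $n$-algebra is a vector space $\mathcal{L}$ with an $n$-linear bracket satisfying $[[x_1,\dots,x_n],y_2,\dots,y_n]=\sum_{i=1}^n[x_1,\dots,[x_i,y_2,\dots,y_n],\dots,x_n]$; a Leibniz algebra is the case $n=2$. A Leibniz algebra is perfect if it is spanned by brackets. All tensor products are over $\mathbb{K}$. (For $n=2$ the iterated bracket of a single element $l_1$ is $l_1$ itself.) $\mathfrak{U}_n(\mathcal{L})$ is the Leibniz $n$-algebra with the same vector space as the Leibniz algebra $\mathcal{L}$ and bracket $[l_1,\dots,l_n]=[l_1,[l_2,\dots,[l_{n-1},l_n]\dots]]$. For a Leibniz $n$-algebra $\mathcal{A}$, $\mathfrak{D}_n(\mathcal{A})$ is the Leibniz algebra $\mathcal{A}^{\otimes(n-1)}$ with bracket $[l_1\otimes\cdots\otimes l_{n-1},l_1'\otimes\cdots\otimes l_{n-1}']=\sum_{i=1}^{n-1}l_1\otimes\cdots\otimes[l_i,l_1',\dots,l_{n-1}']\otimes\cdots\otimes l_{n-1}$. For a Leibniz algebra $\mathfrak{g}$ and a co-representation $M$ of $\mathfrak{g}$ (a vector space with actions $[-,-]:M\otimes\mathfrak{g}\to M$ and $[-,-]:\mathfrak{g}\otimes M\to M$ satisfying the usual Loday–Pirashvili axioms), the Leibniz complex is $CL_k(\mathfrak{g},M)=M\otimes\mathfrak{g}^{\otimes k}$, $k\ge 0$, with boundary \begin{align*} d_k(m\otimes x_1\otimes\cdots\otimes x_k)={}&[m,x_1]\otimes x_2\otimes\cdots\otimes x_k+\sum_{2\le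 i\le k}(-1)^i[x_i,m]\otimes x_1\otimes\cdots\otimes\widehat{x_i}\otimes\cdots\otimes x_k\\ &+\sum_{1\le i<j\le k}(-1)^{j+1}m\otimes x_1\otimes\cdots\otimes x_{i-1}\otimes[x_i,x_j]\otimes\cdots\otimes\widehat{x_j}\otimes\cdots\otimes x_k. \end{align*} For a Leibniz $n$-algebra $\mathcal{A}$ and a trivial co-representation $\mathcal{M}$, $\mathcal{M}\otimes\mathcal{A}$ is a co-representation of $\mathfrak{D}_n(\mathcal{A})$ via $[m\otimes l,l_1\otimes\cdots\otimes l_{n-1}]=m\otimes[l,l_1,\dots,l_{n-1}]$ and $[l_1\otimes\cdots\otimes l_{n-1},m\otimes l]=-m\otimes[l,l_1,\dots,l_{n-1}]$. Put ${}_nCL_*(\mathcal{A},\mathcal{M}):=CL_*(\mathfrak{D}_n(\mathcal{A}),\mathcal{M}\otimes\mathcal{A})$ and ${}_nHL_*(\mathcal{A},\mathcal{M}):=H_*({}_nCL_*(\mathcal{A},\mathcal{M}))$. In particular ${}_nHL_0(\mathcal{A},\mathcal{M})=\mathcal{M}\otimes\mathcal{A}/[\mathcal{A}^n]$, with $[\mathcal{A}^n]$ the span of all $n$-ary brackets. *)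

theory Defs
  imports "HOL-Algebra.Module" "HOL-Algebra.AbelCoset"
begin

section \<open>Linear algebra over a field\<close>

text \<open>
  A vector space over a field \<open>K\<close> is a \<^locale>\<open>module\<close> over \<open>K\<close>. The record type of modules
  inherits the ring fields \<^const>\<open>mult\<close> and \<^const>\<open>one\<close>, which play no role for modules; they are
  left undefined below.
\<close>

definition linear_map ::
  "('k,'r) ring_scheme \<Rightarrow> ('k,'a,'e) module_scheme \<Rightarrow> ('k,'b,'f) module_scheme \<Rightarrow> ('a \<Rightarrow> 'b) \<Rightarrow> bool"
  where "linear_map K V W f \<longleftrightarrow>
    f \<in> carrier V \<rightarrow> carrier W \<and>
    (\<forall>x\<in>carrier V. \<forall>y\<in>carrier V. f (x \<oplus>\<^bsub>V\<^esub> y) = f x \<oplus>\<^bsub>W\<^esub> f y) \<and>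
    (\<forall>a\<in>carrier K. \<forall>x\<in>carrier V. f (a \<odot>\<^bsub>V\<^esub> x) = a \<odot>\<^bsub>W\<^esub> f x)"

definition bilinear_map ::
  "('k,'r) ring_scheme \<Rightarrow> ('k,'a,'e) module_scheme \<Rightarrow> ('k,'b,'f) module_scheme \<Rightarrow>
   ('k,'c,'g) module_scheme \<Rightarrow> ('a \<Rightarrow> 'b \<Rightarrow> 'c) \<Rightarrow> bool"
  where "bilinear_map K V W U b \<longleftrightarrow>
    (\<forall>v\<in>carrier V. linear_map K W U (b v)) \<and>
    (\<forall>w\<in>carrier W. linear_map K V U (\<lambda>v. b v w))"

definition vlists :: "('k,'a,'e) module_scheme \<Rightarrow> nat \<Rightarrow> 'a list set"
  where "vlists V k = {xs. length xs = k \<and> set xs \<subseteq> carrier V}"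

definition multilinear_map ::
  "('k,'r) ring_scheme \<Rightarrow> nat \<Rightarrow> ('k,'a,'e) module_scheme \<Rightarrow> ('k,'b,'f) module_scheme \<Rightarrow>
   ('a list \<Rightarrow> 'b) \<Rightarrow> bool"
  where "multilinear_map K k V W f \<longleftrightarrow>
    (\<forall>xs\<in>vlists V k. \<forall>i<k. linear_map K V W (\<lambda>v. f (xs[i := v])))"

definition lin_span ::
  "('k,'r) ring_scheme \<Rightarrow> ('k,'a,'e) module_scheme \<Rightarrow> 'a set \<Rightarrow> 'a set"
  where "lin_span K V S = \<Inter>{W. submodule W K V \<and> S \<subseteq> W}"

definition quot_module :: "('k,'a,'e) module_scheme \<Rightarrow> 'a set \<Rightarrow> ('k,'a set) module"
  where "quot_module V S =
    \<lparr>carrier = a_rcosets\<^bsub>V\<^esub> S, mult = undefined, one = undefined, zero = S,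
     add = set_add V, smult = (\<lambda>a X. \<Union>x\<in>X. S +>\<^bsub>V\<^esub> (a \<odot>\<^bsub>V\<^esub> x))\<rparr>"

definition free_module :: "('k,'r) ring_scheme \<Rightarrow> 'x set \<Rightarrow> ('k,'x \<Rightarrow> 'k) module"
  where "free_module K X =
    \<lparr>carrier = {f \<in> UNIV \<rightarrow> carrier K. finite {x. f x \<noteq> \<zero>\<^bsub>K\<^esub>} \<and> {x. f x \<noteq> \<zero>\<^bsub>K\<^esub>} \<subseteq> X},
     mult = undefined, one = undefined, zero = (\<lambda>x. \<zero>\<^bsub>K\<^esub>),
     add = (\<lambda>f g x. f x \<oplus>\<^bsub>K\<^esub> g x), smult = (\<lambda>a f x. a \<otimes>\<^bsub>K\<^esub> f x)\<rparr>"

definition gen :: "('k,'r) ring_scheme \<Rightarrow> 'x \<Rightarrow> 'x \<Rightarrow> 'k"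
  where "gen K x = (\<lambda>y. if y = x then \<one>\<^bsub>K\<^esub> else \<zero>\<^bsub>K\<^esub>)"


subsection \<open>The tensor product of two vector spaces\<close>

definition tensor_rels ::
  "('k,'r) ring_scheme \<Rightarrow> ('k,'a,'e) module_scheme \<Rightarrow> ('k,'b,'f) module_scheme \<Rightarrow> ('a \<times> 'b \<Rightarrow> 'k) set"
  where "tensor_rels K V W =
    (let F = free_module K (carrier V \<times> carrier W) in lin_span K F
      ({gen K (v \<oplus>\<^bsub>V\<^esub> v', w) \<ominus>\<^bsub>F\<^esub> (gen K (v, w) \<oplus>\<^bsub>F\<^esub> gen K (v', w)) | v v' w.
          v \<in> carrier V \<and> v' \<in> carrier V \<and> w \<in> carrier W} \<union>
       {gen K (v, w \<oplus>\<^bsub>W\<^esub> w') \<ominus>\<^bsub>F\<^esub> (gen K (v, w) \<oplus>\<^bsub>F\<^esub> gen K (v, w')) | v w w'.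
          v \<in> carrier V \<and> w \<in> carrier W \<and> w' \<in> carrier W} \<union>
       {gen K (a \<odot>\<^bsub>V\<^esub> v, w) \<ominus>\<^bsub>F\<^esub> a \<odot>\<^bsub>F\<^esub> gen K (v, w) | a v w.
          a \<in> carrier K \<and> v \<in> carrier V \<and> w \<in> carrier W} \<union>
       {gen K (v, a \<odot>\<^bsub>W\<^esub> w) \<ominus>\<^bsub>F\<^esub> a \<odot>\<^bsub>F\<^esub> gen K (v, w) | a v w.
          a \<in> carrier K \<and> v \<in> carrier V \<and> w \<in> carrier W}))"

definition tensor ::
  "('k,'r) ring_scheme \<Rightarrow> ('k,'a,'e) module_scheme \<Rightarrow> ('k,'b,'f) module_scheme \<Rightarrow>
   ('k, ('a \<times> 'b \<Rightarrow> 'k) set) module"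
  where "tensor K V W = quot_module (free_module K (carrier V \<times> carrier W)) (tensor_rels K V W)"

definition tens ::
  "('k,'r) ring_scheme \<Rightarrow> ('k,'a,'e) module_scheme \<Rightarrow> ('k,'b,'f) module_scheme \<Rightarrow>
   'a \<Rightarrow> 'b \<Rightarrow> ('a \<times> 'b \<Rightarrow> 'k) set"
  where "tens K V W v w =
    tensor_rels K V W +>\<^bsub>free_module K (carrier V \<times> carrier W)\<^esub> gen K (v, w)"


subsection \<open>Tensor powers of a vector space\<close>

definition tpow_rels ::
  "('k,'r) ring_scheme \<Rightarrow> ('k,'a,'e) module_scheme \<Rightarrow> nat \<Rightarrow> ('a list \<Rightarrow> 'k) set"
  where "tpow_rels K V k =
    (let F = free_module K (vlists V k) in lin_span K F
      ({gen K (xs[i := v \<oplus>\<^bsub>V\<^esub> v']) \<ominus>\<^bsub>F\<^esub> (gen K (xs[i := v]) \<oplus>\<^bsub>F\<^esub> gen K (xs[i := v'])) | xs i v v'.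
          xs \<in> vlists V k \<and> i < k \<and> v \<in> carrier V \<and> v' \<in> carrier V} \<union>
       {gen K (xs[i := a \<odot>\<^bsub>V\<^esub> v]) \<ominus>\<^bsub>F\<^esub> a \<odot>\<^bsub>F\<^esub> gen K (xs[i := v]) | xs i a v.
          xs \<in> vlists V k \<and> i < k \<and> a \<in> carrier K \<and> v \<in> carrier V}))"

text \<open>For \<open>k = 0\<close> this is the one-dimensional space spanned by the empty tensor, i.e. \<open>K\<close>.\<close>

definition tpow ::
  "('k,'r) ring_scheme \<Rightarrow> ('k,'a,'e) module_scheme \<Rightarrow> nat \<Rightarrow> ('k, ('a list \<Rightarrow> 'k) set) module"
  where "tpow K V k = quot_module (free_module K (vlists V k)) (tpow_rels K V k)"

definition pure ::
  "('k,'r) ring_scheme \<Rightarrow> ('k,'a,'e) module_scheme \<Rightarrow> 'a list \<Rightarrow> ('a list \<Rightarrow> 'k) set"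
  where "pure K V xs =
    tpow_rels K V (length xs) +>\<^bsub>free_module K (vlists V (length xs))\<^esub> gen K xs"


subsection \<open>Maps determined by their values on generators\<close>

text \<open>
  \<open>lin_ext K V W X p \<phi>\<close> is the linear map \<open>f : V \<rightarrow> W\<close> with \<open>f (p x) = \<phi> x\<close> for \<open>x \<in> X\<close>, and
  \<open>bilin_ext\<close> is the analogue for bilinear maps. Below, the elements \<open>p x\<close> are always the pure
  tensors, which span \<open>V\<close>, so that the choice is unique on the carrier.
\<close>

definition lin_ext ::
  "('k,'r) ring_scheme \<Rightarrow> ('k,'a,'e) module_scheme \<Rightarrow> ('k,'b,'f) module_scheme \<Rightarrow>
   'x set \<Rightarrow> ('x \<Rightarrow> 'a) \<Rightarrow> ('x \<Rightarrow> 'b) \<Rightarrow> 'a \<Rightarrow> 'b"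
  where "lin_ext K V W X p \<phi> = (SOME f. linear_map K V W f \<and> (\<forall>x\<in>X. f (p x) = \<phi> x))"

definition bilin_ext ::
  "('k,'r) ring_scheme \<Rightarrow> ('k,'a,'e) module_scheme \<Rightarrow> ('k,'b,'f) module_scheme \<Rightarrow>
   ('k,'c,'g) module_scheme \<Rightarrow> 'x set \<Rightarrow> ('x \<Rightarrow> 'a) \<Rightarrow> 'y set \<Rightarrow> ('y \<Rightarrow> 'b) \<Rightarrow>
   ('x \<Rightarrow> 'y \<Rightarrow> 'c) \<Rightarrow> 'a \<Rightarrow> 'b \<Rightarrow> 'c"
  where "bilin_ext K V W U X p Y q \<phi> =
    (SOME b. bilinear_map K V W U b \<and> (\<forall>x\<in>X. \<forall>y\<in>Y. b (p x) (q y) = \<phi> x y))"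


section \<open>Leibniz \<open>n\<close>-algebras\<close>

text \<open>The \<open>n\<close>-ary bracket is a function on lists, of which only the lists of length \<open>n\<close> matter.\<close>

record ('k, 'a) nleibniz = "('k, 'a) module" +
  nbr :: "'a list \<Rightarrow> 'a"

definition leibniz_n_algebra ::
  "('k,'r) ring_scheme \<Rightarrow> nat \<Rightarrow> ('k,'a,'e) nleibniz_scheme \<Rightarrow> bool"
  where "leibniz_n_algebra K n A \<longleftrightarrow>
    module K A \<and>
    nbr A \<in> vlists A n \<rightarrow> carrier A \<and>
    multilinear_map K n A A (nbr A) \<and>
    (\<forall>xs\<in>vlists A n. \<forall>ys\<in>vlists A (n - 1).
       nbr A (nbr A xs # ys) = (\<Oplus>\<^bsub>A\<^esub>i\<in>{..<n}. nbr A (xs[i := nbr A (xs ! i # ys)])))"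

abbreviation leibniz_algebra :: "('k,'r) ring_scheme \<Rightarrow> ('k,'a,'e) nleibniz_scheme \<Rightarrow> bool"
  where "leibniz_algebra K L \<equiv> leibniz_n_algebra K 2 L"

abbreviation br :: "('k,'a,'e) nleibniz_scheme \<Rightarrow> 'a \<Rightarrow> 'a \<Rightarrow> 'a"
  where "br L x y \<equiv> nbr L [x, y]"

definition perfect :: "('k,'r) ring_scheme \<Rightarrow> ('k,'a,'e) nleibniz_scheme \<Rightarrow> bool"
  where "perfect K L \<longleftrightarrow>
    lin_span K L {br L x y | x y. x \<in> carrier L \<and> y \<in> carrier L} = carrier L"

fun iter_br :: "('k,'a,'e) nleibniz_scheme \<Rightarrow> 'a list \<Rightarrow> 'a" where
  "iter_br L [] = undefined"
| "iter_br L [x] = x"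
| "iter_br L (x # y # zs) = br L x (iter_br L (y # zs))"

text \<open>
  The Leibniz \<open>n\<close>-algebra \<open>\<UU>\<^sub>n(L)\<close>. The list bracket is the same expression for all \<open>n\<close>; the
  arity enters through the length of the lists it is applied to.
\<close>

definition U_alg :: "('k,'a,'e) nleibniz_scheme \<Rightarrow> ('k,'a,'e) nleibniz_scheme"
  where "U_alg L = L\<lparr>nbr := iter_br L\<rparr>"

text \<open>The Leibniz algebra \<open>\<DD>\<^sub>n(A)\<close> on the \<open>(n-1)\<close>-st tensor power of \<open>A\<close>.\<close>

definition D_br ::
  "('k,'r) ring_scheme \<Rightarrow> nat \<Rightarrow> ('k,'a,'e) nleibniz_scheme \<Rightarrow>
   ('a list \<Rightarrow> 'k) set \<Rightarrow> ('a list \<Rightarrow> 'k) set \<Rightarrow> ('a list \<Rightarrow> 'k) set"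
  where "D_br K n A = (let T = tpow K A (n - 1) in
    bilin_ext K T T T (vlists A (n - 1)) (pure K A) (vlists A (n - 1)) (pure K A)
      (\<lambda>ls ls'. \<Oplus>\<^bsub>T\<^esub>i\<in>{..<n - 1}. pure K A (ls[i := nbr A (ls ! i # ls')])))"

definition D_alg ::
  "('k,'r) ring_scheme \<Rightarrow> nat \<Rightarrow> ('k,'a,'e) nleibniz_scheme \<Rightarrow> ('k, ('a list \<Rightarrow> 'k) set) nleibniz"
  where "D_alg K n A =
    module.extend (tpow K A (n - 1)) (nleibniz.fields (\<lambda>ts. D_br K n A (ts ! 0) (ts ! 1)))"


section \<open>Homology of complexes\<close>

text \<open>
  A complex consists of spaces \<open>C k\<close> and maps \<open>d k : C k \<rightarrow> C (k - 1)\<close> for \<open>k \<ge> 1\<close>; the boundary on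
  \<open>C 0\<close> is zero, and \<open>d 0\<close> is not used.
\<close>

definition cycles :: "(nat \<Rightarrow> ('k,'a,'e) module_scheme) \<Rightarrow> (nat \<Rightarrow> 'a \<Rightarrow> 'a) \<Rightarrow> nat \<Rightarrow> 'a set"
  where "cycles C d k = {z \<in> carrier (C k). k = 0 \<or> d k z = \<zero>\<^bsub>C (k - 1)\<^esub>}"

definition boundaries :: "(nat \<Rightarrow> ('k,'a,'e) module_scheme) \<Rightarrow> (nat \<Rightarrow> 'a \<Rightarrow> 'a) \<Rightarrow> nat \<Rightarrow> 'a set"
  where "boundaries C d k = d (Suc k) ` carrier (C (Suc k))"

definition homology ::
  "(nat \<Rightarrow> ('k,'a,'e) module_scheme) \<Rightarrow> (nat \<Rightarrow> 'a \<Rightarrow> 'a) \<Rightarrow> nat \<Rightarrow> ('k,'a set) module"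
  where "homology C d k = quot_module ((C k)\<lparr>carrier := cycles C d k\<rparr>) (boundaries C d k)"

definition hclass ::
  "(nat \<Rightarrow> ('k,'a,'e) module_scheme) \<Rightarrow> (nat \<Rightarrow> 'a \<Rightarrow> 'a) \<Rightarrow> nat \<Rightarrow> 'a \<Rightarrow> 'a set"
  where "hclass C d k z = boundaries C d k +>\<^bsub>C k\<^esub> z"

text \<open>The map of homology spaces, into the homology of \<open>(C', d')\<close>, induced by \<open>f\<close>.\<close>

definition induced ::
  "(nat \<Rightarrow> ('k,'b,'e) module_scheme) \<Rightarrow> (nat \<Rightarrow> 'b \<Rightarrow> 'b) \<Rightarrow> (nat \<Rightarrow> 'a \<Rightarrow> 'b) \<Rightarrow>
   nat \<Rightarrow> 'a set \<Rightarrow> 'b set"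
  where "induced C' d' f k X = (\<Union>z\<in>X. hclass C' d' k (f k z))"


section \<open>The Leibniz complex\<close>

text \<open>The data of a co-representation: a space with a right and a left action of \<open>\<gg>\<close>.\<close>

record ('k, 'm, 'g) corep = "('k, 'm) module" +
  ract :: "'m \<Rightarrow> 'g \<Rightarrow> 'm"
  lact :: "'g \<Rightarrow> 'm \<Rightarrow> 'm"

definition CL ::
  "('k,'r) ring_scheme \<Rightarrow> ('k,'g,'e) nleibniz_scheme \<Rightarrow> ('k,'m,'g,'f) corep_scheme \<Rightarrow> nat \<Rightarrow>
   ('k, ('m \<times> ('g list \<Rightarrow> 'k) set \<Rightarrow> 'k) set) module"
  where "CL K g M k = tensor K M (tpow K g k)"

text \<open>The pure tensor \<open>m \<otimes> x\<^sub>1 \<otimes> \<dots> \<otimes> x\<^sub>k\<close>, where \<open>xs = [x\<^sub>1, \<dots>, x\<^sub>k]\<close>.\<close>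

definition cl ::
  "('k,'r) ring_scheme \<Rightarrow> ('k,'g,'e) nleibniz_scheme \<Rightarrow> ('k,'m,'g,'f) corep_scheme \<Rightarrow>
   'm \<Rightarrow> 'g list \<Rightarrow> ('m \<times> ('g list \<Rightarrow> 'k) set \<Rightarrow> 'k) set"
  where "cl K g M m xs = tens K M (tpow K g (length xs)) m (pure K g xs)"

text \<open>List positions are counted from 1, so that the formulas have the usual indices.\<close>

definition ent :: "'a list \<Rightarrow> nat \<Rightarrow> 'a"
  where "ent xs i = xs ! (i - 1)"

definition omit :: "nat \<Rightarrow> 'a list \<Rightarrow> 'a list"
  where "omit i xs = take (i - 1) xs @ drop i xs"

definition CL_d ::
  "('k,'r) ring_scheme \<Rightarrow> ('k,'g,'e) nleibniz_scheme \<Rightarrow> ('k,'m,'g,'f) corep_scheme \<Rightarrow> nat \<Rightarrow>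
   ('m \<times> ('g list \<Rightarrow> 'k) set \<Rightarrow> 'k) set \<Rightarrow> ('m \<times> ('g list \<Rightarrow> 'k) set \<Rightarrow> 'k) set"
  where "CL_d K g M k = (let C = CL K g M (k - 1); sgn = (\<lambda>i::nat. (\<ominus>\<^bsub>K\<^esub> \<one>\<^bsub>K\<^esub>) [^]\<^bsub>K\<^esub> i) in
    lin_ext K (CL K g M k) C (carrier M \<times> vlists g k) (\<lambda>(m, xs). cl K g M m xs)
      (\<lambda>(m, xs).
        cl K g M (ract M m (ent xs 1)) (omit 1 xs) \<oplus>\<^bsub>C\<^esub>
        (\<Oplus>\<^bsub>C\<^esub>i\<in>{2..k}. sgn i \<odot>\<^bsub>C\<^esub> cl K g M (lact M (ent xs i) m) (omit i xs)) \<oplus>\<^bsub>C\<^esub>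
        finsum C (\<lambda>(i, j). sgn (j + 1) \<odot>\<^bsub>C\<^esub>
            cl K g M m (omit j (xs[i - 1 := br g (ent xs i) (ent xs j)])))
          {(i, j). 1 \<le> i \<and> i < j \<and> j \<le> k}))"


section \<open>The complex of a Leibniz \<open>n\<close>-algebra with trivial coefficients\<close>

text \<open>
  A trivial co-representation \<open>M\<close> of a Leibniz \<open>n\<close>-algebra (zero actions) is just a vector space.
  \<open>D_corep K n A M\<close> is \<open>M \<otimes> A\<close> as a co-representation of \<open>\<DD>\<^sub>n(A)\<close>.
\<close>

definition D_ract ::
  "('k,'r) ring_scheme \<Rightarrow> nat \<Rightarrow> ('k,'a,'e) nleibniz_scheme \<Rightarrow> ('k,'m,'f) module_scheme \<Rightarrow>
   ('m \<times> 'a \<Rightarrow> 'k) set \<Rightarrow> ('a list \<Rightarrow> 'k) set \<Rightarrow> ('m \<times> 'a \<Rightarrow> 'k) set"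
  where "D_ract K n A M =
    bilin_ext K (tensor K M A) (tpow K A (n - 1)) (tensor K M A)
      (carrier M \<times> carrier A) (\<lambda>(m, l). tens K M A m l) (vlists A (n - 1)) (pure K A)
      (\<lambda>(m, l) ls. tens K M A m (nbr A (l # ls)))"

definition D_lact ::
  "('k,'r) ring_scheme \<Rightarrow> nat \<Rightarrow> ('k,'a,'e) nleibniz_scheme \<Rightarrow> ('k,'m,'f) module_scheme \<Rightarrow>
   ('a list \<Rightarrow> 'k) set \<Rightarrow> ('m \<times> 'a \<Rightarrow> 'k) set \<Rightarrow> ('m \<times> 'a \<Rightarrow> 'k) set"
  where "D_lact K n A M =
    bilin_ext K (tpow K A (n - 1)) (tensor K M A) (tensor K M A)
      (vlists A (n - 1)) (pure K A) (carrier M \<times> carrier A) (\<lambda>(m, l). tens K M A m l)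
      (\<lambda>ls (m, l). \<ominus>\<^bsub>tensor K M A\<^esub> tens K M A m (nbr A (l # ls)))"

definition D_corep ::
  "('k,'r) ring_scheme \<Rightarrow> nat \<Rightarrow> ('k,'a,'e) nleibniz_scheme \<Rightarrow> ('k,'m,'f) module_scheme \<Rightarrow>
   ('k, ('m \<times> 'a \<Rightarrow> 'k) set, ('a list \<Rightarrow> 'k) set) corep"
  where "D_corep K n A M =
    module.extend (tensor K M A) (corep.fields (D_ract K n A M) (D_lact K n A M))"

text \<open>
  For \<open>n = 2\<close> the algebra \<open>\<DD>\<^sub>2(L)\<close> lives on the first tensor power of \<open>L\<close>, which is identified
  with \<open>L\<close> by \<open>pure K L [x] \<leftrightarrow> x\<close>. In degree 0 the space \<open>nCL K n A M 0\<close> is a copy of \<open>M \<otimes> A\<close>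
  not depending on \<open>n\<close> or the bracket.
\<close>

definition nCL where "nCL K n A M = CL K (D_alg K n A) (D_corep K n A M)"

definition nCL_d where "nCL_d K n A M = CL_d K (D_alg K n A) (D_corep K n A M)"

definition nHL where "nHL K n A M = homology (nCL K n A M) (nCL_d K n A M)"

text \<open>The pure tensor \<open>m \<otimes> l \<otimes> (l\<^sub>1\<^sup>1 \<otimes> \<dots> \<otimes> l\<^sub>n\<^sub>-\<^sub>1\<^sup>1) \<otimes> \<dots> \<otimes> (l\<^sub>1\<^sup>k \<otimes> \<dots> \<otimes> l\<^sub>n\<^sub>-\<^sub>1\<^sup>k)\<close>.\<close>

definition ncl where
  "ncl K n A M m l lss =
    cl K (D_alg K n A) (D_corep K n A M) (tens K M A m l) (map (pure K A) lss)"

definition h_map where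
  "h_map K n L M k =
    lin_ext K (nCL K n (U_alg L) M k) (nCL K 2 L M k)
      (carrier M \<times> carrier L \<times> {lss. length lss = k \<and> set lss \<subseteq> vlists L (n - 1)})
      (\<lambda>(m, l, lss). ncl K n (U_alg L) M m l lss)
      (\<lambda>(m, l, lss). ncl K 2 L M m l (map (\<lambda>ls. [iter_br L ls]) lss))"

definition h_bar where
  "h_bar K n L M = induced (nCL K 2 L M) (nCL_d K 2 L M) (h_map K n L M)"

end

theory Submission
  imports Defs
begin

text \<open>
  The contraction \<open>l\<^sub>1 \<otimes> \<dots> \<otimes> l\<^sub>n\<^sub>-\<^sub>1 \<mapsto> [l\<^sub>1, [l\<^sub>2, \<dots>]]\<close> is a homomorphism of Leibniz algebras from
  \<open>\<DD>\<^sub>n(\<UU>\<^sub>n(L))\<close> to \<open>\<DD>\<^sub>2(L)\<close>, because right multiplication is a derivation of the iterated bracket, and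
  it is compatible with the actions on \<open>M \<otimes> L\<close>. By functoriality of the Leibniz complex it induces
  the chain map \<open>h\<close>, which is the identity in degree 0. If \<open>L\<close> is perfect, then iterated brackets of
  every length span \<open>L\<close>; hence both complexes have the same boundaries (all of \<open>M \<otimes> L\<close>) in degree 0,
  and \<open>h\<^sub>1\<close> is surjective. A preimage under \<open>h\<^sub>1\<close> of a cycle is a cycle, since \<open>h\<^sub>0\<close> is injective.
\<close>

subsection \<open>Linear maps and submodules\<close>

text \<open>The brackets, actions, boundaries and \<open>h_map\<close> are all choices of a map with
  prescribed values on pure tensors, so nothing is known about them until such a map has been shown
  to exist. This obstacle accounts for most of the development: \<open>tensor\<close> and
  \<open>tpow\<close> receive their universal properties, and each defining formula is checked to be
  linear in every slot, also where entries of a list are replaced and deleted. Uniqueness comes from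
  spanning by pure tensors, and equalities between maps are verified there.

  The contraction respects brackets for the following reason. In \<open>U_alg L\<close> the bracket
  of \<open>l # ls\<close> is \<open>[l, y]\<close>, where \<open>y\<close> is the iterated bracket
  of \<open>ls\<close>. Hence a pure tensor of \<open>ls\<close> acts on every slot as right
  multiplication by the single element \<open>y\<close> of \<open>L\<close>, and a derivation rule
  for one element is all that has to be summed up.\<close>

lemma linear_mapI:
  assumes "\<And>x. x \<in> carrier V \<Longrightarrow> f x \<in> carrier W"
    and "\<And>x y. x \<in> carrier V \<Longrightarrow> y \<in> carrier V \<Longrightarrow> f (x \<oplus>\<^bsub>V\<^esub> y) = f x \<oplus>\<^bsub>W\<^esub> f y"
    and "\<And>a x. a \<in> carrier K \<Longrightarrow> x \<in> carrier V \<Longrightarrow> f (a \<odot>\<^bsub>V\<^esub> x) = a \<odot>\<^bsub>W\<^esub> f x"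
  shows "linear_map K V W f"
  using assms by (auto simp: linear_map_def)

lemma linear_map_closed: "linear_map K V W f \<Longrightarrow> x \<in> carrier V \<Longrightarrow> f x \<in> carrier W"
  by (auto simp: linear_map_def)

lemma linear_map_add:
  "linear_map K V W f \<Longrightarrow> x \<in> carrier V \<Longrightarrow> y \<in> carrier V \<Longrightarrow> f (x \<oplus>\<^bsub>V\<^esub> y) = f x \<oplus>\<^bsub>W\<^esub> f y"
  by (auto simp: linear_map_def)

lemma linear_map_smult:
  "linear_map K V W f \<Longrightarrow> a \<in> carrier K \<Longrightarrow> x \<in> carrier V \<Longrightarrow> f (a \<odot>\<^bsub>V\<^esub> x) = a \<odot>\<^bsub>W\<^esub> f x"
  by (auto simp: linear_map_def)

lemma linear_map_zero:
  assumes "module K V" "module K W" "linear_map K V W f"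
  shows "f \<zero>\<^bsub>V\<^esub> = \<zero>\<^bsub>W\<^esub>"
proof -
  interpret V: module K V by fact
  interpret W: module K W by fact
  have "f (\<zero>\<^bsub>K\<^esub> \<odot>\<^bsub>V\<^esub> \<zero>\<^bsub>V\<^esub>) = \<zero>\<^bsub>K\<^esub> \<odot>\<^bsub>W\<^esub> f \<zero>\<^bsub>V\<^esub>"
    by (rule linear_map_smult[OF assms(3)]) auto
  then show ?thesis
    using linear_map_closed[OF assms(3) V.zero_closed] by simp
qed

lemma linear_map_neg:
  assumes "module K V" "module K W" "linear_map K V W f" "x \<in> carrier V"
  shows "f (\<ominus>\<^bsub>V\<^esub> x) = \<ominus>\<^bsub>W\<^esub> f x"
proof -
  interpret V: module K V by fact
  interpret W: module K W by fact
  have "f ((\<ominus>\<^bsub>K\<^esub> \<one>\<^bsub>K\<^esub>) \<odot>\<^bsub>V\<^esub> x) = (\<ominus>\<^bsub>K\<^esub> \<one>\<^bsub>K\<^esub>) \<odot>\<^bsub>W\<^esub> f x"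
    by (rule linear_map_smult[OF assms(3)]) (use assms(4) in auto)
  then show ?thesis
    using linear_map_closed[OF assms(3,4)] assms(4)
    by (simp add: V.smult_l_minus W.smult_l_minus)
qed

lemma linear_map_minus:
  assumes "module K V" "module K W" "linear_map K V W f" "x \<in> carrier V" "y \<in> carrier V"
  shows "f (x \<ominus>\<^bsub>V\<^esub> y) = f x \<ominus>\<^bsub>W\<^esub> f y"
proof -
  interpret V: module K V by fact
  show ?thesis
    using assms by (simp add: a_minus_def linear_map_add linear_map_neg)
qed

lemma linear_map_finsum:
  assumes "module K V" "module K W" "linear_map K V W f" "g \<in> A \<rightarrow> carrier V"
  shows "f (\<Oplus>\<^bsub>V\<^esub>i\<in>A. g i) = (\<Oplus>\<^bsub>W\<^esub>i\<in>A. f (g i))"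
proof -
  interpret V: module K V by fact
  interpret W: module K W by fact
  show ?thesis
    using assms(4)
  proof (induction A rule: infinite_finite_induct)
    \<comment> \<open>A sum over an infinite index set is zero by convention, on both sides.\<close>
    case (infinite A)
    then show ?case by (simp add: linear_map_zero[OF assms(1-3)])
  next
    case empty
    then show ?case by (simp add: linear_map_zero[OF assms(1-3)])
  next
    case (insert x A)
    have "(\<lambda>i. f (g i)) \<in> A \<rightarrow> carrier W" "f (g x) \<in> carrier W"
      using insert.prems linear_map_closed[OF assms(3)] by auto
    with insert show ?case
      by (simp add: linear_map_add[OF assms(3)])
  qed
qed

text \<open>Linearity sees a function only on the carrier. This serves where a rewriting such as
  \<open>cl_eq_tens\<close> is valid for arguments in the carrier only.\<close>

lemma linear_map_cong:
  assumes "module K V" "\<And>x. x \<in> carrier V \<Longrightarrow> f x = g x"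
  shows "linear_map K V W f \<longleftrightarrow> linear_map K V W g"
proof -
  interpret V: module K V by fact
  show ?thesis by (auto simp: linear_map_def assms(2) Pi_def)
qed

section \<open>Composition and pointwise operations on linear maps\<close>

lemma linear_map_ident: "linear_map K V V (\<lambda>x. x)"
  by (simp add: linear_map_def)

lemma linear_map_compose:
  "linear_map K V W f \<Longrightarrow> linear_map K W U g \<Longrightarrow> linear_map K V U (\<lambda>x. g (f x))"
  by (auto simp: linear_map_def Pi_def)

lemma linear_map_add_fun:
  assumes "module K W" "linear_map K V W f" "linear_map K V W g"
  shows "linear_map K V W (\<lambda>x. f x \<oplus>\<^bsub>W\<^esub> g x)"
proof -
  interpret W: module K W by fact
  note cl = linear_map_closed[OF assms(2)] linear_map_closed[OF assms(3)]
  show ?thesis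
    by (rule linear_mapI)
      (use cl in \<open>auto simp: linear_map_add[OF assms(2)] linear_map_add[OF assms(3)]
        linear_map_smult[OF assms(2)] linear_map_smult[OF assms(3)] W.smult_r_distr W.a_ac\<close>)
qed

lemma linear_map_smult_fun:
  assumes "module K W" "linear_map K V W f" "a \<in> carrier K"
  shows "linear_map K V W (\<lambda>x. a \<odot>\<^bsub>W\<^esub> f x)"
proof -
  interpret W: module K W by fact
  note cl = linear_map_closed[OF assms(2)]
  show ?thesis
    by (rule linear_mapI)
      (use cl assms(3) in \<open>auto simp: linear_map_add[OF assms(2)] linear_map_smult[OF assms(2)]
        W.smult_r_distr W.smult_assoc1[symmetric] W.m_comm\<close>)
qed

lemma linear_map_zero_fun:
  assumes "module K W"
  shows "linear_map K V W (\<lambda>x. \<zero>\<^bsub>W\<^esub>)"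
proof -
  interpret W: module K W by fact
  show ?thesis by (rule linear_mapI) auto
qed

lemma linear_map_neg_fun:
  assumes "module K W" "linear_map K V W f"
  shows "linear_map K V W (\<lambda>x. \<ominus>\<^bsub>W\<^esub> f x)"
proof -
  interpret W: module K W by fact
  note cl = linear_map_closed[OF assms(2)]
  show ?thesis
    by (rule linear_mapI)
      (use cl in \<open>auto simp: linear_map_add[OF assms(2)] linear_map_smult[OF assms(2)]
        W.minus_add W.smult_r_minus W.a_comm\<close>)
qed

lemma linear_map_finsum_fun:
  assumes "module K W" "\<And>i. i \<in> A \<Longrightarrow> linear_map K V W (f i)"
  shows "linear_map K V W (\<lambda>x. \<Oplus>\<^bsub>W\<^esub>i\<in>A. f i x)"
proof -
  interpret W: module K W by fact
  have cl: "(\<lambda>i. f i x) \<in> A \<rightarrow> carrier W" if "x \<in> carrier V" for x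
    using assms(2) that by (auto intro: linear_map_closed)
  show ?thesis
  proof (rule linear_mapI)
    fix x y assume xy: "x \<in> carrier V" "y \<in> carrier V"
    have "(\<Oplus>\<^bsub>W\<^esub>i\<in>A. f i (x \<oplus>\<^bsub>V\<^esub> y)) = (\<Oplus>\<^bsub>W\<^esub>i\<in>A. f i x \<oplus>\<^bsub>W\<^esub> f i y)"
      by (rule W.finsum_cong') (use cl[OF xy(1)] cl[OF xy(2)] xy assms(2) in
        \<open>auto simp: linear_map_add[OF assms(2)] Pi_def\<close>)
    then show "(\<Oplus>\<^bsub>W\<^esub>i\<in>A. f i (x \<oplus>\<^bsub>V\<^esub> y)) = (\<Oplus>\<^bsub>W\<^esub>i\<in>A. f i x) \<oplus>\<^bsub>W\<^esub> (\<Oplus>\<^bsub>W\<^esub>i\<in>A. f i y)"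
      using W.finsum_addf[OF cl[OF xy(1)] cl[OF xy(2)]] by simp
  next
    fix a x assume ax: "a \<in> carrier K" "x \<in> carrier V"
    have "(\<Oplus>\<^bsub>W\<^esub>i\<in>A. f i (a \<odot>\<^bsub>V\<^esub> x)) = (\<Oplus>\<^bsub>W\<^esub>i\<in>A. a \<odot>\<^bsub>W\<^esub> f i x)"
      by (rule W.finsum_cong') (use cl[OF ax(2)] ax assms(2) in
        \<open>auto simp: linear_map_smult[OF assms(2)] Pi_def\<close>)
    \<comment> \<open>Scaling by \<open>a\<close> is itself a linear map, so
      \<open>linear_map_finsum\<close> moves it out of the sum.\<close>
    also have "\<dots> = a \<odot>\<^bsub>W\<^esub> (\<Oplus>\<^bsub>W\<^esub>i\<in>A. f i x)"
      by (rule linear_map_finsum[symmetric, OF assms(1) assms(1)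
            linear_map_smult_fun[OF assms(1) linear_map_ident ax(1)] cl[OF ax(2)]])
    finally show "(\<Oplus>\<^bsub>W\<^esub>i\<in>A. f i (a \<odot>\<^bsub>V\<^esub> x)) = a \<odot>\<^bsub>W\<^esub> (\<Oplus>\<^bsub>W\<^esub>i\<in>A. f i x)" .
  qed (use cl in auto)
qed

section \<open>Submodules obtained from linear maps, and linear spans\<close>

lemma submodule_vimage:
  assumes "module K V" "module K W" "linear_map K V W f" "submodule S K W"
  shows "submodule {x \<in> carrier V. f x \<in> S} K V"
proof -
  interpret V: module K V by fact
  interpret W: module K W by fact
  note S = W.submoduleE[OF assms(4)]
  have "\<zero>\<^bsub>W\<^esub> \<in> S"
    using subgroup.one_closed[OF submodule.axioms(1)[OF assms(4)]] by simp
  then show ?thesis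
    by (intro V.submoduleI) (use S assms(3) in \<open>auto simp: linear_map_zero[OF assms(1-3)]
      linear_map_neg[OF assms(1-3)] linear_map_add linear_map_smult\<close>)
qed

lemma submodule_image:
  assumes "module K V" "module K W" "linear_map K V W f" "submodule S K V"
  shows "submodule (f ` S) K W"
proof -
  interpret V: module K V by fact
  interpret W: module K W by fact
  note S = V.submoduleE[OF assms(4)]
  have z: "\<zero>\<^bsub>V\<^esub> \<in> S"
    using subgroup.one_closed[OF submodule.axioms(1)[OF assms(4)]] by simp
  show ?thesis
  proof (rule W.submoduleI)
    show "f ` S \<subseteq> carrier W" using S(1) linear_map_closed[OF assms(3)] by auto
    show "\<zero>\<^bsub>W\<^esub> \<in> f ` S" using z linear_map_zero[OF assms(1-3)] by (metis imageI)
    show "\<ominus>\<^bsub>W\<^esub> a \<in> f ` S" if "a \<in> f ` S" for a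
      using that S(1,3) linear_map_neg[OF assms(1-3)] by (metis (no_types, lifting) imageE imageI subsetD)
    show "a \<oplus>\<^bsub>W\<^esub> b \<in> f ` S" if "a \<in> f ` S" "b \<in> f ` S" for a b
      using that S(1,5) linear_map_add[OF assms(3)] by (smt (verit) imageE imageI subsetD)
    show "a \<odot>\<^bsub>W\<^esub> b \<in> f ` S" if "a \<in> carrier K" "b \<in> f ` S" for a b
      using that S(1,4) linear_map_smult[OF assms(3)] by (smt (verit) imageE imageI subsetD)
  qed
qed

lemma submodule_zero: "submodule S K V \<Longrightarrow> \<zero>\<^bsub>V\<^esub> \<in> S"
  using subgroup.one_closed[OF submodule.axioms(1)] by fastforce

lemma submodule_singleton_zero:
  assumes "module K V"
  shows "submodule {\<zero>\<^bsub>V\<^esub>} K V"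
proof -
  interpret V: module K V by fact
  show ?thesis by (rule V.submoduleI) auto
qed

lemma submodule_equalizer:
  assumes "module K V" "module K W" "linear_map K V W f" "linear_map K V W g"
  shows "submodule {x \<in> carrier V. f x = g x} K V"
proof -
  interpret V: module K V by fact
  show ?thesis
    by (intro V.submoduleI)
      (auto simp: linear_map_zero[OF assms(1-3)] linear_map_zero[OF assms(1,2,4)]
        linear_map_neg[OF assms(1-3)] linear_map_neg[OF assms(1,2,4)]
        linear_map_add[OF assms(3)] linear_map_add[OF assms(4)]
        linear_map_smult[OF assms(3)] linear_map_smult[OF assms(4)])
qed

text \<open>The inclusion of \<open>S\<close> in the carrier puts the whole space into the
  intersected family. Over an empty family the intersection would be the whole type.\<close>

lemma lin_span_submodule:
  assumes "module K V" "S \<subseteq> carrier V"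
  shows "submodule (lin_span K V S) K V"
proof -
  interpret V: module K V by fact
  note E = V.submoduleE
  show ?thesis
    unfolding lin_span_def
    by (intro V.submoduleI)
      (use V.carrier_is_submodule assms(2) in \<open>auto intro: submodule_zero E(3-5)\<close>)
qed

lemma lin_span_superset: "S \<subseteq> lin_span K V S"
  by (auto simp: lin_span_def)

lemma lin_span_least: "submodule W K V \<Longrightarrow> S \<subseteq> W \<Longrightarrow> lin_span K V S \<subseteq> W"
  by (auto simp: lin_span_def)

lemma lin_span_closed: "module K V \<Longrightarrow> S \<subseteq> carrier V \<Longrightarrow> lin_span K V S \<subseteq> carrier V"
  by (meson lin_span_least module.carrier_is_submodule)

text \<open>The equalizer of \<open>f\<close> and \<open>g\<close> is a submodule, so it contains
  the span of \<open>S\<close> once it contains \<open>S\<close>. This is the uniqueness half of the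
  universal properties below.\<close>

lemma linear_map_eqI:
  assumes "module K V" "module K W" "linear_map K V W f" "linear_map K V W g"
    and "lin_span K V S = carrier V" "\<And>x. x \<in> S \<Longrightarrow> f x = g x" "x \<in> carrier V"
  shows "f x = g x"
proof -
  have "S \<subseteq> carrier V" using lin_span_superset[of S K V] assms(5) by simp
  then have "lin_span K V S \<subseteq> {x \<in> carrier V. f x = g x}"
    using assms(6) by (intro lin_span_least submodule_equalizer[OF assms(1-4)]) auto
  with assms(5,7) show ?thesis by auto
qed

lemma linear_map_surjI:
  assumes "module K V" "module K W" "linear_map K V W f"
    and "lin_span K W S = carrier W" "S \<subseteq> f ` carrier V"
  shows "f ` carrier V = carrier W"
proof
  show "f ` carrier V \<subseteq> carrier W" using linear_map_closed[OF assms(3)] by auto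
  show "carrier W \<subseteq> f ` carrier V"
    using lin_span_least[OF submodule_image[OF assms(1-3) module.carrier_is_submodule[OF assms(1)]] assms(5)]
      assms(4) by simp
qed

subsection \<open>Quotient spaces\<close>

lemma coset_add:
  assumes "module K V" "submodule S K V" "x \<in> carrier V" "y \<in> carrier V"
  shows "(S +>\<^bsub>V\<^esub> x) <+>\<^bsub>V\<^esub> (S +>\<^bsub>V\<^esub> y) = S +>\<^bsub>V\<^esub> (x \<oplus>\<^bsub>V\<^esub> y)"
proof -
  interpret V: module K V by fact
  interpret S: abelian_subgroup S V
    using submodule.axioms(1)[OF assms(2)] V.a_comm_group by (rule_tac abelian_subgroupI2)
  show ?thesis by (rule S.a_rcos_sum[OF assms(3,4)])
qed

lemma coset_absorb:
  assumes "module K V" "submodule S K V" "x \<in> carrier V" "s \<in> S"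
  shows "S +>\<^bsub>V\<^esub> (s \<oplus>\<^bsub>V\<^esub> x) = S +>\<^bsub>V\<^esub> x"
proof -
  interpret V: module K V by fact
  have "s \<oplus>\<^bsub>V\<^esub> x \<in> S +>\<^bsub>V\<^esub> x" using assms(4) by (auto simp: a_r_coset_def')
  from V.a_repr_independence[OF this assms(3) submodule.axioms(1)[OF assms(2)]]
  show ?thesis by simp
qed

lemma coset_self:
  assumes "module K V" "submodule S K V" "x \<in> carrier V"
  shows "x \<in> S +>\<^bsub>V\<^esub> x"
proof -
  interpret V: module K V by fact
  show ?thesis using submodule_zero[OF assms(2)] assms(3) by (force simp: a_r_coset_def')
qed

lemma coset_eq_iff:
  assumes "module K V" "submodule S K V" "x \<in> carrier V" "y \<in> carrier V"
  shows "S +>\<^bsub>V\<^esub> x = S +>\<^bsub>V\<^esub> y \<longleftrightarrow> x \<ominus>\<^bsub>V\<^esub> y \<in> S"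
proof -
  interpret V: module K V by fact
  have S: "S \<subseteq> carrier V" using V.submoduleE(1)[OF assms(2)] .
  show ?thesis
  proof
    assume "S +>\<^bsub>V\<^esub> x = S +>\<^bsub>V\<^esub> y"
    then obtain s where "s \<in> S" "x = s \<oplus>\<^bsub>V\<^esub> y"
      using coset_self[OF assms(1-3)] by (auto simp: a_r_coset_def')
    then show "x \<ominus>\<^bsub>V\<^esub> y \<in> S"
      using S assms(4) by (auto simp: a_minus_def V.a_assoc V.r_neg subsetD)
  next
    assume "x \<ominus>\<^bsub>V\<^esub> y \<in> S"
    from coset_absorb[OF assms(1,2,4) this] show "S +>\<^bsub>V\<^esub> x = S +>\<^bsub>V\<^esub> y"
      using assms(3,4) by (simp add: a_minus_def V.a_assoc V.l_neg)
  qed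
qed

text \<open>The left side is scalar multiplication in \<open>quot_module\<close>, a union over all
  representatives. They differ by elements of \<open>S\<close>, which stay in \<open>S\<close> after
  scaling, so every member of the union is the same coset.\<close>

lemma coset_smult:
  assumes "module K V" "submodule S K V" "x \<in> carrier V" "a \<in> carrier K"
  shows "(\<Union>y\<in>S +>\<^bsub>V\<^esub> x. S +>\<^bsub>V\<^esub> (a \<odot>\<^bsub>V\<^esub> y)) = S +>\<^bsub>V\<^esub> (a \<odot>\<^bsub>V\<^esub> x)"
proof -
  interpret V: module K V by fact
  note S = V.submoduleE[OF assms(2)]
  have "S +>\<^bsub>V\<^esub> (a \<odot>\<^bsub>V\<^esub> y) = S +>\<^bsub>V\<^esub> (a \<odot>\<^bsub>V\<^esub> x)" if y: "y \<in> S +>\<^bsub>V\<^esub> x" for y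
  proof -
    obtain s where s: "s \<in> S" "y = s \<oplus>\<^bsub>V\<^esub> x" using y by (auto simp: a_r_coset_def')
    then have "a \<odot>\<^bsub>V\<^esub> y = a \<odot>\<^bsub>V\<^esub> s \<oplus>\<^bsub>V\<^esub> a \<odot>\<^bsub>V\<^esub> x"
      using S(1) assms(3,4) V.smult_r_distr[of a s x] by auto
    then show ?thesis
      using coset_absorb[OF assms(1,2), of "a \<odot>\<^bsub>V\<^esub> x" "a \<odot>\<^bsub>V\<^esub> s"] S(4) s assms(3,4) by simp
  qed
  then show ?thesis using coset_self[OF assms(1-3)] by blast
qed

lemma carrier_quot_module:
  "carrier (quot_module V S) = (\<lambda>x. S +>\<^bsub>V\<^esub> x) ` carrier V"
  by (auto simp: quot_module_def A_RCOSETS_def')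

lemma quot_module_module:
  assumes "module K V" "submodule S K V"
  shows "module K (quot_module V S)"
proof -
  interpret V: module K V by fact
  note a = coset_add[OF assms] and s = coset_smult[OF assms]
  have z: "S = S +>\<^bsub>V\<^esub> \<zero>\<^bsub>V\<^esub>" using V.submoduleE(1)[OF assms(2)] by simp
  have c: "carrier (quot_module V S) = (\<lambda>x. S +>\<^bsub>V\<^esub> x) ` carrier V" by (rule carrier_quot_module)
  have ad: "(S +>\<^bsub>V\<^esub> x) \<oplus>\<^bsub>quot_module V S\<^esub> (S +>\<^bsub>V\<^esub> y) = S +>\<^bsub>V\<^esub> (x \<oplus>\<^bsub>V\<^esub> y)"
    if "x \<in> carrier V" "y \<in> carrier V" for x y using a that by (simp add: quot_module_def)
  have sm: "b \<odot>\<^bsub>quot_module V S\<^esub> (S +>\<^bsub>V\<^esub> x) = S +>\<^bsub>V\<^esub> (b \<odot>\<^bsub>V\<^esub> x)"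
    if "x \<in> carrier V" "b \<in> carrier K" for b x using s that by (simp add: quot_module_def)
  have ze: "\<zero>\<^bsub>quot_module V S\<^esub> = S +>\<^bsub>V\<^esub> \<zero>\<^bsub>V\<^esub>" using z by (simp add: quot_module_def)
  show ?thesis
  proof (rule moduleI)
    show "cring K" by (rule V.is_cring)
    show "abelian_group (quot_module V S)"
    proof (rule abelian_groupI)
      show "\<exists>y\<in>carrier (quot_module V S). y \<oplus>\<^bsub>quot_module V S\<^esub> x = \<zero>\<^bsub>quot_module V S\<^esub>"
        if x: "x \<in> carrier (quot_module V S)" for x
      proof -
        obtain v where v: "v \<in> carrier V" "x = S +>\<^bsub>V\<^esub> v" using x c by auto
        have "(S +>\<^bsub>V\<^esub> (\<ominus>\<^bsub>V\<^esub> v)) \<oplus>\<^bsub>quot_module V S\<^esub> x = \<zero>\<^bsub>quot_module V S\<^esub>"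
          using v by (simp add: ad ze V.l_neg)
        then show ?thesis using v c by blast
      qed
    qed (auto simp: c ad ze V.a_ac)
  qed (auto simp: c ad sm V.smult_l_distr V.smult_r_distr V.smult_assoc1)
qed

lemma coset_linear_map:
  assumes "module K V" "submodule S K V"
  shows "linear_map K V (quot_module V S) (\<lambda>x. S +>\<^bsub>V\<^esub> x)"
  by (rule linear_mapI)
    (auto simp: carrier_quot_module quot_module_def coset_add[OF assms] coset_smult[OF assms] A_RCOSETS_def')

text \<open>The map is defined through chosen representatives. The choice is harmless because two
  representatives of one coset differ by an element of \<open>S\<close>, which \<open>f\<close>
  kills.\<close>

lemma quot_module_lift:
  assumes "module K V" "submodule S K V" "module K W" "linear_map K V W f"
    and "\<And>x. x \<in> S \<Longrightarrow> f x = \<zero>\<^bsub>W\<^esub>"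
  shows "\<exists>g. linear_map K (quot_module V S) W g \<and> (\<forall>x\<in>carrier V. g (S +>\<^bsub>V\<^esub> x) = f x)"
proof -
  interpret V: module K V by fact
  interpret W: module K W by fact
  define g where "g X = f (SOME x. x \<in> carrier V \<and> X = S +>\<^bsub>V\<^esub> x)" for X
  have g: "g (S +>\<^bsub>V\<^esub> x) = f x" if x: "x \<in> carrier V" for x
  proof -
    define y where "y = (SOME y. y \<in> carrier V \<and> S +>\<^bsub>V\<^esub> x = S +>\<^bsub>V\<^esub> y)"
    have y: "y \<in> carrier V \<and> S +>\<^bsub>V\<^esub> x = S +>\<^bsub>V\<^esub> y"
      unfolding y_def by (rule someI[of _ x]) (use x in simp)
    then have "f (x \<ominus>\<^bsub>V\<^esub> y) = \<zero>\<^bsub>W\<^esub>"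
      using assms(5) coset_eq_iff[OF assms(1,2) x, of y] by auto
    then have "f x \<ominus>\<^bsub>W\<^esub> f y = \<zero>\<^bsub>W\<^esub>"
      using linear_map_minus[OF assms(1,3,4)] x y by simp
    moreover have "f x = (f x \<ominus>\<^bsub>W\<^esub> f y) \<oplus>\<^bsub>W\<^esub> f y"
      using linear_map_closed[OF assms(4)] x y by (simp add: a_minus_def W.a_assoc W.l_neg)
    ultimately have "f x = f y"
      using linear_map_closed[OF assms(4)] y by simp
    then show ?thesis by (simp add: g_def y_def)
  qed
  note p = coset_linear_map[OF assms(1,2)]
  have "linear_map K (quot_module V S) W g"
    by (rule linear_mapI)
      (auto simp: carrier_quot_module linear_map_add[OF p, symmetric] linear_map_smult[OF p, symmetric]
        g linear_map_closed[OF assms(4)] linear_map_add[OF assms(4)] linear_map_smult[OF assms(4)])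
  with g show ?thesis by blast
qed

subsection \<open>Free modules\<close>

lemma free_module_carrier:
  "f \<in> carrier (free_module K X) \<longleftrightarrow>
    (\<forall>x. f x \<in> carrier K) \<and> finite {x. f x \<noteq> \<zero>\<^bsub>K\<^esub>} \<and> {x. f x \<noteq> \<zero>\<^bsub>K\<^esub>} \<subseteq> X"
  by (auto simp: free_module_def)

lemma free_module_add: "f \<oplus>\<^bsub>free_module K X\<^esub> g = (\<lambda>x. f x \<oplus>\<^bsub>K\<^esub> g x)"
  by (simp add: free_module_def)

lemma free_module_smult: "a \<odot>\<^bsub>free_module K X\<^esub> f = (\<lambda>x. a \<otimes>\<^bsub>K\<^esub> f x)"
  by (simp add: free_module_def)

lemma free_module_zero: "\<zero>\<^bsub>free_module K X\<^esub> = (\<lambda>x. \<zero>\<^bsub>K\<^esub>)"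
  by (simp add: free_module_def)

lemma free_module_module:
  assumes "cring K"
  shows "module K (free_module K X)"
proof -
  interpret K: cring K by fact
  let ?F = "free_module K X"
  note sel = free_module_add free_module_smult free_module_zero
  have cl: "f x \<in> carrier K" if "f \<in> carrier ?F" for f x using that by (simp add: free_module_carrier)
  have addc: "f \<oplus>\<^bsub>?F\<^esub> g \<in> carrier ?F" if fg: "f \<in> carrier ?F" "g \<in> carrier ?F" for f g
  proof -
    have "{x. f x \<oplus>\<^bsub>K\<^esub> g x \<noteq> \<zero>\<^bsub>K\<^esub>} \<subseteq> {x. f x \<noteq> \<zero>\<^bsub>K\<^esub>} \<union> {x. g x \<noteq> \<zero>\<^bsub>K\<^esub>}" by auto
    then have "finite {x. f x \<oplus>\<^bsub>K\<^esub> g x \<noteq> \<zero>\<^bsub>K\<^esub>} \<and> {x. f x \<oplus>\<^bsub>K\<^esub> g x \<noteq> \<zero>\<^bsub>K\<^esub>} \<subseteq> X"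
      using fg unfolding free_module_carrier by (meson Un_least finite_UnI rev_finite_subset subset_trans)
    then show ?thesis using fg by (simp add: sel free_module_carrier)
  qed
  have smc: "a \<odot>\<^bsub>?F\<^esub> f \<in> carrier ?F" if f: "a \<in> carrier K" "f \<in> carrier ?F" for a f
  proof -
    have "{x. a \<otimes>\<^bsub>K\<^esub> f x \<noteq> \<zero>\<^bsub>K\<^esub>} \<subseteq> {x. f x \<noteq> \<zero>\<^bsub>K\<^esub>}" using f by auto
    then have "finite {x. a \<otimes>\<^bsub>K\<^esub> f x \<noteq> \<zero>\<^bsub>K\<^esub>} \<and> {x. a \<otimes>\<^bsub>K\<^esub> f x \<noteq> \<zero>\<^bsub>K\<^esub>} \<subseteq> X"
      using f unfolding free_module_carrier by (meson rev_finite_subset subset_trans)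
    then show ?thesis using f by (simp add: sel free_module_carrier)
  qed
  show ?thesis
  proof (rule moduleI)
    show "abelian_group ?F"
    proof (rule abelian_groupI)
      show "\<exists>g\<in>carrier ?F. g \<oplus>\<^bsub>?F\<^esub> f = \<zero>\<^bsub>?F\<^esub>" if f: "f \<in> carrier ?F" for f
      proof (rule bexI)
        show "(\<ominus>\<^bsub>K\<^esub> \<one>\<^bsub>K\<^esub>) \<odot>\<^bsub>?F\<^esub> f \<in> carrier ?F" by (rule smc[OF _ f]) simp
        show "(\<ominus>\<^bsub>K\<^esub> \<one>\<^bsub>K\<^esub>) \<odot>\<^bsub>?F\<^esub> f \<oplus>\<^bsub>?F\<^esub> f = \<zero>\<^bsub>?F\<^esub>"
          using cl[OF f] by (simp add: sel K.l_minus K.l_neg)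
      qed
    qed (use addc cl in \<open>auto simp: sel free_module_carrier K.a_ac\<close>)
  qed (use assms smc cl in \<open>auto simp: sel K.l_distr K.r_distr K.m_assoc\<close>)
qed

lemma gen_closed:
  assumes "cring K" "x \<in> X"
  shows "gen K x \<in> carrier (free_module K X)"
proof -
  interpret K: cring K by fact
  have "{y. gen K x y \<noteq> \<zero>\<^bsub>K\<^esub>} \<subseteq> {x}" by (auto simp: gen_def)
  moreover from this have "finite {y. gen K x y \<noteq> \<zero>\<^bsub>K\<^esub>}" by (rule finite_subset) simp
  ultimately show ?thesis using assms by (auto simp: free_module_carrier gen_def)
qed

lemma free_module_span:
  assumes "cring K"
  shows "lin_span K (free_module K X) (gen K ` X) = carrier (free_module K X)"
proof
  interpret K: cring K by fact
  let ?F = "free_module K X"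
  interpret F: module K ?F by (rule free_module_module[OF assms])
  have g: "gen K ` X \<subseteq> carrier ?F" using gen_closed[OF assms] by auto
  show "lin_span K ?F (gen K ` X) \<subseteq> carrier ?F"
    by (rule lin_span_closed[OF F.module_axioms g])
  note W = lin_span_submodule[OF F.module_axioms g]
  \<comment> \<open>The induction runs over a finite set \<open>A\<close> containing the support
    rather than over the support itself: zeroing the coefficient at \<open>x\<close> leaves a
    function supported in the smaller set, whatever that coefficient was.\<close>
  have "f \<in> lin_span K ?F (gen K ` X)"
    if "finite A" "f \<in> carrier ?F" "{x. f x \<noteq> \<zero>\<^bsub>K\<^esub>} \<subseteq> A" for A f
    using that
  proof (induction A arbitrary: f)
    case empty
    then have "f = \<zero>\<^bsub>?F\<^esub>" by (auto simp: free_module_zero)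
    then show ?case using submodule_zero[OF W] by simp
  next
    case (insert x A)
    have fc: "f y \<in> carrier K" for y using insert.prems by (simp add: free_module_carrier)
    define h where "h = f(x := \<zero>\<^bsub>K\<^esub>)"
    have hs: "{y. h y \<noteq> \<zero>\<^bsub>K\<^esub>} \<subseteq> {y. f y \<noteq> \<zero>\<^bsub>K\<^esub>} - {x}" by (auto simp: h_def)
    then have "h \<in> carrier ?F"
      using insert.prems(1) fc unfolding free_module_carrier
      by (auto simp: h_def intro: finite_subset)
    moreover have "{y. h y \<noteq> \<zero>\<^bsub>K\<^esub>} \<subseteq> A" using hs insert.prems(2) by auto
    ultimately have h: "h \<in> lin_span K ?F (gen K ` X)" by (rule insert.IH)
    show ?case
    proof (cases "f x = \<zero>\<^bsub>K\<^esub>")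
      case True
      then have "h = f" by (auto simp: h_def)
      with h show ?thesis by simp
    next
      case False
      then have "gen K x \<in> lin_span K ?F (gen K ` X)"
        using insert.prems(1) lin_span_superset[of "gen K ` X" K ?F] by (auto simp: free_module_carrier)
      then have "h \<oplus>\<^bsub>?F\<^esub> f x \<odot>\<^bsub>?F\<^esub> gen K x \<in> lin_span K ?F (gen K ` X)"
        using F.submoduleE(4,5)[OF W] h fc by simp
      moreover have "h \<oplus>\<^bsub>?F\<^esub> f x \<odot>\<^bsub>?F\<^esub> gen K x = f"
        using fc by (auto simp: h_def free_module_add free_module_smult gen_def)
      ultimately show ?thesis by simp
    qed
  qed
  then show "carrier ?F \<subseteq> lin_span K ?F (gen K ` X)"
    by (auto simp: free_module_carrier)
qed

text \<open>The linear extension of \<open>\<phi>\<close> to finitely supported functions. The index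
  set is the support and so changes with \<open>f\<close>; \<open>free_ext_superset\<close> removes
  this dependence.\<close>

definition free_ext ::
  "('k,'r) ring_scheme \<Rightarrow> ('k,'a,'e) module_scheme \<Rightarrow> ('x \<Rightarrow> 'a) \<Rightarrow> ('x \<Rightarrow> 'k) \<Rightarrow> 'a"
  where "free_ext K W \<phi> f = (\<Oplus>\<^bsub>W\<^esub>x\<in>{x. f x \<noteq> \<zero>\<^bsub>K\<^esub>}. f x \<odot>\<^bsub>W\<^esub> \<phi> x)"

lemma free_ext_superset:
  assumes "module K W" "\<phi> \<in> X \<rightarrow> carrier W" "f \<in> carrier (free_module K X)"
    and "finite A" "A \<subseteq> X" "{x. f x \<noteq> \<zero>\<^bsub>K\<^esub>} \<subseteq> A"
  shows "free_ext K W \<phi> f = (\<Oplus>\<^bsub>W\<^esub>x\<in>A. f x \<odot>\<^bsub>W\<^esub> \<phi> x)"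
proof -
  interpret W: module K W by fact
  show ?thesis
    unfolding free_ext_def
    by (rule W.add.finprod_mono_neutral_cong_left)
      (use assms in \<open>auto simp: free_module_carrier Pi_def subset_iff\<close>)
qed

lemma free_ext_linear_map:
  assumes "module K W" "\<phi> \<in> X \<rightarrow> carrier W"
  shows "linear_map K (free_module K X) W (free_ext K W \<phi>)"
proof -
  interpret W: module K W by fact
  let ?F = "free_module K X"
  interpret F: module K ?F by (rule free_module_module) (rule W.is_cring)
  note sup = free_ext_superset[OF assms]
  have fc: "f x \<in> carrier K" if "f \<in> carrier ?F" for f x using that by (simp add: free_module_carrier)
  have cl: "(\<lambda>x. f x \<odot>\<^bsub>W\<^esub> \<phi> x) \<in> A \<rightarrow> carrier W" if "f \<in> carrier ?F" "A \<subseteq> X" for f A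
    using that assms(2) fc by (auto simp: Pi_def)
  show ?thesis
  proof (rule linear_mapI)
    fix f assume f: "f \<in> carrier ?F"
    then show "free_ext K W \<phi> f \<in> carrier W"
      unfolding free_ext_def by (intro W.finsum_closed cl) (auto simp: free_module_carrier)
  next
    fix f g assume f: "f \<in> carrier ?F" and g: "g \<in> carrier ?F"
    \<comment> \<open>A common finite index set for \<open>f\<close>, \<open>g\<close> and their
      sum, whose support may be smaller through cancellation.\<close>
    define A where "A = {x. f x \<noteq> \<zero>\<^bsub>K\<^esub>} \<union> {x. g x \<noteq> \<zero>\<^bsub>K\<^esub>}"
    have A: "finite A" "A \<subseteq> X" "{x. f x \<noteq> \<zero>\<^bsub>K\<^esub>} \<subseteq> A" "{x. g x \<noteq> \<zero>\<^bsub>K\<^esub>} \<subseteq> A"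
      "{x. (f \<oplus>\<^bsub>?F\<^esub> g) x \<noteq> \<zero>\<^bsub>K\<^esub>} \<subseteq> A"
      using f g by (auto simp: A_def free_module_carrier free_module_add)
    have "free_ext K W \<phi> (f \<oplus>\<^bsub>?F\<^esub> g) = (\<Oplus>\<^bsub>W\<^esub>x\<in>A. (f \<oplus>\<^bsub>?F\<^esub> g) x \<odot>\<^bsub>W\<^esub> \<phi> x)"
      using f g A by (intro sup) auto
    also have "\<dots> = (\<Oplus>\<^bsub>W\<^esub>x\<in>A. f x \<odot>\<^bsub>W\<^esub> \<phi> x \<oplus>\<^bsub>W\<^esub> g x \<odot>\<^bsub>W\<^esub> \<phi> x)"
      by (rule W.finsum_cong') (use A(2) fc[OF f] fc[OF g] assms(2) in
        \<open>auto simp: free_module_add W.smult_l_distr Pi_def subset_iff\<close>)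
    also have "\<dots> = (\<Oplus>\<^bsub>W\<^esub>x\<in>A. f x \<odot>\<^bsub>W\<^esub> \<phi> x) \<oplus>\<^bsub>W\<^esub> (\<Oplus>\<^bsub>W\<^esub>x\<in>A. g x \<odot>\<^bsub>W\<^esub> \<phi> x)"
      by (rule W.finsum_addf[OF cl[OF f A(2)] cl[OF g A(2)]])
    finally show "free_ext K W \<phi> (f \<oplus>\<^bsub>?F\<^esub> g) = free_ext K W \<phi> f \<oplus>\<^bsub>W\<^esub> free_ext K W \<phi> g"
      using sup[OF f A(1,2,3)] sup[OF g A(1,2,4)] by simp
  next
    fix a f assume a: "a \<in> carrier K" and f: "f \<in> carrier ?F"
    define A where "A = {x. f x \<noteq> \<zero>\<^bsub>K\<^esub>}"
    have A: "finite A" "A \<subseteq> X" "{x. f x \<noteq> \<zero>\<^bsub>K\<^esub>} \<subseteq> A" "{x. (a \<odot>\<^bsub>?F\<^esub> f) x \<noteq> \<zero>\<^bsub>K\<^esub>} \<subseteq> A"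
      using a f by (auto simp: A_def free_module_carrier free_module_smult)
    have "free_ext K W \<phi> (a \<odot>\<^bsub>?F\<^esub> f) = (\<Oplus>\<^bsub>W\<^esub>x\<in>A. (a \<odot>\<^bsub>?F\<^esub> f) x \<odot>\<^bsub>W\<^esub> \<phi> x)"
      using a f A by (intro sup) auto
    also have "\<dots> = (\<Oplus>\<^bsub>W\<^esub>x\<in>A. a \<odot>\<^bsub>W\<^esub> (f x \<odot>\<^bsub>W\<^esub> \<phi> x))"
      by (rule W.finsum_cong') (use A(2) a fc[OF f] assms(2) in
        \<open>auto simp: free_module_smult W.smult_assoc1 Pi_def subset_iff\<close>)
    also have "\<dots> = a \<odot>\<^bsub>W\<^esub> (\<Oplus>\<^bsub>W\<^esub>x\<in>A. f x \<odot>\<^bsub>W\<^esub> \<phi> x)"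
      by (rule W.finsum_smult_ldistr[symmetric, OF A(1) a cl[OF f A(2)]])
    finally show "free_ext K W \<phi> (a \<odot>\<^bsub>?F\<^esub> f) = a \<odot>\<^bsub>W\<^esub> free_ext K W \<phi> f"
      using sup[OF f A(1-3)] by simp
  qed
qed

lemma free_ext_gen:
  assumes "module K W" "\<phi> \<in> X \<rightarrow> carrier W" "x \<in> X"
  shows "free_ext K W \<phi> (gen K x) = \<phi> x"
proof -
  interpret W: module K W by fact
  have "free_ext K W \<phi> (gen K x) = (\<Oplus>\<^bsub>W\<^esub>y\<in>{x}. gen K x y \<odot>\<^bsub>W\<^esub> \<phi> y)"
    by (rule free_ext_superset[OF assms(1,2) gen_closed[OF W.is_cring assms(3)]])
      (use assms(3) in \<open>auto simp: gen_def\<close>)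
  then show ?thesis using assms(2,3) by (simp add: gen_def Pi_def)
qed

subsection \<open>Modules given by generators and relations\<close>

text \<open>The common form of \<open>tensor\<close> and \<open>tpow\<close>. Here \<open>R\<close>
  is the bare set of relators, before the span is taken, so that a map out of the quotient has to be
  tested on the relators alone.\<close>

definition pres_module ::
  "('k,'r) ring_scheme \<Rightarrow> 'x set \<Rightarrow> ('x \<Rightarrow> 'k) set \<Rightarrow> ('k, ('x \<Rightarrow> 'k) set) module"
  where "pres_module K X R =
    quot_module (free_module K X) (lin_span K (free_module K X) R)"

definition pres_gen ::
  "('k,'r) ring_scheme \<Rightarrow> 'x set \<Rightarrow> ('x \<Rightarrow> 'k) set \<Rightarrow> 'x \<Rightarrow> ('x \<Rightarrow> 'k) set"
  where "pres_gen K X R x = lin_span K (free_module K X) R +>\<^bsub>free_module K X\<^esub> gen K x"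

context
  fixes K :: "('k,'r) ring_scheme" and X :: "'x set" and R :: "('x \<Rightarrow> 'k) set"
  assumes K: "cring K" and R: "R \<subseteq> carrier (free_module K X)"
begin

lemma pres_rels_submodule: "submodule (lin_span K (free_module K X) R) K (free_module K X)"
  by (rule lin_span_submodule[OF free_module_module[OF K] R])

lemma pres_module_module: "module K (pres_module K X R)"
  unfolding pres_module_def
  by (rule quot_module_module[OF free_module_module[OF K] pres_rels_submodule])

lemma pres_proj_linear_map:
  "linear_map K (free_module K X) (pres_module K X R)
    (\<lambda>f. lin_span K (free_module K X) R +>\<^bsub>free_module K X\<^esub> f)"
  unfolding pres_module_def
  by (rule coset_linear_map[OF free_module_module[OF K] pres_rels_submodule])

lemma pres_gen_closed: "x \<in> X \<Longrightarrow> pres_gen K X R x \<in> carrier (pres_module K X R)"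
  unfolding pres_gen_def
  by (rule linear_map_closed[OF pres_proj_linear_map gen_closed[OF K]])

lemma pres_module_span:
  "lin_span K (pres_module K X R) (pres_gen K X R ` X) = carrier (pres_module K X R)"
    (is "?S = _")
proof
  let ?F = "free_module K X" and ?P = "pres_module K X R"
  let ?p = "\<lambda>f. lin_span K ?F R +>\<^bsub>?F\<^esub> f"
  have g: "pres_gen K X R ` X \<subseteq> carrier ?P" using pres_gen_closed by auto
  show "?S \<subseteq> carrier ?P" by (rule lin_span_closed[OF pres_module_module g])
  note vi = submodule_vimage[OF free_module_module[OF K] pres_module_module pres_proj_linear_map
      lin_span_submodule[OF pres_module_module g]]
  have "gen K ` X \<subseteq> {f \<in> carrier ?F. ?p f \<in> ?S}"
    using lin_span_superset[of "pres_gen K X R ` X" K ?P] gen_closed[OF K]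
    by (auto simp: pres_gen_def)
  from lin_span_least[OF vi this] have "carrier ?F \<subseteq> {f \<in> carrier ?F. ?p f \<in> ?S}"
    by (simp add: free_module_span[OF K])
  then show "carrier ?P \<subseteq> ?S"
    by (auto simp: pres_module_def carrier_quot_module)
qed

text \<open>Turns a relator into an equation between classes. Bilinearity of \<open>tens\<close> and
  multilinearity of \<open>pure\<close> are read off from the relators in this way.\<close>

lemma pres_module_rel:
  assumes "f \<ominus>\<^bsub>free_module K X\<^esub> g \<in> R" "f \<in> carrier (free_module K X)" "g \<in> carrier (free_module K X)"
  shows "lin_span K (free_module K X) R +>\<^bsub>free_module K X\<^esub> f =
    lin_span K (free_module K X) R +>\<^bsub>free_module K X\<^esub> g"
  by (rule iffD2[OF coset_eq_iff[OF free_module_module[OF K] pres_rels_submodule assms(2,3)]])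
    (rule subsetD[OF lin_span_superset assms(1)])

text \<open>The kernel of \<open>free_ext K W \<phi>\<close> is a submodule. Once it contains
  \<open>R\<close> it contains the span of \<open>R\<close>, and the map descends to the
  quotient.\<close>

lemma pres_module_lift:
  assumes W: "module K W" and \<phi>: "\<phi> \<in> X \<rightarrow> carrier W"
    and rel: "\<And>r. r \<in> R \<Longrightarrow> free_ext K W \<phi> r = \<zero>\<^bsub>W\<^esub>"
  shows "\<exists>f. linear_map K (pres_module K X R) W f \<and> (\<forall>x\<in>X. f (pres_gen K X R x) = \<phi> x)"
proof -
  note F = free_module_module[OF K] and e = free_ext_linear_map[OF W \<phi>]
  have "R \<subseteq> {f \<in> carrier (free_module K X). free_ext K W \<phi> f \<in> {\<zero>\<^bsub>W\<^esub>}}"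
    using R rel by auto
  from lin_span_least[OF submodule_vimage[OF F W e submodule_singleton_zero[OF W]] this]
  have "free_ext K W \<phi> x = \<zero>\<^bsub>W\<^esub>" if "x \<in> lin_span K (free_module K X) R" for x
    using that by auto
  from quot_module_lift[OF F pres_rels_submodule W e this]
  show ?thesis
    using gen_closed[OF K] free_ext_gen[OF W \<phi>]
    unfolding pres_module_def pres_gen_def by metis
qed

end

subsection \<open>The tensor product\<close>

definition tensor_rel_gens ::
  "('k,'r) ring_scheme \<Rightarrow> ('k,'a,'e) module_scheme \<Rightarrow> ('k,'b,'f) module_scheme \<Rightarrow> ('a \<times> 'b \<Rightarrow> 'k) set"
  where "tensor_rel_gens K V W =
    (let F = free_module K (carrier V \<times> carrier W) in
      ({gen K (v \<oplus>\<^bsub>V\<^esub> v', w) \<ominus>\<^bsub>F\<^esub> (gen K (v, w) \<oplus>\<^bsub>F\<^esub> gen K (v', w)) | v v' w.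
          v \<in> carrier V \<and> v' \<in> carrier V \<and> w \<in> carrier W} \<union>
       {gen K (v, w \<oplus>\<^bsub>W\<^esub> w') \<ominus>\<^bsub>F\<^esub> (gen K (v, w) \<oplus>\<^bsub>F\<^esub> gen K (v, w')) | v w w'.
          v \<in> carrier V \<and> w \<in> carrier W \<and> w' \<in> carrier W} \<union>
       {gen K (a \<odot>\<^bsub>V\<^esub> v, w) \<ominus>\<^bsub>F\<^esub> a \<odot>\<^bsub>F\<^esub> gen K (v, w) | a v w.
          a \<in> carrier K \<and> v \<in> carrier V \<and> w \<in> carrier W} \<union>
       {gen K (v, a \<odot>\<^bsub>W\<^esub> w) \<ominus>\<^bsub>F\<^esub> a \<odot>\<^bsub>F\<^esub> gen K (v, w) | a v w.
          a \<in> carrier K \<and> v \<in> carrier V \<and> w \<in> carrier W}))"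

lemma tensor_eq_pres_module:
  "tensor K V W = pres_module K (carrier V \<times> carrier W) (tensor_rel_gens K V W)"
  by (simp add: tensor_def pres_module_def tensor_rels_def tensor_rel_gens_def Let_def)

lemma tens_eq_pres_gen:
  "tens K V W v w = pres_gen K (carrier V \<times> carrier W) (tensor_rel_gens K V W) (v, w)"
  by (simp add: tens_def pres_gen_def tensor_rels_def tensor_rel_gens_def Let_def)

lemma bilinear_mapI:
  assumes "\<And>v. v \<in> carrier V \<Longrightarrow> linear_map K W U (b v)"
    and "\<And>w. w \<in> carrier W \<Longrightarrow> linear_map K V U (\<lambda>v. b v w)"
  shows "bilinear_map K V W U b"
  using assms by (simp add: bilinear_map_def)

lemma bilinear_map_right: "bilinear_map K V W U b \<Longrightarrow> v \<in> carrier V \<Longrightarrow> linear_map K W U (b v)"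
  by (simp add: bilinear_map_def)

lemma bilinear_map_left: "bilinear_map K V W U b \<Longrightarrow> w \<in> carrier W \<Longrightarrow> linear_map K V U (\<lambda>v. b v w)"
  by (simp add: bilinear_map_def)

lemma bilinear_map_closed:
  "bilinear_map K V W U b \<Longrightarrow> v \<in> carrier V \<Longrightarrow> w \<in> carrier W \<Longrightarrow> b v w \<in> carrier U"
  by (meson bilinear_map_right linear_map_closed)

context
  fixes K :: "('k,'r) ring_scheme" and V :: "('k,'a,'e) module_scheme"
    and W :: "('k,'b,'f) module_scheme"
  assumes V: "module K V" and W: "module K W"
begin

interpretation V: module K V by (rule V)
interpretation W: module K W by (rule W)
interpretation F: module K "free_module K (carrier V \<times> carrier W)"
  by (rule free_module_module[OF V.is_cring])

private lemma gen_pair_closed [simp]: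
  "v \<in> carrier V \<Longrightarrow> w \<in> carrier W \<Longrightarrow> gen K (v, w) \<in> carrier (free_module K (carrier V \<times> carrier W))"
  by (rule gen_closed[OF V.is_cring]) simp

lemma tensor_rel_gens_closed:
  "tensor_rel_gens K V W \<subseteq> carrier (free_module K (carrier V \<times> carrier W))"
  unfolding tensor_rel_gens_def Let_def by auto

lemma tensor_module: "module K (tensor K V W)"
  unfolding tensor_eq_pres_module
  by (rule pres_module_module[OF V.is_cring tensor_rel_gens_closed])

lemma tensor_span:
  "lin_span K (tensor K V W) ((\<lambda>(v, w). tens K V W v w) ` (carrier V \<times> carrier W)) = carrier (tensor K V W)"
proof -
  have e: "(\<lambda>(v, w). tens K V W v w) = pres_gen K (carrier V \<times> carrier W) (tensor_rel_gens K V W)"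
    by (auto simp: tens_eq_pres_gen)
  show ?thesis
    unfolding e tensor_eq_pres_module
    by (rule pres_module_span[OF V.is_cring tensor_rel_gens_closed])
qed

lemma tens_bilinear: "bilinear_map K V W (tensor K V W) (tens K V W)"
proof -
  let ?F = "free_module K (carrier V \<times> carrier W)"
  interpret T: module K "tensor K V W" by (rule tensor_module)
  define p where "p f = lin_span K ?F (tensor_rel_gens K V W) +>\<^bsub>?F\<^esub> f" for f
  have p: "linear_map K ?F (tensor K V W) p"
    using pres_proj_linear_map[OF V.is_cring tensor_rel_gens_closed]
    by (simp add: p_def[abs_def] tensor_eq_pres_module)
  have eq: "p f = p g"
    if "f \<ominus>\<^bsub>?F\<^esub> g \<in> tensor_rel_gens K V W" "f \<in> carrier ?F" "g \<in> carrier ?F" for f g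
    unfolding p_def by (rule pres_module_rel[OF V.is_cring tensor_rel_gens_closed that])
  have t: "tens K V W v w = p (gen K (v, w))" for v w
    by (simp add: tens_eq_pres_gen pres_gen_def p_def)
  note ps = linear_map_closed[OF p] linear_map_add[OF p, symmetric] linear_map_smult[OF p, symmetric]
  show ?thesis
  proof (rule bilinear_mapI; rule linear_mapI; unfold t)
    fix v w w' assume "v \<in> carrier V" "w \<in> carrier W" "w' \<in> carrier W"
    then show "p (gen K (v, w \<oplus>\<^bsub>W\<^esub> w')) = p (gen K (v, w)) \<oplus>\<^bsub>tensor K V W\<^esub> p (gen K (v, w'))"
      by (simp add: ps) (rule eq; (force simp: tensor_rel_gens_def Let_def)?)
  next
    fix v w w' assume "w \<in> carrier W" "v \<in> carrier V" "w' \<in> carrier V"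
    then show "p (gen K (v \<oplus>\<^bsub>V\<^esub> w', w)) = p (gen K (v, w)) \<oplus>\<^bsub>tensor K V W\<^esub> p (gen K (w', w))"
      by (simp add: ps) (rule eq; (force simp: tensor_rel_gens_def Let_def)?)
  next
    fix v w a assume "v \<in> carrier V" "a \<in> carrier K" "w \<in> carrier W"
    then show "p (gen K (v, a \<odot>\<^bsub>W\<^esub> w)) = a \<odot>\<^bsub>tensor K V W\<^esub> p (gen K (v, w))"
      by (simp add: ps) (rule eq; (force simp: tensor_rel_gens_def Let_def)?)
  next
    fix v w a assume "w \<in> carrier W" "a \<in> carrier K" "v \<in> carrier V"
    then show "p (gen K (a \<odot>\<^bsub>V\<^esub> v, w)) = a \<odot>\<^bsub>tensor K V W\<^esub> p (gen K (v, w))"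
      by (simp add: ps) (rule eq; (force simp: tensor_rel_gens_def Let_def)?)
  qed (simp_all add: ps)
qed

lemma tensor_lift:
  assumes U: "module K U" and b: "bilinear_map K V W U b"
  shows "\<exists>f. linear_map K (tensor K V W) U f \<and>
    (\<forall>v\<in>carrier V. \<forall>w\<in>carrier W. f (tens K V W v w) = b v w)"
proof -
  interpret U: module K U by (rule U)
  have c: "(\<lambda>(v, w). b v w) \<in> carrier V \<times> carrier W \<rightarrow> carrier U"
    using bilinear_map_closed[OF b] by auto
  note e = free_ext_linear_map[OF U c]
  note es = linear_map_minus[OF F.module_axioms U e] linear_map_add[OF e] linear_map_smult[OF e]
    free_ext_gen[OF U c] bilinear_map_closed[OF b]
    linear_map_add[OF bilinear_map_right[OF b]] linear_map_smult[OF bilinear_map_right[OF b]]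
    linear_map_add[OF bilinear_map_left[OF b]] linear_map_smult[OF bilinear_map_left[OF b]]
  \<comment> \<open>Each of the four families of relators is killed by additivity or homogeneity of
    \<open>b\<close> in one of its arguments.\<close>
  have "free_ext K U (\<lambda>(v, w). b v w) r = \<zero>\<^bsub>U\<^esub>" if "r \<in> tensor_rel_gens K V W" for r
    using that unfolding tensor_rel_gens_def Let_def
    by (auto simp: es a_minus_def[of U] U.r_neg)
  from pres_module_lift[OF V.is_cring tensor_rel_gens_closed U c this]
  show ?thesis
    by (auto simp: tensor_eq_pres_module tens_eq_pres_gen)
qed

end

text \<open>Existence in each variable separately suffices. The elements \<open>w\<close> of
  \<open>Q\<close> over which a suitable linear map on \<open>P\<close> exists form a submodule; it
  contains the spanning family \<open>q\<close> by the hypothesis \<open>left\<close>, so it is all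
  of \<open>Q\<close>. The map over \<open>w\<close> is unique because \<open>p\<close> spans, and
  uniqueness forces linearity in \<open>w\<close>. No space of linear maps has to be
  constructed.\<close>

lemma bilinear_map_exists:
  assumes P: "module K P" and Q: "module K Q" and U: "module K U"
    and p: "lin_span K P (p ` X) = carrier P" and q: "lin_span K Q (q ` Y) = carrier Q"
    and right: "\<And>x. x \<in> X \<Longrightarrow> \<exists>f. linear_map K Q U f \<and> (\<forall>y\<in>Y. f (q y) = \<phi> x y)"
    and left: "\<And>y. y \<in> Y \<Longrightarrow> \<exists>f. linear_map K P U f \<and> (\<forall>x\<in>X. f (p x) = \<phi> x y)"
  shows "\<exists>b. bilinear_map K P Q U b \<and> (\<forall>x\<in>X. \<forall>y\<in>Y. b (p x) (q y) = \<phi> x y)"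
proof -
  interpret P: module K P by (rule P)
  interpret Q: module K Q by (rule Q)
  interpret U: module K U by (rule U)
  from right obtain B where B: "\<And>x. x \<in> X \<Longrightarrow> linear_map K Q U (B x)"
    "\<And>x y. x \<in> X \<Longrightarrow> y \<in> Y \<Longrightarrow> B x (q y) = \<phi> x y" by metis
  have pc: "x \<in> X \<Longrightarrow> p x \<in> carrier P" for x using lin_span_superset[of "p ` X" K P] p by auto
  have qc: "y \<in> Y \<Longrightarrow> q y \<in> carrier Q" for y using lin_span_superset[of "q ` Y" K Q] q by auto
  \<comment> \<open>\<open>E w f\<close> says that \<open>f\<close> is the slice at \<open>w\<close>
    of the bilinear map sought. \<open>B x\<close> extends the prescribed values from
    \<open>Y\<close> to all of \<open>Q\<close>, so that the condition makes sense for every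
    \<open>w\<close>.\<close>
  define E where "E w f \<longleftrightarrow> linear_map K P U f \<and> (\<forall>x\<in>X. f (p x) = B x w)" for w f
  note z = linear_map_zero[OF Q U B(1)] and n = linear_map_neg[OF Q U B(1)]
    and a = linear_map_add[OF B(1)] and s = linear_map_smult[OF B(1)]
  have E0: "E \<zero>\<^bsub>Q\<^esub> (\<lambda>v. \<zero>\<^bsub>U\<^esub>)"
    by (simp add: E_def z linear_map_zero_fun[OF U])
  have En: "E (\<ominus>\<^bsub>Q\<^esub> w) (\<lambda>v. \<ominus>\<^bsub>U\<^esub> f v)" if "w \<in> carrier Q" "E w f" for w f
    using that by (simp add: E_def n linear_map_neg_fun[OF U])
  have Ea: "E (w \<oplus>\<^bsub>Q\<^esub> w') (\<lambda>v. f v \<oplus>\<^bsub>U\<^esub> f' v)"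
    if "w \<in> carrier Q" "w' \<in> carrier Q" "E w f" "E w' f'" for w f w' f'
    using that by (simp add: E_def a linear_map_add_fun[OF U])
  have Es: "E (c \<odot>\<^bsub>Q\<^esub> w) (\<lambda>v. c \<odot>\<^bsub>U\<^esub> f v)" if "w \<in> carrier Q" "c \<in> carrier K" "E w f" for c w f
    using that by (simp add: E_def s linear_map_smult_fun[OF U])
  have uniq: "f v = g v" if "E w f" "E w g" "v \<in> carrier P" for w f g v
    by (rule linear_map_eqI[OF P U _ _ p]) (use that in \<open>auto simp: E_def\<close>)
  have "submodule {w \<in> carrier Q. \<exists>f. E w f} K Q"
    by (rule Q.submoduleI) (use E0 En Ea Es in \<open>auto; blast\<close>)+
  moreover have "q ` Y \<subseteq> {w \<in> carrier Q. \<exists>f. E w f}"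
    using left qc B(2) by (auto simp: E_def)
  ultimately have "carrier Q \<subseteq> {w \<in> carrier Q. \<exists>f. E w f}"
    using lin_span_least q by metis
  then have "\<forall>w. \<exists>f. w \<in> carrier Q \<longrightarrow> E w f" by blast
  then obtain b where b: "\<And>w. w \<in> carrier Q \<Longrightarrow> E w (b w)" by metis
  have "bilinear_map K P Q U (\<lambda>v w. b w v)"
  proof (rule bilinear_mapI)
    show "linear_map K P U (\<lambda>v. b w v)" if "w \<in> carrier Q" for w
      using b[OF that] by (simp add: E_def)
    show "linear_map K Q U (\<lambda>w. b w v)" if v: "v \<in> carrier P" for v
    proof (rule linear_mapI)
      show "b w v \<in> carrier U" if "w \<in> carrier Q" for w
        using b[OF that] v by (auto simp: E_def intro: linear_map_closed)
      show "b (w \<oplus>\<^bsub>Q\<^esub> w') v = b w v \<oplus>\<^bsub>U\<^esub> b w' v" if "w \<in> carrier Q" "w' \<in> carrier Q" for w w'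
        using uniq[OF b Ea[OF that b b] v] that by simp
      show "b (c \<odot>\<^bsub>Q\<^esub> w) v = c \<odot>\<^bsub>U\<^esub> b w v" if "c \<in> carrier K" "w \<in> carrier Q" for c w
        using uniq[OF b Es[OF that(2,1) b] v] that by simp
    qed
  qed
  moreover have "b (q y) (p x) = \<phi> x y" if "x \<in> X" "y \<in> Y" for x y
    using b[OF qc[OF that(2)]] B(2) that by (simp add: E_def)
  ultimately show ?thesis by blast
qed

lemma bilinear_map_eqI:
  assumes P: "module K P" and Q: "module K Q" and U: "module K U"
    and p: "lin_span K P S = carrier P" and q: "lin_span K Q T = carrier Q"
    and b: "bilinear_map K P Q U b" and c: "bilinear_map K P Q U c"
    and eq: "\<And>x y. x \<in> S \<Longrightarrow> y \<in> T \<Longrightarrow> b x y = c x y"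
    and v: "v \<in> carrier P" and w: "w \<in> carrier Q"
  shows "b v w = c v w"
proof (rule linear_map_eqI[OF P U bilinear_map_left[OF b w] bilinear_map_left[OF c w] p _ v])
  fix x assume x: "x \<in> S"
  then have xc: "x \<in> carrier P" using lin_span_superset[of S K P] p by auto
  show "b x w = c x w"
    by (rule linear_map_eqI[OF Q U bilinear_map_right[OF b xc] bilinear_map_right[OF c xc] q eq[OF x] w])
qed

subsection \<open>Tensor powers\<close>

definition tpow_rel_gens ::
  "('k,'r) ring_scheme \<Rightarrow> ('k,'a,'e) module_scheme \<Rightarrow> nat \<Rightarrow> ('a list \<Rightarrow> 'k) set"
  where "tpow_rel_gens K V k =
    (let F = free_module K (vlists V k) in
      ({gen K (xs[i := v \<oplus>\<^bsub>V\<^esub> v']) \<ominus>\<^bsub>F\<^esub> (gen K (xs[i := v]) \<oplus>\<^bsub>F\<^esub> gen K (xs[i := v'])) | xs i v v'.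
          xs \<in> vlists V k \<and> i < k \<and> v \<in> carrier V \<and> v' \<in> carrier V} \<union>
       {gen K (xs[i := a \<odot>\<^bsub>V\<^esub> v]) \<ominus>\<^bsub>F\<^esub> a \<odot>\<^bsub>F\<^esub> gen K (xs[i := v]) | xs i a v.
          xs \<in> vlists V k \<and> i < k \<and> a \<in> carrier K \<and> v \<in> carrier V}))"

lemma tpow_eq_pres_module: "tpow K V k = pres_module K (vlists V k) (tpow_rel_gens K V k)"
  by (simp add: tpow_def pres_module_def tpow_rels_def tpow_rel_gens_def Let_def)

lemma pure_eq_pres_gen:
  "xs \<in> vlists V k \<Longrightarrow> pure K V xs = pres_gen K (vlists V k) (tpow_rel_gens K V k) xs"
  by (auto simp: pure_def pres_gen_def tpow_rels_def tpow_rel_gens_def Let_def vlists_def)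

lemma vlists_update: "xs \<in> vlists V k \<Longrightarrow> v \<in> carrier V \<Longrightarrow> xs[i := v] \<in> vlists V k"
  using set_update_subset_insert[of xs i v] by (auto simp: vlists_def)

lemma vlists_nth: "xs \<in> vlists V k \<Longrightarrow> i < k \<Longrightarrow> xs ! i \<in> carrier V"
  by (auto simp: vlists_def)

lemma multilinear_mapI:
  assumes "\<And>xs i. xs \<in> vlists V k \<Longrightarrow> i < k \<Longrightarrow> linear_map K V W (\<lambda>v. f (xs[i := v]))"
  shows "multilinear_map K k V W f"
  using assms by (simp add: multilinear_map_def)

lemma multilinear_mapD:
  "multilinear_map K k V W f \<Longrightarrow> xs \<in> vlists V k \<Longrightarrow> i < k \<Longrightarrow> linear_map K V W (\<lambda>v. f (xs[i := v]))"
  by (simp add: multilinear_map_def)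

lemma multilinear_map_span:
  assumes V: "module K V" and U: "module K U" and f: "multilinear_map K k V U f"
    and S: "lin_span K V S = carrier V" and W: "submodule W K U"
    and fS: "\<And>xs. length xs = k \<Longrightarrow> set xs \<subseteq> S \<Longrightarrow> f xs \<in> W"
    and xs: "xs \<in> vlists V k"
  shows "f xs \<in> W"
proof -
  \<comment> \<open>Arbitrary entries are allowed at one more position at a time.\<close>
  have "f xs \<in> W" if "j \<le> k" "xs \<in> vlists V k" "\<forall>i. j \<le> i \<and> i < k \<longrightarrow> xs ! i \<in> S" for j xs
    using that
  proof (induction j arbitrary: xs)
    case 0
    then have "length xs = k" "set xs \<subseteq> S" by (auto simp: vlists_def in_set_conv_nth)
    then show ?case by (rule fS)
  next
    case (Suc j)
    then have j: "j < k" and len: "length xs = k" by (auto simp: vlists_def)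
    have "S \<subseteq> {v \<in> carrier V. f (xs[j := v]) \<in> W}"
    proof
      fix v assume v: "v \<in> S"
      then have vc: "v \<in> carrier V" using lin_span_superset[of S K V] S by auto
      have "f (xs[j := v]) \<in> W"
        by (rule Suc.IH) (use Suc.prems j len v vlists_update[OF Suc.prems(2) vc] in
          \<open>auto simp: nth_list_update\<close>)
      with vc show "v \<in> {v \<in> carrier V. f (xs[j := v]) \<in> W}" by simp
    qed
    from lin_span_least[OF submodule_vimage[OF V U multilinear_mapD[OF f Suc.prems(2) j] W] this]
    have "f (xs[j := xs ! j]) \<in> W" using S vlists_nth[OF Suc.prems(2) j] by auto
    then show ?case by simp
  qed
  from this[OF order_refl xs] show ?thesis by (meson leD)
qed

context
  fixes K :: "('k,'r) ring_scheme" and V :: "('k,'a,'e) module_scheme" and k :: nat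
  assumes V: "module K V"
begin

interpretation V: module K V by (rule V)
interpretation F: module K "free_module K (vlists V k)"
  by (rule free_module_module[OF V.is_cring])

private lemma gen_list_closed [simp]:
  "xs \<in> vlists V k \<Longrightarrow> gen K xs \<in> carrier (free_module K (vlists V k))"
  by (rule gen_closed[OF V.is_cring])

lemma tpow_rel_gens_closed: "tpow_rel_gens K V k \<subseteq> carrier (free_module K (vlists V k))"
  unfolding tpow_rel_gens_def Let_def by (auto simp: vlists_update)

lemma tpow_module: "module K (tpow K V k)"
  unfolding tpow_eq_pres_module
  by (rule pres_module_module[OF V.is_cring tpow_rel_gens_closed])

lemma tpow_span: "lin_span K (tpow K V k) (pure K V ` vlists V k) = carrier (tpow K V k)"
proof -
  have e: "pure K V ` vlists V k = pres_gen K (vlists V k) (tpow_rel_gens K V k) ` vlists V k"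
    by (rule image_cong[OF refl]) (rule pure_eq_pres_gen)
  show ?thesis
    unfolding e tpow_eq_pres_module
    by (rule pres_module_span[OF V.is_cring tpow_rel_gens_closed])
qed

lemma pure_closed: "xs \<in> vlists V k \<Longrightarrow> pure K V xs \<in> carrier (tpow K V k)"
  by (simp add: pure_eq_pres_gen tpow_eq_pres_module pres_gen_closed[OF V.is_cring tpow_rel_gens_closed])

lemma pure_multilinear: "multilinear_map K k V (tpow K V k) (pure K V)"
proof -
  let ?F = "free_module K (vlists V k)"
  interpret T: module K "tpow K V k" by (rule tpow_module)
  define p where "p f = lin_span K ?F (tpow_rel_gens K V k) +>\<^bsub>?F\<^esub> f" for f
  have p: "linear_map K ?F (tpow K V k) p"
    using pres_proj_linear_map[OF V.is_cring tpow_rel_gens_closed]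
    by (simp add: p_def[abs_def] tpow_eq_pres_module)
  have eq: "p f = p g"
    if "f \<ominus>\<^bsub>?F\<^esub> g \<in> tpow_rel_gens K V k" "f \<in> carrier ?F" "g \<in> carrier ?F" for f g
    unfolding p_def by (rule pres_module_rel[OF V.is_cring tpow_rel_gens_closed that])
  have t: "pure K V xs = p (gen K xs)" if "xs \<in> vlists V k" for xs
    using that by (simp add: pure_eq_pres_gen pres_gen_def p_def)
  note ps = linear_map_closed[OF p] linear_map_add[OF p, symmetric] linear_map_smult[OF p, symmetric]
  show ?thesis
  proof (rule multilinear_mapI; rule linear_mapI)
    fix xs i v v' assume "xs \<in> vlists V k" "i < k" "v \<in> carrier V" "v' \<in> carrier V"
    then show "pure K V (xs[i := v \<oplus>\<^bsub>V\<^esub> v']) =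
        pure K V (xs[i := v]) \<oplus>\<^bsub>tpow K V k\<^esub> pure K V (xs[i := v'])"
      by (simp add: t ps vlists_update)
        (rule eq; (force simp: tpow_rel_gens_def Let_def vlists_update)?)
  next
    fix xs i a v assume "xs \<in> vlists V k" "i < k" "a \<in> carrier K" "v \<in> carrier V"
    then show "pure K V (xs[i := a \<odot>\<^bsub>V\<^esub> v]) = a \<odot>\<^bsub>tpow K V k\<^esub> pure K V (xs[i := v])"
      by (simp add: t ps vlists_update)
        (rule eq; (force simp: tpow_rel_gens_def Let_def vlists_update)?)
  qed (simp add: pure_closed vlists_update)
qed

text \<open>That the values of \<open>\<phi>\<close> lie in \<open>U\<close> is a separate
  hypothesis: for \<open>k = 0\<close> multilinearity is an empty condition, while the empty list is
  still a generator.\<close>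

lemma tpow_lift:
  assumes U: "module K U" and m: "multilinear_map K k V U \<phi>" and c: "\<phi> \<in> vlists V k \<rightarrow> carrier U"
  shows "\<exists>f. linear_map K (tpow K V k) U f \<and> (\<forall>xs\<in>vlists V k. f (pure K V xs) = \<phi> xs)"
proof -
  interpret U: module K U by (rule U)
  note e = free_ext_linear_map[OF U c]
  note es = linear_map_minus[OF F.module_axioms U e] linear_map_add[OF e] linear_map_smult[OF e]
    free_ext_gen[OF U c] funcset_mem[OF c] vlists_update
    linear_map_add[OF multilinear_mapD[OF m]] linear_map_smult[OF multilinear_mapD[OF m]]
  have "free_ext K U \<phi> r = \<zero>\<^bsub>U\<^esub>" if "r \<in> tpow_rel_gens K V k" for r
    using that unfolding tpow_rel_gens_def Let_def
    by (auto simp: es a_minus_def[of U] U.r_neg)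
  from pres_module_lift[OF V.is_cring tpow_rel_gens_closed U c this]
  show ?thesis
    by (auto simp: tpow_eq_pres_module pure_eq_pres_gen)
qed

end

subsection \<open>Induced maps in homology\<close>

text \<open>Shrinking the carrier to the cycles changes neither the addition nor the cosets, so
  classes may be computed in all of \<open>C k\<close>.\<close>

lemma homology_carrier: "carrier (homology C d k) = hclass C d k ` cycles C d k"
  by (auto simp: homology_def carrier_quot_module hclass_def a_r_coset_def')

lemma homology_add: "X \<oplus>\<^bsub>homology C d k\<^esub> Y = X <+>\<^bsub>C k\<^esub> Y"
  by (simp add: homology_def quot_module_def set_add_def')

lemma homology_smult:
  "a \<odot>\<^bsub>homology C d k\<^esub> X = (\<Union>x\<in>X. boundaries C d k +>\<^bsub>C k\<^esub> (a \<odot>\<^bsub>C k\<^esub> x))"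
  by (simp add: homology_def quot_module_def a_r_coset_def')

locale chain_map =
  fixes K :: "('k,'r) ring_scheme"
    and C :: "nat \<Rightarrow> ('k,'a,'e) module_scheme" and d :: "nat \<Rightarrow> 'a \<Rightarrow> 'a"
    and C' :: "nat \<Rightarrow> ('k,'b,'e2) module_scheme" and d' :: "nat \<Rightarrow> 'b \<Rightarrow> 'b"
    and f :: "nat \<Rightarrow> 'a \<Rightarrow> 'b"
  assumes modules: "module K (C k)" "module K (C' k)"
    and d_linear: "linear_map K (C (Suc k)) (C k) (d (Suc k))"
    and d'_linear: "linear_map K (C' (Suc k)) (C' k) (d' (Suc k))"
    and f_linear: "linear_map K (C k) (C' k) (f k)"
    and commute: "z \<in> carrier (C (Suc k)) \<Longrightarrow> f k (d (Suc k) z) = d' (Suc k) (f (Suc k) z)"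
begin

lemma boundaries_submodule: "submodule (boundaries C d k) K (C k)"
  unfolding boundaries_def
  by (rule submodule_image[OF modules(1) modules(1) d_linear module.carrier_is_submodule[OF modules(1)]])

lemma boundaries'_submodule: "submodule (boundaries C' d' k) K (C' k)"
  unfolding boundaries_def
  by (rule submodule_image[OF modules(2) modules(2) d'_linear module.carrier_is_submodule[OF modules(2)]])

lemma cycles_mono: "f k ` cycles C d k \<subseteq> cycles C' d' k"
proof
  fix y assume "y \<in> f k ` cycles C d k"
  then obtain z where z: "z \<in> cycles C d k" "y = f k z" by auto
  show "y \<in> cycles C' d' k"
  proof (cases k)
    case 0
    with z show ?thesis using linear_map_closed[OF f_linear] by (auto simp: cycles_def)
  next
    case (Suc j)
    then have zc: "z \<in> carrier (C (Suc j))" "d (Suc j) z = \<zero>\<^bsub>C j\<^esub>" using z by (auto simp: cycles_def)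
    then have "d' (Suc j) (f (Suc j) z) = \<zero>\<^bsub>C' j\<^esub>"
      using commute[OF zc(1)] linear_map_zero[OF modules(1,2) f_linear] by simp
    then show ?thesis
      using Suc z zc linear_map_closed[OF f_linear] by (simp add: cycles_def)
  qed
qed

lemma boundaries_mono: "f k ` boundaries C d k \<subseteq> boundaries C' d' k"
  using commute linear_map_closed[OF f_linear] by (auto simp: boundaries_def)

text \<open>\<open>induced\<close> is a union over all representatives. They differ by boundaries,
  which \<open>f\<close> sends to boundaries, so one class is repeated throughout the union. Stating
  this for all chains covers sums and multiples of representatives directly.\<close>

lemma induced_hclass:
  assumes z: "z \<in> carrier (C k)"
  shows "induced C' d' f k (hclass C d k z) = hclass C' d' k (f k z)"
proof -
  note B = boundaries_submodule and B' = boundaries'_submodule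
  have "hclass C' d' k (f k x) = hclass C' d' k (f k z)" if x: "x \<in> hclass C d k z" for x
  proof -
    obtain b where b: "b \<in> boundaries C d k" "x = b \<oplus>\<^bsub>C k\<^esub> z"
      using x by (auto simp: hclass_def a_r_coset_def')
    have bc: "b \<in> carrier (C k)" using module.submoduleE(1)[OF modules(1) B] b(1) by auto
    have "f k b \<in> boundaries C' d' k" using boundaries_mono b(1) by auto
    then show ?thesis
      using b(2) coset_absorb[OF modules(2) B' linear_map_closed[OF f_linear z]]
      by (simp add: hclass_def linear_map_add[OF f_linear bc z])
  qed
  then show ?thesis
    using coset_self[OF modules(1) B z] unfolding induced_def hclass_def by blast
qed

lemma induced_linear_map:
  "linear_map K (homology C d k) (homology C' d' k) (induced C' d' f k)"
proof -
  interpret V: module K "C k" by (rule modules)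
  interpret V': module K "C' k" by (rule modules)
  have Z: "z \<in> carrier (C k)" if "z \<in> cycles C d k" for z using that by (simp add: cycles_def)
  note fc = linear_map_closed[OF f_linear]
  note eqs = coset_add[OF modules(1) boundaries_submodule] coset_smult[OF modules(1) boundaries_submodule]
    coset_add[OF modules(2) boundaries'_submodule] coset_smult[OF modules(2) boundaries'_submodule]
  note eqs = eqs[folded hclass_def]
  show ?thesis
  proof (rule linear_mapI)
    show "induced C' d' f k X \<in> carrier (homology C' d' k)" if "X \<in> carrier (homology C d k)" for X
      using that cycles_mono[of k] Z by (auto simp: homology_carrier induced_hclass)
  next
    fix X Y assume "X \<in> carrier (homology C d k)" "Y \<in> carrier (homology C d k)"
    then obtain x y where *: "x \<in> carrier (C k)" "X = hclass C d k x" "y \<in> carrier (C k)" "Y = hclass C d k y"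
      using Z by (auto simp: homology_carrier)
    then show "induced C' d' f k (X \<oplus>\<^bsub>homology C d k\<^esub> Y) =
        induced C' d' f k X \<oplus>\<^bsub>homology C' d' k\<^esub> induced C' d' f k Y"
      using fc by (simp add: homology_add eqs induced_hclass linear_map_add[OF f_linear])
  next
    fix a X assume a: "a \<in> carrier K" and "X \<in> carrier (homology C d k)"
    then obtain x where *: "x \<in> carrier (C k)" "X = hclass C d k x"
      using Z by (auto simp: homology_carrier)
    then show "induced C' d' f k (a \<odot>\<^bsub>homology C d k\<^esub> X) = a \<odot>\<^bsub>homology C' d' k\<^esub> induced C' d' f k X"
      using fc a by (simp add: homology_smult hclass_def[symmetric] eqs induced_hclass linear_map_smult[OF f_linear])
  qed
qed

end

subsection \<open>The Leibniz complex\<close>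

text \<open>All knowledge about the chosen maps enters through this lemma and the next. The
  existence premise is the real task for every construction below.\<close>

lemma lin_ext_spec:
  assumes "\<exists>f. linear_map K V W f \<and> (\<forall>x\<in>X. f (p x) = \<phi> x)"
  shows "linear_map K V W (lin_ext K V W X p \<phi>)" "\<And>x. x \<in> X \<Longrightarrow> lin_ext K V W X p \<phi> (p x) = \<phi> x"
  using someI_ex[OF assms] unfolding lin_ext_def[symmetric] by auto

lemma bilin_ext_spec:
  assumes "\<exists>b. bilinear_map K V W U b \<and> (\<forall>x\<in>X. \<forall>y\<in>Y. b (p x) (q y) = \<phi> x y)"
  shows "bilinear_map K V W U (bilin_ext K V W U X p Y q \<phi>)"
    "\<And>x y. x \<in> X \<Longrightarrow> y \<in> Y \<Longrightarrow> bilin_ext K V W U X p Y q \<phi> (p x) (q y) = \<phi> x y"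
  using someI_ex[OF assms] unfolding bilin_ext_def[symmetric] by auto

section \<open>Reading, replacing and deleting entries of a list\<close>

lemma omit_vlists: "xs \<in> vlists V k \<Longrightarrow> 1 \<le> i \<Longrightarrow> i \<le> k \<Longrightarrow> omit i xs \<in> vlists V (k - 1)"
  using set_take_subset[of "i - 1" xs] set_drop_subset[of i xs]
  by (auto simp: vlists_def omit_def)

lemma ent_closed: "xs \<in> vlists V k \<Longrightarrow> 1 \<le> i \<Longrightarrow> i \<le> k \<Longrightarrow> ent xs i \<in> carrier V"
  by (auto simp: ent_def intro: vlists_nth)

lemma ent_update:
  "p < length xs \<Longrightarrow> 1 \<le> i \<Longrightarrow> ent (xs[p := v]) i = (if p = i - 1 then v else ent xs i)"
  by (auto simp: ent_def)

lemma omit_update_same: "1 \<le> i \<Longrightarrow> omit i (xs[i - Suc 0 := v]) = omit i xs"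
  by (simp add: omit_def)

lemma omit_update_less: "p < i - 1 \<Longrightarrow> i \<le> length xs \<Longrightarrow> omit i (xs[p := v]) = (omit i xs)[p := v]"
  by (simp add: omit_def list_update_append take_update_swap)

text \<open>The position \<open>q\<close> is \<open>p\<close> if the deleted entry lies behind it,
  and \<open>p - 1\<close> if it lies before. One \<open>q\<close> serves all lists of the given
  length, because \<open>br_omit_multilinear\<close> applies this to a list in which a bracket has
  already been inserted.\<close>

lemma omit_update_other:
  fixes xs :: "'a list"
  assumes "p < length xs" "1 \<le> i" "i \<le> length xs" "p \<noteq> i - 1"
  shows "\<exists>q<length xs - 1. \<forall>(ys::'a list) v. length ys = length xs \<longrightarrow>
    omit i (ys[p := v]) = (omit i ys)[q := v]"
proof (cases "p < i - 1")
  case True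
  then have "p < length xs - 1" using assms by linarith
  with True show ?thesis using assms(3) omit_update_less[of p i] by metis
next
  case False
  then have p: "i \<le> p" using assms by linarith
  have "omit i (ys[p := v]) = (omit i ys)[p - 1 := v]" if "length ys = length xs" for ys :: "'a list" and v
    using p assms that by (simp add: omit_def list_update_append drop_update_swap)
  moreover have "p - 1 < length xs - 1" using p assms by linarith
  ultimately show ?thesis by blast
qed

lemma ent_map: "1 \<le> i \<Longrightarrow> i \<le> length xs \<Longrightarrow> ent (map f xs) i = f (ent xs i)"
  by (simp add: ent_def)

lemma omit_map: "omit i (map f xs) = map f (omit i xs)"
  by (simp add: omit_def take_map drop_map)

text \<open>Bilinearity of the bracket and of both actions is what makes the boundary formula well
  defined on tensors.\<close>

locale leibniz_coefficients =
  fixes K :: "('k,'r) ring_scheme" and g :: "('k,'g,'e) nleibniz_scheme"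
    and M :: "('k,'m,'g,'f) corep_scheme"
  assumes g: "module K g" and M: "module K M"
    and br: "bilinear_map K g g g (br g)"
    and ract: "bilinear_map K M g M (ract M)"
    and lact: "bilinear_map K g M M (lact M)"
begin

lemma CL_module: "module K (CL K g M k)"
  unfolding CL_def by (rule tensor_module[OF M tpow_module[OF g]])

lemma cl_eq_tens: "xs \<in> vlists g k \<Longrightarrow> cl K g M m xs = tens K M (tpow K g k) m (pure K g xs)"
  by (auto simp: cl_def vlists_def)

lemma cl_linear:
  assumes "xs \<in> vlists g k"
  shows "linear_map K M (CL K g M k) (\<lambda>m. cl K g M m xs)"
  unfolding CL_def cl_eq_tens[OF assms]
  by (rule bilinear_map_left[OF tens_bilinear[OF M tpow_module[OF g]] pure_closed[OF g assms]])

lemma cl_closed: "m \<in> carrier M \<Longrightarrow> xs \<in> vlists g k \<Longrightarrow> cl K g M m xs \<in> carrier (CL K g M k)"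
  by (rule linear_map_closed[OF cl_linear])

lemma cl_multilinear:
  assumes "m \<in> carrier M"
  shows "multilinear_map K k g (CL K g M k) (cl K g M m)"
proof (rule multilinear_mapI)
  fix xs i assume xs: "xs \<in> vlists g k" "i < k"
  have "linear_map K g (CL K g M k) (\<lambda>v. tens K M (tpow K g k) m (pure K g (xs[i := v])))"
    unfolding CL_def
    by (rule linear_map_compose[OF multilinear_mapD[OF pure_multilinear[OF g] xs]
          bilinear_map_right[OF tens_bilinear[OF M tpow_module[OF g]] assms]])
  then show "linear_map K g (CL K g M k) (\<lambda>v. cl K g M m (xs[i := v]))"
    by (rule iffD1[OF linear_map_cong[OF g], rotated])
      (simp add: cl_eq_tens[OF vlists_update[OF xs(1)]])
qed

text \<open>The list variable extends over the tensor power by \<open>tpow_lift\<close>, the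
  coefficient variable is linear already, and the resulting bilinear map factors through
  \<open>tensor\<close>.\<close>

lemma CL_lift:
  assumes U: "module K U"
    and left: "\<And>xs. xs \<in> vlists g k \<Longrightarrow> linear_map K M U (\<lambda>m. \<phi> m xs)"
    and right: "\<And>m. m \<in> carrier M \<Longrightarrow> multilinear_map K k g U (\<phi> m)"
  shows "\<exists>f. linear_map K (CL K g M k) U f \<and>
    (\<forall>m\<in>carrier M. \<forall>xs\<in>vlists g k. f (cl K g M m xs) = \<phi> m xs)"
proof -
  note T = tpow_module[OF g, of k]
  \<comment> \<open>\<open>bilinear_map_exists\<close> asks for a spanning family in each variable.
    For the coefficients this is all of \<open>M\<close>, indexed by the identity, so that
    \<open>left\<close> can be used as it stands.\<close>
  have "lin_span K M ((\<lambda>m. m) ` carrier M) = carrier M"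
    using lin_span_closed[OF M order_refl] lin_span_superset[of "carrier M" K M] by simp
  moreover have "\<exists>f. linear_map K (tpow K g k) U f \<and> (\<forall>xs\<in>vlists g k. f (pure K g xs) = \<phi> m xs)"
    if "m \<in> carrier M" for m
    by (rule tpow_lift[OF g U right[OF that]]) (auto intro: linear_map_closed[OF left _ ] that)
  moreover have "\<exists>f. linear_map K M U f \<and> (\<forall>m\<in>carrier M. f m = \<phi> m xs)" if "xs \<in> vlists g k" for xs
    using left[OF that] by blast
  ultimately obtain b where b: "bilinear_map K M (tpow K g k) U b"
    "\<forall>m\<in>carrier M. \<forall>xs\<in>vlists g k. b m (pure K g xs) = \<phi> m xs"
    using bilinear_map_exists[OF M T U _ tpow_span[OF g]] by blast
  from tensor_lift[OF M T U b(1)] b(2) show ?thesis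
    unfolding CL_def by (metis cl_eq_tens pure_closed[OF g])
qed

lemma CL_span:
  "lin_span K (CL K g M k) {cl K g M m xs | m xs. m \<in> carrier M \<and> xs \<in> vlists g k} = carrier (CL K g M k)"
    (is "lin_span K ?C ?S = _")
proof
  note T = tpow_module[OF g, of k]
  have S: "?S \<subseteq> carrier ?C" using cl_closed by auto
  show "lin_span K ?C ?S \<subseteq> carrier ?C" by (rule lin_span_closed[OF CL_module S])
  note W = lin_span_submodule[OF CL_module S]
  have "tens K M (tpow K g k) m t \<in> lin_span K ?C ?S" if m: "m \<in> carrier M" and t: "t \<in> carrier (tpow K g k)" for m t
  proof -
    note l = bilinear_map_right[OF tens_bilinear[OF M T] m, folded CL_def]
    have "pure K g ` vlists g k \<subseteq> {t \<in> carrier (tpow K g k). tens K M (tpow K g k) m t \<in> lin_span K ?C ?S}"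
      using m pure_closed[OF g] lin_span_superset[of ?S K ?C] by (force simp: cl_eq_tens)
    from lin_span_least[OF submodule_vimage[OF T CL_module l W] this] show ?thesis
      using t by (auto simp: tpow_span[OF g])
  qed
  then have "lin_span K ?C ((\<lambda>(v, w). tens K M (tpow K g k) v w) ` (carrier M \<times> carrier (tpow K g k)))
    \<subseteq> lin_span K ?C ?S"
    by (intro lin_span_least[OF W]) auto
  then show "carrier ?C \<subseteq> lin_span K ?C ?S"
    using tensor_span[OF M T] by (simp add: CL_def)
qed

text \<open>\<open>\<psi>\<close> stands for either action with the coefficient fixed. Entry
  \<open>i\<close> occurs only inside \<open>\<psi>\<close> and every other entry only in the
  remaining tensor, so varying a slot affects just one of the two factors.\<close>

lemma ent_omit_multilinear:
  assumes \<psi>: "linear_map K g M \<psi>" and i: "1 \<le> i" "i \<le> k"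
  shows "multilinear_map K k g (CL K g M (k - 1)) (\<lambda>xs. cl K g M (\<psi> (ent xs i)) (omit i xs))"
proof (rule multilinear_mapI)
  fix xs p assume xs: "xs \<in> vlists g k" and p: "p < k"
  have len: "length xs = k" using xs by (simp add: vlists_def)
  note o = omit_vlists[OF xs i]
  show "linear_map K g (CL K g M (k - 1)) (\<lambda>v. cl K g M (\<psi> (ent (xs[p := v]) i)) (omit i (xs[p := v])))"
  proof (cases "p = i - 1")
    case True
    then have "(\<lambda>v. cl K g M (\<psi> (ent (xs[p := v]) i)) (omit i (xs[p := v]))) =
        (\<lambda>v. cl K g M (\<psi> v) (omit i xs))"
      using i p len by (simp add: ent_update omit_update_same)
    then show ?thesis using linear_map_compose[OF \<psi> cl_linear[OF o]] by simp
  next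
    case False
    obtain q where q: "q < k - 1" "\<And>v. omit i (xs[p := v]) = (omit i xs)[q := v]"
      using omit_update_other[of p xs i] False p i len by metis
    have "\<psi> (ent xs i) \<in> carrier M" by (rule linear_map_closed[OF \<psi> ent_closed[OF xs i]])
    from multilinear_mapD[OF cl_multilinear[OF this] o q(1)] show ?thesis
      using False i p len by (simp add: ent_update q(2))
  qed
qed

text \<open>Entries \<open>i\<close> and \<open>j\<close> meet in the bracket, whose position
  survives the deletion because \<open>i < j\<close>. Varying one of them is covered by bilinearity
  of the bracket; varying any other entry commutes with the replacement and passes through the
  deletion.\<close>

lemma br_omit_multilinear:
  assumes m: "m \<in> carrier M" and ij: "1 \<le> i" "i < j" "j \<le> k"
  shows "multilinear_map K k g (CL K g M (k - 1))
    (\<lambda>xs. cl K g M m (omit j (xs[i - 1 := br g (ent xs i) (ent xs j)])))"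
proof (rule multilinear_mapI)
  fix xs p assume xs: "xs \<in> vlists g k" and p: "p < k"
  have len: "length xs = k" using xs by (simp add: vlists_def)
  have j: "1 \<le> j" "j \<le> k" and i: "i \<le> k" using ij by auto
  note e = ent_closed[OF xs ij(1) i] ent_closed[OF xs j]
  note o = omit_vlists[OF xs j]
  note lin = multilinear_mapD[OF cl_multilinear[OF m] o, of "i - 1"]
  consider "p = i - 1" | "p = j - 1" | "p \<noteq> i - 1" "p \<noteq> j - 1" by blast
  then show "linear_map K g (CL K g M (k - 1))
    (\<lambda>v. cl K g M m (omit j (xs[p := v, i - 1 := br g (ent (xs[p := v]) i) (ent (xs[p := v]) j)])))"
  proof cases
    case 1
    have *: "omit j (xs[p := v, i - 1 := br g (ent (xs[p := v]) i) (ent (xs[p := v]) j)]) =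
        (omit j xs)[i - 1 := br g v (ent xs j)]" for v
    proof -
      have "p \<noteq> j - 1" using 1 ij by linarith
      then show ?thesis using 1 ij p len by (simp add: ent_update omit_update_less)
    qed
    show ?thesis unfolding *
      by (rule linear_map_compose[OF bilinear_map_left[OF br e(2)] lin]) (use ij in linarith)
  next
    case 2
    have *: "omit j (xs[p := v, i - 1 := br g (ent (xs[p := v]) i) (ent (xs[p := v]) j)]) =
        (omit j xs)[i - 1 := br g (ent xs i) v]" for v
    proof -
      have "p \<noteq> i - 1" using 2 ij by linarith
      then show ?thesis
        using 2 ij p len omit_update_less[of "i - 1" j "xs[p := v]"] omit_update_same[of j xs v]
        by (simp add: ent_update)
    qed
    show ?thesis unfolding *
      by (rule linear_map_compose[OF bilinear_map_right[OF br e(1)] lin]) (use ij in linarith)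
  next
    case 3
    have pj: "p < length xs" "j \<le> length xs" using p j len by auto
    obtain q where q: "q < length xs - 1"
      "\<forall>(ys::'g list) v. length ys = length xs \<longrightarrow> omit j (ys[p := v]) = (omit j ys)[q := v]"
      using omit_update_other[OF pj(1) j(1) pj(2) 3(2)] by auto
    have qk: "q < k - 1" using q(1) len by simp
    \<comment> \<open>The bracket does not involve position \<open>p\<close>, so the replacement can
      be carried out first. The position \<open>q\<close> is valid for \<open>ys\<close> as well,
      since it depends only on the length.\<close>
    define ys where "ys = xs[i - 1 := br g (ent xs i) (ent xs j)]"
    have ys: "ys \<in> vlists g k"
      unfolding ys_def by (rule vlists_update[OF xs bilinear_map_closed[OF br e]])
    have *: "omit j (xs[p := v, i - 1 := br g (ent (xs[p := v]) i) (ent (xs[p := v]) j)]) =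
        (omit j ys)[q := v]" for v
    proof -
      have "xs[p := v, i - 1 := br g (ent (xs[p := v]) i) (ent (xs[p := v]) j)] = ys[p := v]"
        using 3 ij p len by (simp add: ent_update ys_def list_update_swap)
      then show ?thesis using q(2) ys len by (simp add: vlists_def)
    qed
    show ?thesis unfolding *
      by (rule multilinear_mapD[OF cl_multilinear[OF m] omit_vlists[OF ys j] qk])
  qed
qed

text \<open>The value prescribed in \<open>CL_d\<close>, with the local definitions there expanded
  so that \<open>CL_d_def\<close> can be folded against it.\<close>

abbreviation boundary_sum :: "nat \<Rightarrow> 'm \<Rightarrow> 'g list \<Rightarrow> ('m \<times> ('g list \<Rightarrow> 'k) set \<Rightarrow> 'k) set"
  where "boundary_sum k m xs \<equiv>
        cl K g M (ract M m (ent xs 1)) (omit 1 xs) \<oplus>\<^bsub>CL K g M (k - 1)\<^esub>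
        (\<Oplus>\<^bsub>CL K g M (k - 1)\<^esub>i\<in>{2..k}. ((\<ominus>\<^bsub>K\<^esub> \<one>\<^bsub>K\<^esub>) [^]\<^bsub>K\<^esub> i) \<odot>\<^bsub>CL K g M (k - 1)\<^esub>
          cl K g M (lact M (ent xs i) m) (omit i xs)) \<oplus>\<^bsub>CL K g M (k - 1)\<^esub>
        finsum (CL K g M (k - 1)) (\<lambda>(i, j). ((\<ominus>\<^bsub>K\<^esub> \<one>\<^bsub>K\<^esub>) [^]\<^bsub>K\<^esub> (j + 1)) \<odot>\<^bsub>CL K g M (k - 1)\<^esub>
            cl K g M m (omit j (xs[i - 1 := br g (ent xs i) (ent xs j)])))
          {(i, j). 1 \<le> i \<and> i < j \<and> j \<le> k}"

lemma sign_closed: "(\<ominus>\<^bsub>K\<^esub> \<one>\<^bsub>K\<^esub>) [^]\<^bsub>K\<^esub> (i::nat) \<in> carrier K"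
proof -
  interpret g: module K g by (rule g)
  show ?thesis by simp
qed

lemma CL_d_exists:
  assumes "1 \<le> k"
  shows "\<exists>f. linear_map K (CL K g M k) (CL K g M (k - 1)) f \<and>
    (\<forall>m\<in>carrier M. \<forall>xs\<in>vlists g k. f (cl K g M m xs) = boundary_sum k m xs)"
proof (rule CL_lift[OF CL_module])
  note sm = linear_map_smult_fun[OF CL_module _ sign_closed]
  fix xs assume xs: "xs \<in> vlists g k"
  have o: "omit i ys \<in> vlists g (k - 1)" if "ys \<in> vlists g k" "1 \<le> i" "i \<le> k" for i ys
    using that by (rule omit_vlists)
  show "linear_map K M (CL K g M (k - 1)) (\<lambda>m. boundary_sum k m xs)"
  proof (rule linear_map_add_fun[OF CL_module linear_map_add_fun[OF CL_module]])
    show "linear_map K M (CL K g M (k - 1)) (\<lambda>m. cl K g M (ract M m (ent xs 1)) (omit 1 xs))"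
      using assms by (intro linear_map_compose[OF bilinear_map_left[OF ract] cl_linear] o xs ent_closed[OF xs]) auto
  next
    have "linear_map K M (CL K g M (k - 1)) (\<lambda>m. cl K g M (lact M (ent xs i) m) (omit i xs))"
      if "i \<in> {2..k}" for i
      using that by (intro linear_map_compose[OF bilinear_map_right[OF lact] cl_linear] o xs ent_closed[OF xs]) auto
    from linear_map_finsum_fun[OF CL_module sm[OF this]]
    show "linear_map K M (CL K g M (k - 1)) (\<lambda>m. \<Oplus>\<^bsub>CL K g M (k - 1)\<^esub>i\<in>{2..k}.
      ((\<ominus>\<^bsub>K\<^esub> \<one>\<^bsub>K\<^esub>) [^]\<^bsub>K\<^esub> i) \<odot>\<^bsub>CL K g M (k - 1)\<^esub> cl K g M (lact M (ent xs i) m) (omit i xs))" .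
  next
    show "linear_map K M (CL K g M (k - 1)) (\<lambda>m. finsum (CL K g M (k - 1))
      (\<lambda>(i, j). ((\<ominus>\<^bsub>K\<^esub> \<one>\<^bsub>K\<^esub>) [^]\<^bsub>K\<^esub> (j + 1)) \<odot>\<^bsub>CL K g M (k - 1)\<^esub>
        cl K g M m (omit j (xs[i - 1 := br g (ent xs i) (ent xs j)])))
      {(i, j). 1 \<le> i \<and> i < j \<and> j \<le> k})"
    proof (rule linear_map_finsum_fun[OF CL_module], clarify, rule sm, rule cl_linear)
      fix i j assume "1 \<le> i" "i < j" "j \<le> k"
      then show "omit j (xs[i - 1 := br g (ent xs i) (ent xs j)]) \<in> vlists g (k - 1)"
        by (intro o vlists_update[OF xs] bilinear_map_closed[OF br] ent_closed[OF xs]) linarith+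
    qed
  qed
next
  note sm = linear_map_smult_fun[OF CL_module _ sign_closed]
  fix m assume m: "m \<in> carrier M"
  show "multilinear_map K k g (CL K g M (k - 1)) (boundary_sum k m)"
  proof (rule multilinear_mapI, rule linear_map_add_fun[OF CL_module linear_map_add_fun[OF CL_module]])
    fix xs p assume xs: "xs \<in> vlists g k" "p < k"
    show "linear_map K g (CL K g M (k - 1))
      (\<lambda>v. cl K g M (ract M m (ent (xs[p := v]) 1)) (omit 1 (xs[p := v])))"
      by (rule multilinear_mapD[OF ent_omit_multilinear[OF bilinear_map_right[OF ract m]] xs])
        (use assms in auto)
    have "linear_map K g (CL K g M (k - 1))
        (\<lambda>v. cl K g M (lact M (ent (xs[p := v]) i) m) (omit i (xs[p := v])))" if "i \<in> {2..k}" for i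
      by (rule multilinear_mapD[OF ent_omit_multilinear[OF bilinear_map_left[OF lact m]] xs])
        (use that in auto)
    from linear_map_finsum_fun[OF CL_module sm[OF this]]
    show "linear_map K g (CL K g M (k - 1)) (\<lambda>v. \<Oplus>\<^bsub>CL K g M (k - 1)\<^esub>i\<in>{2..k}.
      ((\<ominus>\<^bsub>K\<^esub> \<one>\<^bsub>K\<^esub>) [^]\<^bsub>K\<^esub> i) \<odot>\<^bsub>CL K g M (k - 1)\<^esub>
        cl K g M (lact M (ent (xs[p := v]) i) m) (omit i (xs[p := v])))" .
    show "linear_map K g (CL K g M (k - 1)) (\<lambda>v. finsum (CL K g M (k - 1))
      (\<lambda>(i, j). ((\<ominus>\<^bsub>K\<^esub> \<one>\<^bsub>K\<^esub>) [^]\<^bsub>K\<^esub> (j + 1)) \<odot>\<^bsub>CL K g M (k - 1)\<^esub>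
        cl K g M m (omit j (xs[p := v, i - 1 := br g (ent (xs[p := v]) i) (ent (xs[p := v]) j)])))
      {(i, j). 1 \<le> i \<and> i < j \<and> j \<le> k})"
    proof (rule linear_map_finsum_fun[OF CL_module], clarify, rule sm)
      fix i j assume "1 \<le> i" "i < j" "j \<le> k"
      from multilinear_mapD[OF br_omit_multilinear[OF m this] xs]
      show "linear_map K g (CL K g M (k - 1)) (\<lambda>v. cl K g M m
        (omit j (xs[p := v, i - 1 := br g (ent (xs[p := v]) i) (ent (xs[p := v]) j)])))" .
    qed
  qed
qed

lemma CL_d_linear: "linear_map K (CL K g M (Suc k)) (CL K g M k) (CL_d K g M (Suc k))"
  and CL_d_cl: "m \<in> carrier M \<Longrightarrow> xs \<in> vlists g (Suc k) \<Longrightarrow>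
    CL_d K g M (Suc k) (cl K g M m xs) = boundary_sum (Suc k) m xs"
proof -
  have ex: "\<exists>f. linear_map K (CL K g M (Suc k)) (CL K g M (Suc k - 1)) f \<and>
    (\<forall>x\<in>carrier M \<times> vlists g (Suc k). f ((\<lambda>(m, xs). cl K g M m xs) x) = (\<lambda>(m, xs). boundary_sum (Suc k) m xs) x)"
    using CL_d_exists[of "Suc k"] by fastforce
  note s = lin_ext_spec[OF ex, folded CL_d_def[unfolded Let_def]]
  show "linear_map K (CL K g M (Suc k)) (CL K g M k) (CL_d K g M (Suc k))" using s(1) by simp
  show "m \<in> carrier M \<Longrightarrow> xs \<in> vlists g (Suc k) \<Longrightarrow>
    CL_d K g M (Suc k) (cl K g M m xs) = boundary_sum (Suc k) m xs"
    using s(2)[of "(m, xs)"] by simp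
qed

end

section \<open>Functoriality of the Leibniz complex\<close>

locale leibniz_coefficients_hom =
  src: leibniz_coefficients K g M + tgt: leibniz_coefficients K g' M'
  for K :: "('k,'r) ring_scheme" and g :: "('k,'g,'e) nleibniz_scheme"
    and M :: "('k,'m,'g,'f) corep_scheme"
    and g' :: "('k,'g2,'e2) nleibniz_scheme" and M' :: "('k,'m2,'g2,'f2) corep_scheme" +
  fixes \<eta> :: "'g \<Rightarrow> 'g2" and \<mu> :: "'m \<Rightarrow> 'm2"
  assumes \<eta>: "linear_map K g g' \<eta>" and \<mu>: "linear_map K M M' \<mu>"
    and \<eta>_br: "x \<in> carrier g \<Longrightarrow> y \<in> carrier g \<Longrightarrow> \<eta> (br g x y) = br g' (\<eta> x) (\<eta> y)"
    and \<mu>_ract: "m \<in> carrier M \<Longrightarrow> x \<in> carrier g \<Longrightarrow> \<mu> (ract M m x) = ract M' (\<mu> m) (\<eta> x)"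
    and \<mu>_lact: "m \<in> carrier M \<Longrightarrow> x \<in> carrier g \<Longrightarrow> \<mu> (lact M x m) = lact M' (\<eta> x) (\<mu> m)"
begin

lemma map_vlists: "xs \<in> vlists g k \<Longrightarrow> map \<eta> xs \<in> vlists g' k"
  using linear_map_closed[OF \<eta>] by (auto simp: vlists_def)

lemma CL_map_exists:
  "\<exists>f. linear_map K (CL K g M k) (CL K g' M' k) f \<and>
    (\<forall>m\<in>carrier M. \<forall>xs\<in>vlists g k. f (cl K g M m xs) = cl K g' M' (\<mu> m) (map \<eta> xs))"
proof (rule src.CL_lift[OF tgt.CL_module])
  show "linear_map K M (CL K g' M' k) (\<lambda>m. cl K g' M' (\<mu> m) (map \<eta> xs))" if "xs \<in> vlists g k" for xs
    by (rule linear_map_compose[OF \<mu> tgt.cl_linear[OF map_vlists[OF that]]])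
  fix m assume m: "m \<in> carrier M"
  show "multilinear_map K k g (CL K g' M' k) (\<lambda>xs. cl K g' M' (\<mu> m) (map \<eta> xs))"
  proof (rule multilinear_mapI)
    fix xs i assume xs: "xs \<in> vlists g k" "i < k"
    show "linear_map K g (CL K g' M' k) (\<lambda>v. cl K g' M' (\<mu> m) (map \<eta> (xs[i := v])))"
      unfolding map_update
      by (rule linear_map_compose[OF \<eta> multilinear_mapD[OF
            tgt.cl_multilinear[OF linear_map_closed[OF \<mu> m]] map_vlists[OF xs(1)] xs(2)]])
  qed
qed

text \<open>\<open>F\<close> is any family with these values, because the lemma is applied to
  \<open>h_map\<close>, which is chosen by its values on other generators. On a pure tensor the
  summands of the boundary correspond one to one: \<open>\<eta>\<close> and \<open>\<mu>\<close>
  respect brackets and actions, and \<open>map\<close> commutes with replacing and deleting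
  entries.\<close>

lemma CL_map_commute:
  assumes F: "\<And>k. linear_map K (CL K g M k) (CL K g' M' k) (F k)"
    and F_cl: "\<And>k m xs. m \<in> carrier M \<Longrightarrow> xs \<in> vlists g k \<Longrightarrow>
      F k (cl K g M m xs) = cl K g' M' (\<mu> m) (map \<eta> xs)"
    and z: "z \<in> carrier (CL K g M (Suc k))"
  shows "F k (CL_d K g M (Suc k) z) = CL_d K g' M' (Suc k) (F (Suc k) z)"
proof (rule linear_map_eqI[OF src.CL_module tgt.CL_module
      linear_map_compose[OF src.CL_d_linear F] linear_map_compose[OF F tgt.CL_d_linear] src.CL_span _ z])
  fix z assume "z \<in> {cl K g M m xs | m xs. m \<in> carrier M \<and> xs \<in> vlists g (Suc k)}"
  then obtain m xs where m: "m \<in> carrier M" and xs: "xs \<in> vlists g (Suc k)" and z: "z = cl K g M m xs"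
    by auto
  let ?k = "Suc k"
  let ?C = "CL K g M k" and ?C' = "CL K g' M' k"
  interpret C: module K ?C by (rule src.CL_module)
  interpret C': module K ?C' by (rule tgt.CL_module)
  have len: "length xs = ?k" using xs by (simp add: vlists_def)
  note \<mu>m = linear_map_closed[OF \<mu> m]
  note o = omit_vlists[of _ g ?k, simplified] and e = ent_closed[OF xs]
  have r: "ract M m (ent xs i) \<in> carrier M" "lact M (ent xs i) m \<in> carrier M" if "1 \<le> i" "i \<le> ?k" for i
    using bilinear_map_closed[OF src.ract m e] bilinear_map_closed[OF src.lact e m] that by auto
  have b: "xs[i - 1 := br g (ent xs i) (ent xs j)] \<in> vlists g ?k" if "1 \<le> i" "i < j" "j \<le> ?k" for i j
    using that by (intro vlists_update[OF xs] bilinear_map_closed[OF src.br] e) auto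
  define t1 where "t1 = cl K g M (ract M m (ent xs 1)) (omit 1 xs)"
  define t2 where "t2 i = ((\<ominus>\<^bsub>K\<^esub> \<one>\<^bsub>K\<^esub>) [^]\<^bsub>K\<^esub> i) \<odot>\<^bsub>?C\<^esub> cl K g M (lact M (ent xs i) m) (omit i xs)" for i
  define t3 where "t3 = (\<lambda>(i, j). ((\<ominus>\<^bsub>K\<^esub> \<one>\<^bsub>K\<^esub>) [^]\<^bsub>K\<^esub> (j + 1)) \<odot>\<^bsub>?C\<^esub>
      cl K g M m (omit j (xs[i - 1 := br g (ent xs i) (ent xs j)])))"
  let ?P = "{(i, j). 1 \<le> i \<and> i < j \<and> j \<le> ?k}"
  let ?ys = "map \<eta> xs"
  have t1: "t1 \<in> carrier ?C" and F1: "F k t1 = cl K g' M' (ract M' (\<mu> m) (ent ?ys 1)) (omit 1 ?ys)"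
    using r(1)[of 1] o[OF xs, of 1]
    by (auto simp: t1_def F_cl omit_map ent_map len \<mu>_ract[OF m e] intro!: src.cl_closed)
  have t2: "t2 i \<in> carrier ?C" and F2: "F k (t2 i) = ((\<ominus>\<^bsub>K\<^esub> \<one>\<^bsub>K\<^esub>) [^]\<^bsub>K\<^esub> i) \<odot>\<^bsub>?C'\<^esub>
      cl K g' M' (lact M' (ent ?ys i) (\<mu> m)) (omit i ?ys)" if i: "i \<in> {2..?k}" for i
  proof -
    have c: "cl K g M (lact M (ent xs i) m) (omit i xs) \<in> carrier ?C"
      using i r(2)[of i] o[OF xs, of i] by (auto intro!: src.cl_closed)
    then show "t2 i \<in> carrier ?C" by (simp add: t2_def src.sign_closed)
    show "F k (t2 i) = ((\<ominus>\<^bsub>K\<^esub> \<one>\<^bsub>K\<^esub>) [^]\<^bsub>K\<^esub> i) \<odot>\<^bsub>?C'\<^esub> cl K g' M' (lact M' (ent ?ys i) (\<mu> m)) (omit i ?ys)"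
      using i r(2)[of i] o[OF xs, of i] c
      by (simp add: t2_def linear_map_smult[OF F src.sign_closed] F_cl omit_map ent_map len \<mu>_lact[OF m e])
  qed
  have t3: "t3 p \<in> carrier ?C" and F3: "F k (t3 p) = (\<lambda>(i, j). ((\<ominus>\<^bsub>K\<^esub> \<one>\<^bsub>K\<^esub>) [^]\<^bsub>K\<^esub> (j + 1)) \<odot>\<^bsub>?C'\<^esub>
      cl K g' M' (\<mu> m) (omit j (?ys[i - 1 := br g' (ent ?ys i) (ent ?ys j)]))) p" if p: "p \<in> ?P" for p
  proof -
    obtain i j where ij: "p = (i, j)" "1 \<le> i" "i < j" "j \<le> ?k" using p by auto
    note ob = o[OF b[OF ij(2-4)], of j]
    have c: "cl K g M m (omit j (xs[i - 1 := br g (ent xs i) (ent xs j)])) \<in> carrier ?C"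
      using ij ob m by (auto intro!: src.cl_closed)
    then show "t3 p \<in> carrier ?C" using src.sign_closed[of "j + 1"] by (simp add: t3_def ij(1))
    have "br g' (ent ?ys i) (ent ?ys j) = \<eta> (br g (ent xs i) (ent xs j))"
      using ij by (simp add: ent_map len \<eta>_br[OF e e])
    then have "?ys[i - 1 := br g' (ent ?ys i) (ent ?ys j)] = map \<eta> (xs[i - 1 := br g (ent xs i) (ent xs j)])"
      by (simp add: map_update)
    then show "F k (t3 p) = (\<lambda>(i, j). ((\<ominus>\<^bsub>K\<^esub> \<one>\<^bsub>K\<^esub>) [^]\<^bsub>K\<^esub> (j + 1)) \<odot>\<^bsub>?C'\<^esub>
      cl K g' M' (\<mu> m) (omit j (?ys[i - 1 := br g' (ent ?ys i) (ent ?ys j)]))) p"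
      unfolding t3_def ij(1) prod.case linear_map_smult[OF F src.sign_closed c]
      using ij ob by (simp add: F_cl[OF m] omit_map)
  qed
  have t2': "t2 \<in> {2..?k} \<rightarrow> carrier ?C" and t3': "t3 \<in> ?P \<rightarrow> carrier ?C" using t2 t3 by auto
  have F2': "(\<lambda>i. F k (t2 i)) \<in> {2..?k} \<rightarrow> carrier ?C'" and F3': "(\<lambda>i. F k (t3 i)) \<in> ?P \<rightarrow> carrier ?C'"
    using t2 t3 linear_map_closed[OF F] by auto
  have "CL_d K g M ?k z = t1 \<oplus>\<^bsub>?C\<^esub> finsum ?C t2 {2..?k} \<oplus>\<^bsub>?C\<^esub> finsum ?C t3 ?P"
    unfolding z src.CL_d_cl[OF m xs] t1_def t2_def[abs_def] t3_def by simp
  then have "F k (CL_d K g M ?k z) =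
      F k t1 \<oplus>\<^bsub>?C'\<^esub> (\<Oplus>\<^bsub>?C'\<^esub>i\<in>{2..?k}. F k (t2 i)) \<oplus>\<^bsub>?C'\<^esub> (\<Oplus>\<^bsub>?C'\<^esub>p\<in>?P. F k (t3 p))"
    using t1 C.finsum_closed[OF t2'] C.finsum_closed[OF t3']
    by (simp add: linear_map_add[OF F] linear_map_finsum[OF C.module_axioms C'.module_axioms F t2']
        linear_map_finsum[OF C.module_axioms C'.module_axioms F t3'] del: One_nat_def)
  also have "\<dots> = tgt.boundary_sum ?k (\<mu> m) ?ys"
    unfolding diff_Suc_1 F1
    by (intro arg_cong2[where f = "add ?C'"] refl; rule sym; rule C'.finsum_cong'[OF refl])
      (use F2' F3' in \<open>simp_all only: F2 F3\<close>)
  also have "\<dots> = CL_d K g' M' ?k (F ?k z)"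
    unfolding z F_cl[OF m xs] tgt.CL_d_cl[OF \<mu>m map_vlists[OF xs]] ..
  finally show "F k (CL_d K g M ?k z) = CL_d K g' M' ?k (F ?k z)" .
qed

end

subsection \<open>The complex of an \<open>n\<close>-ary algebra\<close>

text \<open>\<open>D_alg\<close>, \<open>D_corep\<close> and \<open>U_alg\<close> add or change only
  fields outside the module structure. This carries the module axioms over to them.\<close>

lemma module_cong:
  assumes "module K V" "carrier V' = carrier V" "add V' = add V" "zero V' = zero V" "smult V' = smult V"
  shows "module K V'"
proof -
  interpret V: module K V by fact
  show ?thesis
  proof (rule moduleI)
    show "abelian_group V'"
    proof (rule abelian_groupI)
      show "\<exists>y\<in>carrier V'. y \<oplus>\<^bsub>V'\<^esub> x = \<zero>\<^bsub>V'\<^esub>" if "x \<in> carrier V'" for x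
        using that V.l_neg V.a_inv_closed by (metis assms(2-4))
    qed (auto simp: assms(2-) V.a_ac)
  qed (auto simp: assms(2-) V.smult_l_distr V.smult_r_distr V.smult_assoc1 V.is_cring)
qed

lemma D_alg_simps [simp]:
  "carrier (D_alg K n A) = carrier (tpow K A (n - 1))"
  "add (D_alg K n A) = add (tpow K A (n - 1))"
  "zero (D_alg K n A) = zero (tpow K A (n - 1))"
  "smult (D_alg K n A) = smult (tpow K A (n - 1))"
  "nbr (D_alg K n A) ts = D_br K n A (ts ! 0) (ts ! 1)"
  by (simp_all add: D_alg_def module.extend_def nleibniz.fields_def)

lemma D_corep_simps [simp]:
  "carrier (D_corep K n A M) = carrier (tensor K M A)"
  "add (D_corep K n A M) = add (tensor K M A)"
  "zero (D_corep K n A M) = zero (tensor K M A)"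
  "smult (D_corep K n A M) = smult (tensor K M A)"
  "ract (D_corep K n A M) = D_ract K n A M"
  "lact (D_corep K n A M) = D_lact K n A M"
  by (simp_all add: D_corep_def module.extend_def corep.fields_def)

lemma linear_map_D [simp]:
  "linear_map K (D_alg K n A) W f \<longleftrightarrow> linear_map K (tpow K A (n - 1)) W f"
  "linear_map K V (D_alg K n A) h \<longleftrightarrow> linear_map K V (tpow K A (n - 1)) h"
  "linear_map K (D_corep K n A M) W f' \<longleftrightarrow> linear_map K (tensor K M A) W f'"
  "linear_map K V (D_corep K n A M) h' \<longleftrightarrow> linear_map K V (tensor K M A) h'"
  by (simp_all add: linear_map_def)

text \<open>Multilinearity of the bracket makes the prescribed values of \<open>D_br\<close>,
  \<open>D_ract\<close> and \<open>D_lact\<close> consistent. The locale is instantiated twice, for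
  \<open>U_alg L\<close> with arity \<open>n\<close> and for \<open>L\<close> with arity 2.\<close>

locale nary_algebra =
  fixes K :: "('k,'r) ring_scheme" and n :: nat and A :: "('k,'a,'e) nleibniz_scheme"
    and M :: "('k,'m,'f) module_scheme"
  assumes A: "module K A" and M: "module K M" and n: "1 \<le> n"
    and nbr_closed: "nbr A \<in> vlists A n \<rightarrow> carrier A"
    and nbr_multilinear: "multilinear_map K n A A (nbr A)"
begin

abbreviation T where "T \<equiv> tpow K A (n - 1)"

lemma Cons_vlists: "l \<in> carrier A \<Longrightarrow> ls \<in> vlists A (n - 1) \<Longrightarrow> l # ls \<in> vlists A n"
  using n by (auto simp: vlists_def)

lemma nbr_Cons_closed: "l \<in> carrier A \<Longrightarrow> ls \<in> vlists A (n - 1) \<Longrightarrow> nbr A (l # ls) \<in> carrier A"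
  using nbr_closed Cons_vlists by auto

lemma nbr_Cons_linear:
  assumes "ls \<in> vlists A (n - 1)"
  shows "linear_map K A A (\<lambda>l. nbr A (l # ls))"
proof -
  interpret A: module K A by (rule A)
  show ?thesis
    using multilinear_mapD[OF nbr_multilinear Cons_vlists[OF A.zero_closed assms], of 0] n by simp
qed

lemma nbr_Cons_multilinear:
  assumes "l \<in> carrier A"
  shows "multilinear_map K (n - 1) A A (\<lambda>ls. nbr A (l # ls))"
proof (rule multilinear_mapI)
  fix ls i assume "ls \<in> vlists A (n - 1)" "i < n - 1"
  then show "linear_map K A A (\<lambda>v. nbr A (l # ls[i := v]))"
    using multilinear_mapD[OF nbr_multilinear Cons_vlists[OF assms], of ls "Suc i"] by simp
qed

lemma D_br_exists:
  "\<exists>b. bilinear_map K T T T b \<and> (\<forall>ls\<in>vlists A (n - 1). \<forall>ls'\<in>vlists A (n - 1).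
    b (pure K A ls) (pure K A ls') = (\<Oplus>\<^bsub>T\<^esub>i\<in>{..<n - 1}. pure K A (ls[i := nbr A (ls ! i # ls')])))"
proof -
  note TM = tpow_module[OF A, of "n - 1"]
  interpret T: module K T by (rule TM)
  note pm = multilinear_mapD[OF pure_multilinear[OF A]]
  have c: "(\<Oplus>\<^bsub>T\<^esub>i\<in>{..<n - 1}. pure K A (ls[i := nbr A (ls ! i # ls')])) \<in> carrier T"
    if "ls \<in> vlists A (n - 1)" "ls' \<in> vlists A (n - 1)" for ls ls'
    by (rule T.finsum_closed)
      (use that in \<open>auto intro!: pure_closed[OF A] vlists_update nbr_Cons_closed vlists_nth\<close>)
  show ?thesis
  proof (rule bilinear_map_exists[OF TM TM TM tpow_span[OF A] tpow_span[OF A]])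
    fix ls assume ls: "ls \<in> vlists A (n - 1)"
    show "\<exists>f. linear_map K T T f \<and> (\<forall>ls'\<in>vlists A (n - 1).
      f (pure K A ls') = (\<Oplus>\<^bsub>T\<^esub>i\<in>{..<n - 1}. pure K A (ls[i := nbr A (ls ! i # ls')])))"
    proof (rule tpow_lift[OF A TM])
      show "multilinear_map K (n - 1) A T (\<lambda>ls'. \<Oplus>\<^bsub>T\<^esub>i\<in>{..<n - 1}. pure K A (ls[i := nbr A (ls ! i # ls')]))"
      proof (rule multilinear_mapI, rule linear_map_finsum_fun[OF TM])
        fix ls' p i assume ls': "ls' \<in> vlists A (n - 1)" "p < n - 1" and i: "i \<in> {..<n - 1}"
        then have i: "i < n - 1" by simp
        show "linear_map K A T (\<lambda>v. pure K A (ls[i := nbr A (ls ! i # ls'[p := v])]))"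
          by (rule linear_map_compose[OF multilinear_mapD[OF nbr_Cons_multilinear[OF vlists_nth[OF ls i]] ls']
                pm[OF ls i]])
      qed
    qed (use c ls in auto)
  next
    fix ls' assume ls': "ls' \<in> vlists A (n - 1)"
    show "\<exists>f. linear_map K T T f \<and> (\<forall>ls\<in>vlists A (n - 1).
      f (pure K A ls) = (\<Oplus>\<^bsub>T\<^esub>i\<in>{..<n - 1}. pure K A (ls[i := nbr A (ls ! i # ls')])))"
    proof (rule tpow_lift[OF A TM])
      show "multilinear_map K (n - 1) A T (\<lambda>ls. \<Oplus>\<^bsub>T\<^esub>i\<in>{..<n - 1}. pure K A (ls[i := nbr A (ls ! i # ls')]))"
      proof (rule multilinear_mapI, rule linear_map_finsum_fun[OF TM])
        fix ls p i assume ls: "ls \<in> vlists A (n - 1)" "p < n - 1" and i: "i \<in> {..<n - 1}"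
        then have i: "i < n - 1" by simp
        have len: "length ls = n - 1" using ls by (simp add: vlists_def)
        show "linear_map K A T (\<lambda>v. pure K A (ls[p := v, i := nbr A (ls[p := v] ! i # ls')]))"
        \<comment> \<open>In slot \<open>p\<close> the varied entry sits inside the bracket; for
          another slot the updates at \<open>i\<close> and \<open>p\<close> commute.\<close>
        proof (cases "i = p")
          case True
          then show ?thesis
            using linear_map_compose[OF nbr_Cons_linear[OF ls'] pm[OF ls]] i len by simp
        next
          case False
          then have "linear_map K A T (\<lambda>v. pure K A (ls[i := nbr A (ls ! i # ls'), p := v]))"
            by (intro pm ls vlists_update nbr_Cons_closed vlists_nth[OF ls(1) i] ls')
          then show ?thesis using False i len by (simp add: list_update_swap[of i p])
        qed
      qed
    qed (use c ls' in auto)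
  qed
qed

lemma D_br_bilinear: "bilinear_map K T T T (D_br K n A)"
  and D_br_pure: "ls \<in> vlists A (n - 1) \<Longrightarrow> ls' \<in> vlists A (n - 1) \<Longrightarrow>
    D_br K n A (pure K A ls) (pure K A ls') = (\<Oplus>\<^bsub>T\<^esub>i\<in>{..<n - 1}. pure K A (ls[i := nbr A (ls ! i # ls')]))"
  using bilin_ext_spec[OF D_br_exists] unfolding D_br_def Let_def by auto

lemma D_ract_exists:
  "\<exists>b. bilinear_map K (tensor K M A) T (tensor K M A) b \<and>
    (\<forall>x\<in>carrier M \<times> carrier A. \<forall>ls\<in>vlists A (n - 1).
      b (case x of (m, l) \<Rightarrow> tens K M A m l) (pure K A ls) =
      (\<lambda>(m, l) ls. tens K M A m (nbr A (l # ls))) x ls)"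
proof -
  note TM = tpow_module[OF A, of "n - 1"] and XM = tensor_module[OF M A]
  note tb = tens_bilinear[OF M A]
  show ?thesis
  proof (rule bilinear_map_exists[OF XM TM XM tensor_span[OF M A] tpow_span[OF A]])
    fix x assume "x \<in> carrier M \<times> carrier A"
    then obtain m l where x: "x = (m, l)" and m: "m \<in> carrier M" and l: "l \<in> carrier A" by auto
    show "\<exists>f. linear_map K T (tensor K M A) f \<and>
      (\<forall>ls\<in>vlists A (n - 1). f (pure K A ls) = (\<lambda>(m, l) ls. tens K M A m (nbr A (l # ls))) x ls)"
      unfolding x prod.case
    proof (rule tpow_lift[OF A XM])
      show "multilinear_map K (n - 1) A (tensor K M A) (\<lambda>ls. tens K M A m (nbr A (l # ls)))"
        by (rule multilinear_mapI, rule linear_map_compose[OF multilinear_mapD[OF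
                nbr_Cons_multilinear[OF l]] bilinear_map_right[OF tb m]])
    qed (use bilinear_map_closed[OF tb m] nbr_Cons_closed[OF l] in auto)
  next
    fix ls assume ls: "ls \<in> vlists A (n - 1)"
    have "bilinear_map K M A (tensor K M A) (\<lambda>m l. tens K M A m (nbr A (l # ls)))"
    proof (rule bilinear_mapI)
      show "linear_map K A (tensor K M A) (\<lambda>l. tens K M A m (nbr A (l # ls)))" if "m \<in> carrier M" for m
        by (rule linear_map_compose[OF nbr_Cons_linear[OF ls] bilinear_map_right[OF tb that]])
      show "linear_map K M (tensor K M A) (\<lambda>m. tens K M A m (nbr A (l # ls)))" if "l \<in> carrier A" for l
        by (rule bilinear_map_left[OF tb nbr_Cons_closed[OF that ls]])
    qed
    from tensor_lift[OF M A XM this]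
    show "\<exists>f. linear_map K (tensor K M A) (tensor K M A) f \<and> (\<forall>x\<in>carrier M \<times> carrier A.
      f (case x of (m, l) \<Rightarrow> tens K M A m l) = (\<lambda>(m, l) ls. tens K M A m (nbr A (l # ls))) x ls)"
      by fastforce
  qed
qed

lemma D_ract_bilinear: "bilinear_map K (tensor K M A) T (tensor K M A) (D_ract K n A M)"
  and D_ract_tens: "m \<in> carrier M \<Longrightarrow> l \<in> carrier A \<Longrightarrow> ls \<in> vlists A (n - 1) \<Longrightarrow>
    D_ract K n A M (tens K M A m l) (pure K A ls) = tens K M A m (nbr A (l # ls))"
  using bilin_ext_spec[OF D_ract_exists] unfolding D_ract_def by auto

text \<open>The left action is minus the right action with the arguments exchanged, which supplies
  the witness.\<close>

lemma D_lact_exists: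
  "\<exists>b. bilinear_map K T (tensor K M A) (tensor K M A) b \<and>
    (\<forall>ls\<in>vlists A (n - 1). \<forall>x\<in>carrier M \<times> carrier A.
      b (pure K A ls) (case x of (m, l) \<Rightarrow> tens K M A m l) =
      (\<lambda>ls (m, l). \<ominus>\<^bsub>tensor K M A\<^esub> tens K M A m (nbr A (l # ls))) ls x)"
proof (intro exI conjI ballI)
  note XM = tensor_module[OF M A]
  show "bilinear_map K T (tensor K M A) (tensor K M A) (\<lambda>t x. \<ominus>\<^bsub>tensor K M A\<^esub> D_ract K n A M x t)"
  proof (rule bilinear_mapI; rule linear_map_neg_fun[OF XM])
    show "linear_map K (tensor K M A) (tensor K M A) (\<lambda>x. D_ract K n A M x t)" if "t \<in> carrier T" for t
      by (rule bilinear_map_left[OF D_ract_bilinear that])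
    show "linear_map K T (tensor K M A) (\<lambda>t. D_ract K n A M x t)" if "x \<in> carrier (tensor K M A)" for x
      by (rule bilinear_map_right[OF D_ract_bilinear that])
  qed
qed (auto simp: D_ract_tens)

lemma D_lact_bilinear: "bilinear_map K T (tensor K M A) (tensor K M A) (D_lact K n A M)"
  and D_lact_tens: "m \<in> carrier M \<Longrightarrow> l \<in> carrier A \<Longrightarrow> ls \<in> vlists A (n - 1) \<Longrightarrow>
    D_lact K n A M (pure K A ls) (tens K M A m l) = \<ominus>\<^bsub>tensor K M A\<^esub> tens K M A m (nbr A (l # ls))"
  using bilin_ext_spec[OF D_lact_exists] unfolding D_lact_def by auto

sublocale leibniz: leibniz_coefficients K "D_alg K n A" "D_corep K n A M"
proof (rule leibniz_coefficients.intro)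
  show "module K (D_alg K n A)" by (rule module_cong[OF tpow_module[OF A]]) simp_all
  show "module K (D_corep K n A M)" by (rule module_cong[OF tensor_module[OF M A]]) simp_all
qed (use D_br_bilinear D_ract_bilinear D_lact_bilinear in \<open>simp_all add: bilinear_map_def\<close>)

text \<open>\<open>lin_span\<close> refers to a record, and \<open>D_alg\<close> is a different
  record on the same space as the tensor power. The identity, viewed as a linear map between the
  two, carries the span over.\<close>

lemma D_alg_span: "lin_span K (D_alg K n A) (pure K A ` vlists A (n - 1)) = carrier (D_alg K n A)"
proof
  have S: "pure K A ` vlists A (n - 1) \<subseteq> carrier (D_alg K n A)" using pure_closed[OF A] by auto
  show "lin_span K (D_alg K n A) (pure K A ` vlists A (n - 1)) \<subseteq> carrier (D_alg K n A)"
    by (rule lin_span_closed[OF leibniz.g S])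
  have "linear_map K T (D_alg K n A) (\<lambda>x. x)" by (simp add: linear_map_ident)
  from submodule_vimage[OF tpow_module[OF A] leibniz.g this lin_span_submodule[OF leibniz.g S]]
  have "lin_span K T (pure K A ` vlists A (n - 1)) \<subseteq>
      {x \<in> carrier T. x \<in> lin_span K (D_alg K n A) (pure K A ` vlists A (n - 1))}"
    by (rule lin_span_least) (use S in \<open>auto intro: subsetD[OF lin_span_superset]\<close>)
  then show "carrier (D_alg K n A) \<subseteq> lin_span K (D_alg K n A) (pure K A ` vlists A (n - 1))"
    using tpow_span[OF A] by auto
qed

lemma tens_induct_submodule:
  assumes W: "submodule W K U" and U: "module K U" and f: "linear_map K (tensor K M A) U f"
    and t: "\<And>m l. m \<in> carrier M \<Longrightarrow> l \<in> carrier A \<Longrightarrow> f (tens K M A m l) \<in> W"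
    and x: "x \<in> carrier (tensor K M A)"
  shows "f x \<in> W"
proof -
  have "(\<lambda>(v, w). tens K M A v w) ` (carrier M \<times> carrier A) \<subseteq> {x \<in> carrier (tensor K M A). f x \<in> W}"
    using t bilinear_map_closed[OF tens_bilinear[OF M A]] by auto
  from lin_span_least[OF submodule_vimage[OF tensor_module[OF M A] U f W] this] x show ?thesis
    by (auto simp: tensor_span[OF M A])
qed

lemma nCL_module: "module K (nCL K n A M k)"
  unfolding nCL_def by (rule leibniz.CL_module)

lemma map_pure_vlists:
  "length lss = k \<Longrightarrow> set lss \<subseteq> vlists A (n - 1) \<Longrightarrow> map (pure K A) lss \<in> vlists (D_alg K n A) k"
  using pure_closed[OF A] by (force simp: vlists_def)

lemma ncl_closed:
  assumes "m \<in> carrier M" "l \<in> carrier A" "length lss = k" "set lss \<subseteq> vlists A (n - 1)"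
  shows "ncl K n A M m l lss \<in> carrier (nCL K n A M k)"
  unfolding ncl_def nCL_def
  by (rule leibniz.cl_closed[OF _ map_pure_vlists[OF assms(3,4)]])
    (simp add: bilinear_map_closed[OF tens_bilinear[OF M A]] assms)

text \<open>The span is enlarged in two stages: \<open>tens_induct_submodule\<close> allows
  arbitrary coefficients, then \<open>multilinear_map_span\<close> allows arbitrary entries of
  \<open>D_alg\<close>. Since \<open>h_map\<close> is prescribed on the \<open>ncl\<close> only,
  this is what determines it.\<close>

lemma ncl_span:
  "lin_span K (nCL K n A M k) {ncl K n A M m l lss | m l lss. m \<in> carrier M \<and> l \<in> carrier A \<and>
    length lss = k \<and> set lss \<subseteq> vlists A (n - 1)} = carrier (nCL K n A M k)"
    (is "lin_span K ?C ?S = _")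
proof
  have S: "?S \<subseteq> carrier ?C" using ncl_closed by auto
  show "lin_span K ?C ?S \<subseteq> carrier ?C" by (rule lin_span_closed[OF nCL_module S])
  let ?D = "D_alg K n A" and ?N = "D_corep K n A M"
  note W = lin_span_submodule[OF nCL_module S]
  have 1: "cl K ?D ?N x (map (pure K A) lss) \<in> lin_span K ?C ?S"
    if lss: "length lss = k" "set lss \<subseteq> vlists A (n - 1)" and x: "x \<in> carrier (tensor K M A)" for x lss
  proof (rule tens_induct_submodule[OF W nCL_module _ _ x])
    show "linear_map K (tensor K M A) ?C (\<lambda>x. cl K ?D ?N x (map (pure K A) lss))"
      using leibniz.cl_linear[OF map_pure_vlists[OF lss]] by (simp add: nCL_def)
    show "cl K ?D ?N (tens K M A m l) (map (pure K A) lss) \<in> lin_span K ?C ?S"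
      if "m \<in> carrier M" "l \<in> carrier A" for m l
      using that lss by (intro subsetD[OF lin_span_superset]) (auto simp: ncl_def)
  qed
  have 2: "cl K ?D ?N x ts \<in> lin_span K ?C ?S"
    if x: "x \<in> carrier ?N" and ts: "ts \<in> vlists ?D k" for x ts
  proof (rule multilinear_map_span[OF leibniz.g nCL_module _ D_alg_span W _ ts])
    show "multilinear_map K k ?D ?C (cl K ?D ?N x)"
      unfolding nCL_def by (rule leibniz.cl_multilinear[OF x])
    fix ts assume ts: "length ts = k" "set ts \<subseteq> pure K A ` vlists A (n - 1)"
    then have "ts \<in> lists (pure K A ` vlists A (n - 1))" by auto
    then obtain lss where "lss \<in> lists (vlists A (n - 1))" "ts = map (pure K A) lss"
      unfolding lists_image by auto
    then show "cl K ?D ?N x ts \<in> lin_span K ?C ?S"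
      using 1[of lss x] x ts(1) by auto
  qed
  have "lin_span K ?C {cl K ?D ?N x ts | x ts. x \<in> carrier ?N \<and> ts \<in> vlists ?D k} \<subseteq> lin_span K ?C ?S"
    by (rule lin_span_least[OF W]) (use 2 in blast)
  then show "carrier ?C \<subseteq> lin_span K ?C ?S"
    using leibniz.CL_span[of k] by (simp add: nCL_def)
qed

text \<open>The boundary of \<open>m \<otimes> l \<otimes> ls\<close> is
  \<open>m \<otimes> [l, ls]\<close>. So the boundaries contain every \<open>m\<close> tensored with
  a bracket, and by linearity in the second factor they contain every \<open>m \<otimes> l\<close>
  when brackets span.\<close>

lemma boundaries_0_eq_carrier:
  assumes span: "lin_span K A (nbr A ` vlists A n) = carrier A"
  shows "boundaries (nCL K n A M) (nCL_d K n A M) 0 = carrier (nCL K n A M 0)"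
proof
  let ?D = "D_alg K n A" and ?N = "D_corep K n A M" and ?C = "nCL K n A M"
  let ?B = "boundaries ?C (nCL_d K n A M) 0"
  interpret C0: module K "?C 0" by (rule nCL_module)
  have d: "linear_map K (?C 1) (?C 0) (nCL_d K n A M 1)"
    using leibniz.CL_d_linear[of 0] by (simp add: nCL_def nCL_d_def)
  have W: "submodule ?B K (?C 0)"
    unfolding boundaries_def using submodule_image[OF nCL_module nCL_module d
      module.carrier_is_submodule[OF nCL_module]] by simp
  show "?B \<subseteq> carrier (?C 0)" by (rule C0.submoduleE(1)[OF W])
  have nil: "[] \<in> vlists V 0" for V :: "('k,'z,'y) module_scheme" by (simp add: vlists_def)
  have tb: "linear_map K A (tensor K M A) (tens K M A m)" if "m \<in> carrier M" for m
    by (rule bilinear_map_right[OF tens_bilinear[OF M A] that])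
  have cl: "linear_map K (tensor K M A) (?C 0) (\<lambda>x. cl K ?D ?N x [])"
    using leibniz.cl_linear[OF nil] by (simp add: nCL_def)
  have b: "cl K ?D ?N (tens K M A m (nbr A ls)) [] \<in> ?B" if m: "m \<in> carrier M" and ls: "ls \<in> vlists A n" for m ls
  proof -
    obtain l ls' where l: "ls = l # ls'" "l \<in> carrier A" "ls' \<in> vlists A (n - 1)"
      using ls n by (cases ls) (auto simp: vlists_def)
    have v: "[pure K A ls'] \<in> vlists ?D (Suc 0)"
      using pure_closed[OF A l(3)] by (simp add: vlists_def)
    have t: "tens K M A m l \<in> carrier ?N"
      using linear_map_closed[OF tb[OF m] l(2)] by simp
    have r: "cl K ?D ?N (tens K M A m (nbr A ls)) [] \<in> carrier (?C 0)"
      using linear_map_closed[OF cl linear_map_closed[OF tb[OF m] nbr_Cons_closed[OF l(2,3)]]] l(1) by simp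
    \<comment> \<open>In degree 1 only the right action contributes: the double sum ranges over this
      empty set, and the left actions over \<open>{2..1}\<close>.\<close>
    have e: "{(i, j). Suc 0 \<le> i \<and> i < j \<and> j \<le> Suc 0} = {}" by auto
    have "nCL_d K n A M (Suc 0) (cl K ?D ?N (tens K M A m l) [pure K A ls']) =
        cl K ?D ?N (tens K M A m (nbr A ls)) []"
      unfolding nCL_d_def leibniz.CL_d_cl[OF t v]
      using r by (simp add: ent_def omit_def D_ract_tens[OF m l(2,3)] e l(1)
          C0.finsum_empty[unfolded nCL_def] C0.r_zero[unfolded nCL_def] nCL_def)
    then show ?thesis
      unfolding boundaries_def using leibniz.cl_closed[OF t v] by (force simp: nCL_def)
  qed
  have b': "cl K ?D ?N (tens K M A m l) [] \<in> ?B" if m: "m \<in> carrier M" and l: "l \<in> carrier A" for m l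
  proof -
    have "nbr A ` vlists A n \<subseteq> {l \<in> carrier A. cl K ?D ?N (tens K M A m l) [] \<in> ?B}"
      using b[OF m] nbr_closed by auto
    from lin_span_least[OF submodule_vimage[OF A nCL_module linear_map_compose[OF tb[OF m] cl] W] this]
    show ?thesis using l span by auto
  qed
  have "cl K ?D ?N x [] \<in> ?B" if "x \<in> carrier (tensor K M A)" for x
    by (rule tens_induct_submodule[OF W nCL_module cl b' that])
  then have "lin_span K (?C 0) {cl K ?D ?N x ts | x ts. x \<in> carrier ?N \<and> ts \<in> vlists ?D 0} \<subseteq> ?B"
    by (intro lin_span_least[OF W]) (auto simp: vlists_def)
  then show "carrier (?C 0) \<subseteq> ?B"
    using leibniz.CL_span[of 0] by (simp add: nCL_def)
qed

end

subsection \<open>Iterated brackets in a Leibniz algebra\<close>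

lemma U_alg_simps [simp]:
  "carrier (U_alg L) = carrier L" "add (U_alg L) = add L" "zero (U_alg L) = zero L"
  "smult (U_alg L) = smult L" "nbr (U_alg L) = iter_br L"
  by (simp_all add: U_alg_def)

lemma vlists_U_alg [simp]: "vlists (U_alg L) k = vlists L k"
  by (simp add: vlists_def)

lemma tpow_U_alg [simp]: "tpow K (U_alg L) k = tpow K L k"
  by (simp add: tpow_def tpow_rels_def)

lemma pure_U_alg [simp]: "pure K (U_alg L) xs = pure K L xs"
  by (simp add: pure_def tpow_rels_def)

lemma tensor_U_alg [simp]: "tensor K M (U_alg L) = tensor K M L"
  by (simp add: tensor_def tensor_rels_def)

lemma tens_U_alg [simp]: "tens K M (U_alg L) m l = tens K M L m l"
  by (simp add: tens_def tensor_rels_def)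

lemma iter_br_Cons: "ys \<noteq> [] \<Longrightarrow> iter_br L (x # ys) = br L x (iter_br L ys)"
  by (cases ys) auto

text \<open>Splits off the index 0 instead of the last one, to match the recursion of
  \<open>iter_br\<close> at the head of a list.\<close>

lemma (in abelian_monoid) finsum_lessThan_Suc:
  assumes "f \<in> {..<Suc k} \<rightarrow> carrier G"
  shows "finsum G f {..<Suc k} = f 0 \<oplus> (\<Oplus>i\<in>{..<k}. f (Suc i))"
proof -
  have f: "f \<in> Suc ` {..<k} \<rightarrow> carrier G" "f 0 \<in> carrier G" using assms by auto
  have "finsum G f {..<Suc k} = f 0 \<oplus> finsum G f (Suc ` {..<k})"
    unfolding lessThan_Suc_eq_insert_0 using f by (intro finsum_insert) auto
  then show ?thesis using finsum_reindex[OF f(1)] by simp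
qed

locale leibniz_alg =
  fixes K :: "('k,'r) ring_scheme" and L :: "('k,'l,'e) nleibniz_scheme"
  assumes leibniz: "leibniz_algebra K L"
begin

lemma L: "module K L"
  using leibniz by (simp add: leibniz_n_algebra_def)

lemma br_bilinear: "bilinear_map K L L L (br L)"
proof -
  interpret L: module K L by (rule L)
  have m: "multilinear_map K 2 L L (nbr L)" using leibniz by (simp add: leibniz_n_algebra_def)
  show ?thesis
  proof (rule bilinear_mapI)
    \<comment> \<open>The zero in the list only fills the slot that the update overwrites.\<close>
    show "linear_map K L L (br L v)" if "v \<in> carrier L" for v
      using multilinear_mapD[OF m, of "[v, \<zero>\<^bsub>L\<^esub>]" 1] that by (simp add: vlists_def)
    show "linear_map K L L (\<lambda>v. br L v w)" if "w \<in> carrier L" for w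
      using multilinear_mapD[OF m, of "[\<zero>\<^bsub>L\<^esub>, w]" 0] that by (simp add: vlists_def)
  qed
qed

lemma br_br:
  assumes "x \<in> carrier L" "w \<in> carrier L" "y \<in> carrier L"
  shows "br L (br L x w) y = br L (br L x y) w \<oplus>\<^bsub>L\<^esub> br L x (br L w y)"
proof -
  interpret L: module K L by (rule L)
  have "\<forall>xs\<in>vlists L 2. \<forall>ys\<in>vlists L (2 - 1).
       nbr L (nbr L xs # ys) = (\<Oplus>\<^bsub>L\<^esub>i\<in>{..<2}. nbr L (xs[i := nbr L (xs ! i # ys)]))"
    using leibniz unfolding leibniz_n_algebra_def by blast
  moreover have "[x, w] \<in> vlists L 2" "[y] \<in> vlists L (2 - 1)" using assms by (auto simp: vlists_def)
  ultimately have "br L (br L x w) y = (\<Oplus>\<^bsub>L\<^esub>i\<in>{..<2}. nbr L ([x, w][i := nbr L ([x, w] ! i # [y])]))"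
    by blast
  then show ?thesis
    using assms bilinear_map_closed[OF br_bilinear]
    by (simp add: numeral_2_eq_2 L.finsum_lessThan_Suc Pi_def less_Suc_eq)
qed

text \<open>Lengths have the form \<open>Suc k\<close> here and below because \<open>iter_br\<close>
  has no meaningful value at the empty list.\<close>

lemma iter_br_closed: "xs \<in> vlists L (Suc k) \<Longrightarrow> iter_br L xs \<in> carrier L"
proof (induction k arbitrary: xs)
  case 0
  then show ?case by (auto simp: vlists_def length_Suc_conv)
next
  case (Suc k)
  then obtain x ys where "xs = x # ys" "ys \<in> vlists L (Suc k)" "x \<in> carrier L"
    by (auto simp: vlists_def length_Suc_conv)
  moreover from this have "ys \<noteq> []" by (auto simp: vlists_def)
  ultimately show ?case
    using Suc.IH[of ys] bilinear_map_closed[OF br_bilinear] by (simp add: iter_br_Cons)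
qed

lemma iter_br_multilinear: "multilinear_map K (Suc k) L L (iter_br L)"
proof (induction k)
  case 0
  show ?case
    by (rule multilinear_mapI) (auto simp: vlists_def length_Suc_conv linear_map_ident)
next
  case (Suc k)
  show ?case
  proof (rule multilinear_mapI)
    fix xs i assume "xs \<in> vlists L (Suc (Suc k))" and i: "i < Suc (Suc k)"
    then obtain x ys where xs: "xs = x # ys" "ys \<in> vlists L (Suc k)" "x \<in> carrier L"
      by (auto simp: vlists_def length_Suc_conv)
    then have ne: "ys \<noteq> []" by (auto simp: vlists_def)
    show "linear_map K L L (\<lambda>v. iter_br L (xs[i := v]))"
    proof (cases i)
      case 0
      then show ?thesis
        using bilinear_map_left[OF br_bilinear iter_br_closed[OF xs(2)]] by (simp add: xs(1) iter_br_Cons ne)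
    next
      case (Suc j)
      then have "linear_map K L L (\<lambda>v. br L x (iter_br L (ys[j := v])))"
        using i by (intro linear_map_compose[OF multilinear_mapD[OF Suc.IH xs(2)]
              bilinear_map_right[OF br_bilinear xs(3)]]) simp
      then show ?thesis by (simp add: xs(1) Suc iter_br_Cons ne)
    qed
  qed
qed

text \<open>By induction on the length. With \<open>w\<close> the iterated bracket of the tail, the
  Leibniz identity gives \<open>[[x, y], w]\<close>, which is the summand at index 0, and
  \<open>[x, [w, y]]\<close>, which the induction hypothesis and linearity of \<open>[x, -]\<close>
  expand into the other summands.\<close>

lemma br_iter_br:
  assumes "y \<in> carrier L" "xs \<in> vlists L (Suc k)"
  shows "br L (iter_br L xs) y = (\<Oplus>\<^bsub>L\<^esub>i\<in>{..<Suc k}. iter_br L (xs[i := br L (xs ! i) y]))"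
  using assms(2)
proof (induction k arbitrary: xs)
  interpret L: module K L by (rule L)
  case 0
  then obtain x where "xs = [x]" "x \<in> carrier L" by (auto simp: vlists_def length_Suc_conv)
  then show ?case
    using assms(1) bilinear_map_closed[OF br_bilinear] by (simp add: L.finsum_lessThan_Suc)
next
  interpret L: module K L by (rule L)
  case (Suc k)
  then obtain x ys where xs: "xs = x # ys" "ys \<in> vlists L (Suc k)" "x \<in> carrier L"
    by (auto simp: vlists_def length_Suc_conv)
  then have ne: "ys \<noteq> []" by (auto simp: vlists_def)
  note bc = bilinear_map_closed[OF br_bilinear] and w = iter_br_closed[OF xs(2)]
  have c: "(\<lambda>i. iter_br L (ys[i := br L (ys ! i) y])) \<in> {..<Suc k} \<rightarrow> carrier L"
    by (auto intro!: iter_br_closed[of _ k] vlists_update xs(2) bc vlists_nth[OF xs(2)] assms(1))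
  have c': "(\<lambda>i. iter_br L (xs[i := br L (xs ! i) y])) \<in> {..<Suc (Suc k)} \<rightarrow> carrier L"
    by (auto intro!: iter_br_closed[of _ "Suc k"] vlists_update Suc.prems bc vlists_nth[OF Suc.prems] assms(1))
  have "br L (iter_br L xs) y = br L (br L x y) (iter_br L ys) \<oplus>\<^bsub>L\<^esub> br L x (br L (iter_br L ys) y)"
    by (simp add: xs(1) iter_br_Cons ne br_br[OF xs(3) w assms(1)])
  also have "br L x (br L (iter_br L ys) y) = (\<Oplus>\<^bsub>L\<^esub>i\<in>{..<Suc k}. br L x (iter_br L (ys[i := br L (ys ! i) y])))"
    unfolding Suc.IH[OF xs(2)]
    by (rule linear_map_finsum[OF L L bilinear_map_right[OF br_bilinear xs(3)] c])
  also have "br L (br L x y) (iter_br L ys) \<oplus>\<^bsub>L\<^esub> \<dots> =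
      (\<Oplus>\<^bsub>L\<^esub>i\<in>{..<Suc (Suc k)}. iter_br L (xs[i := br L (xs ! i) y]))"
    unfolding L.finsum_lessThan_Suc[OF c'] by (simp add: xs(1) iter_br_Cons ne del: lessThan_Suc)
  finally show ?case .
qed

text \<open>By perfectness the \<open>[x, y]\<close> span. By induction \<open>y\<close> is a
  combination of iterated brackets of length \<open>Suc k\<close>, so \<open>[x, y]\<close> is a
  combination of iterated brackets with one more entry.\<close>

lemma iter_br_span:
  assumes "perfect K L"
  shows "lin_span K L (iter_br L ` vlists L (Suc k)) = carrier L"
proof (induction k)
  case 0
  have "carrier L \<subseteq> iter_br L ` vlists L (Suc 0)"
    by (auto simp: vlists_def image_iff intro!: exI[of _ "[_]"])
  then show ?case
    using lin_span_superset lin_span_closed[OF L] iter_br_closed by (metis image_subsetI subset_antisym subset_trans)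
next
  case (Suc k)
  let ?S = "iter_br L ` vlists L (Suc (Suc k))"
  have S: "?S \<subseteq> carrier L" using iter_br_closed by auto
  note W = lin_span_submodule[OF L S]
  have "br L x y \<in> lin_span K L ?S" if x: "x \<in> carrier L" and y: "y \<in> carrier L" for x y
  proof -
    have "br L x (iter_br L ys) \<in> lin_span K L ?S" if ys: "ys \<in> vlists L (Suc k)" for ys
    proof -
      have "x # ys \<in> vlists L (Suc (Suc k))" "ys \<noteq> []" using x ys by (auto simp: vlists_def)
      then have "br L x (iter_br L ys) \<in> ?S" by (metis image_eqI iter_br_Cons)
      then show ?thesis by (rule subsetD[OF lin_span_superset])
    qed
    then have "iter_br L ` vlists L (Suc k) \<subseteq> {y \<in> carrier L. br L x y \<in> lin_span K L ?S}"
      using iter_br_closed by auto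
    from lin_span_least[OF submodule_vimage[OF L L bilinear_map_right[OF br_bilinear x] W] this]
    show ?thesis using y Suc.IH by auto
  qed
  then have "lin_span K L {br L x y | x y. x \<in> carrier L \<and> y \<in> carrier L} \<subseteq> lin_span K L ?S"
    by (intro lin_span_least[OF W]) auto
  then show ?case using assms lin_span_closed[OF L S] by (auto simp: perfect_def)
qed

end

subsection \<open>The comparison map\<close>

lemma homology_cong:
  assumes "C k = C' k" "cycles C d k = cycles C' d' k" "boundaries C d k = boundaries C' d' k"
  shows "homology C d k = homology C' d' k"
  using assms by (simp add: homology_def)

lemma vlists_0: "vlists V 0 = {[]}"
  by (auto simp: vlists_def)

lemma tpow_0: "tpow K V 0 = tpow K W 0"
  by (simp add: tpow_def tpow_rels_def vlists_0)

lemma pure_Nil: "pure K V [] = pure K W []"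
  by (simp add: pure_def tpow_rels_def vlists_0)

text \<open>This is an equality and not just an isomorphism: a zeroth tensor power has the empty
  list as its only generator and no relators, whatever the space. It allows \<open>h_map\<close> in
  degree 0 to be literally the identity.\<close>

lemma nCL_0: "nCL K n (U_alg L) M 0 = nCL K 2 L M 0"
  using tpow_0[of K "D_alg K n (U_alg L)" "D_alg K 2 L"]
  by (simp add: nCL_def CL_def tensor_def tensor_rels_def)

lemma cl_Nil:
  "cl K (D_alg K n (U_alg L)) (D_corep K n (U_alg L) M) x [] = cl K (D_alg K 2 L) (D_corep K 2 L M) x []"
  using tpow_0[of K "D_alg K n (U_alg L)" "D_alg K 2 L"] pure_Nil[of K "D_alg K n (U_alg L)" "D_alg K 2 L"]
  by (simp add: cl_def tens_def tensor_rels_def)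

section \<open>The contraction as a homomorphism of algebras and coefficients\<close>

locale comparison = leibniz_alg K L
  for K :: "('k,'r) ring_scheme" and L :: "('k,'l,'e) nleibniz_scheme" +
  fixes M :: "('k,'m,'f) module_scheme" and n :: nat
  assumes M: "module K M" and n: "2 \<le> n"
begin

text \<open>Translates the lengths \<open>Suc k\<close> of the lemmas on iterated brackets into the
  two that occur: \<open>n - 1\<close> entries in a tensor and \<open>n\<close> entries in a bracket
  of \<open>U_alg L\<close>.\<close>

lemma Suc_pred: "Suc (n - 2) = n - 1" "Suc (n - 1) = n"
  using n by simp_all

lemma nary_L: "nary_algebra K 2 L M"
  by (rule nary_algebra.intro) (use L M leibniz in \<open>simp_all add: leibniz_n_algebra_def\<close>)

lemma nary_U: "nary_algebra K n (U_alg L) M"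
proof (rule nary_algebra.intro)
  show "module K (U_alg L)" by (rule module_cong[OF L]) simp_all
  show "nbr (U_alg L) \<in> vlists (U_alg L) n \<rightarrow> carrier (U_alg L)"
    using iter_br_closed[of _ "n - 1", unfolded Suc_pred] by auto
  show "multilinear_map K n (U_alg L) (U_alg L) (nbr (U_alg L))"
    using iter_br_multilinear[of "n - 1", unfolded Suc_pred]
    by (simp add: multilinear_map_def linear_map_def)
qed (use M n in auto)

sublocale U: nary_algebra K n "U_alg L" M by (rule nary_U)
sublocale L: nary_algebra K 2 L M by (rule nary_L)

lemma iter_br_closed': "ls \<in> vlists L (n - 1) \<Longrightarrow> iter_br L ls \<in> carrier L"
  using iter_br_closed[of ls "n - 2"] by (simp add: Suc_pred)

lemma singleton_vlists: "x \<in> carrier L \<Longrightarrow> [x] \<in> vlists L (2 - 1)"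
  by (simp add: vlists_def)

lemma pure_singleton_linear: "linear_map K L (tpow K L (2 - 1)) (\<lambda>x. pure K L [x])"
proof -
  interpret V: module K L by (rule L)
  show ?thesis
    using multilinear_mapD[OF pure_multilinear[OF L] singleton_vlists[OF V.zero_closed], of 0] by simp
qed

text \<open>The target is the space of \<open>D_alg K 2 L\<close>, into which an element of
  \<open>L\<close> enters as the pure tensor of a one-element list.\<close>

definition contraction :: "('l list \<Rightarrow> 'k) set \<Rightarrow> ('l list \<Rightarrow> 'k) set" where
  "contraction = lin_ext K (tpow K L (n - 1)) (tpow K L (2 - 1)) (vlists L (n - 1)) (pure K L)
    (\<lambda>ls. pure K L [iter_br L ls])"

lemma contraction_linear: "linear_map K (tpow K L (n - 1)) (tpow K L (2 - 1)) contraction"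
  and contraction_pure: "ls \<in> vlists L (n - 1) \<Longrightarrow> contraction (pure K L ls) = pure K L [iter_br L ls]"
proof -
  have "multilinear_map K (n - 1) L (tpow K L (2 - 1)) (\<lambda>ls. pure K L [iter_br L ls])"
    using linear_map_compose[OF multilinear_mapD[OF iter_br_multilinear[of "n - 2"]] pure_singleton_linear]
    by (simp add: multilinear_map_def Suc_pred)
  then have "\<exists>f. linear_map K (tpow K L (n - 1)) (tpow K L (2 - 1)) f \<and>
      (\<forall>ls\<in>vlists L (n - 1). f (pure K L ls) = pure K L [iter_br L ls])"
    by (rule tpow_lift[OF L tpow_module[OF L]])
      (use pure_closed[OF L singleton_vlists[OF iter_br_closed']] in auto)
  from lin_ext_spec[OF this]
  show "linear_map K (tpow K L (n - 1)) (tpow K L (2 - 1)) contraction"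
    "ls \<in> vlists L (n - 1) \<Longrightarrow> contraction (pure K L ls) = pure K L [iter_br L ls]"
    by (simp_all add: contraction_def)
qed

lemma nbr_U_Cons:
  "l \<in> carrier L \<Longrightarrow> ls \<in> vlists L (n - 1) \<Longrightarrow> nbr (U_alg L) (l # ls) = br L l (iter_br L ls)"
  using n by (auto simp: vlists_def intro!: iter_br_Cons)

text \<open>Both sides are bilinear, so pure tensors suffice. There the \<open>n\<close>-ary bracket
  acts on each entry as right multiplication by one element, and \<open>br_iter_br\<close> collects
  the sum over the entries into a single bracket.\<close>

lemma contraction_D_br:
  assumes "x \<in> carrier (tpow K L (n - 1))" "y \<in> carrier (tpow K L (n - 1))"
  shows "contraction (D_br K n (U_alg L) x y) = D_br K 2 L (contraction x) (contraction y)"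
proof (rule bilinear_map_eqI[OF _ _ _ tpow_span[OF L] tpow_span[OF L] _ _ _ assms])
  let ?T = "tpow K L (n - 1)" and ?T' = "tpow K L (2 - 1)"
  show "module K ?T" "module K ?T" "module K ?T'" by (rule tpow_module[OF L])+
  note b = U.D_br_bilinear[simplified tpow_U_alg]
  note cl = linear_map_closed[OF contraction_linear]
  show "bilinear_map K ?T ?T ?T' (\<lambda>x y. contraction (D_br K n (U_alg L) x y))"
    by (rule bilinear_mapI)
      (rule linear_map_compose[OF bilinear_map_right[OF b] contraction_linear]
        linear_map_compose[OF bilinear_map_left[OF b] contraction_linear]; assumption)+
  show "bilinear_map K ?T ?T ?T' (\<lambda>x y. D_br K 2 L (contraction x) (contraction y))"
    by (rule bilinear_mapI)
      (rule linear_map_compose[OF contraction_linear bilinear_map_right[OF L.D_br_bilinear cl]]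
        linear_map_compose[OF contraction_linear bilinear_map_left[OF L.D_br_bilinear cl]]; assumption)+
  fix s t assume "s \<in> pure K L ` vlists L (n - 1)" "t \<in> pure K L ` vlists L (n - 1)"
  then obtain ls ls' where ls: "ls \<in> vlists L (n - 1)" "ls' \<in> vlists L (n - 1)"
    and st: "s = pure K L ls" "t = pure K L ls'" by auto
  interpret V: module K L by (rule L)
  interpret T: module K ?T by (rule tpow_module[OF L])
  interpret T': module K ?T' by (rule tpow_module[OF L])
  let ?y = "iter_br L ls'"
  let ?e = "\<lambda>i. ls[i := br L (ls ! i) ?y]"
  have e: "?e i \<in> vlists L (n - 1)" if "i < n - 1" for i
    using that by (intro vlists_update[OF ls(1)] bilinear_map_closed[OF br_bilinear] vlists_nth[OF ls(1)]
        iter_br_closed'[OF ls(2)])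
  have p: "(\<lambda>i. pure K L (?e i)) \<in> {..<n - 1} \<rightarrow> carrier ?T"
    using pure_closed[OF L e] by auto
  have "D_br K n (U_alg L) s t = (\<Oplus>\<^bsub>?T\<^esub>i\<in>{..<n - 1}. pure K L (ls[i := nbr (U_alg L) (ls ! i # ls')]))"
    using U.D_br_pure[of ls ls'] ls by (simp add: st)
  also have "\<dots> = (\<Oplus>\<^bsub>?T\<^esub>i\<in>{..<n - 1}. pure K L (?e i))"
    using vlists_nth[OF ls(1)] ls(2)
    by (intro T.finsum_cong'[OF refl p]) (auto simp: nbr_U_Cons simp del: U_alg_simps)
  finally have "contraction (D_br K n (U_alg L) s t) = (\<Oplus>\<^bsub>?T'\<^esub>i\<in>{..<n - 1}. contraction (pure K L (?e i)))"
    using linear_map_finsum[OF tpow_module[OF L] tpow_module[OF L] contraction_linear p] by simp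
  also have "\<dots> = (\<Oplus>\<^bsub>?T'\<^esub>i\<in>{..<n - 1}. pure K L [iter_br L (?e i)])"
    using pure_closed[OF L singleton_vlists[OF iter_br_closed'[OF e]]]
    by (intro T'.finsum_cong') (auto simp: contraction_pure[OF e])
  \<comment> \<open>A one-element list has a single slot, in which \<open>pure\<close> is linear, so
    the sum moves inside.\<close>
  also have "\<dots> = pure K L [\<Oplus>\<^bsub>L\<^esub>i\<in>{..<n - 1}. iter_br L (?e i)]"
    using iter_br_closed'[OF e]
    by (intro linear_map_finsum[OF L tpow_module[OF L] pure_singleton_linear, symmetric]) auto
  also have "(\<Oplus>\<^bsub>L\<^esub>i\<in>{..<n - 1}. iter_br L (?e i)) = br L (iter_br L ls) ?y"
    using br_iter_br[OF iter_br_closed'[OF ls(2)], of ls "n - 2"] ls(1) by (simp only: Suc_pred)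
  also have "pure K L [br L (iter_br L ls) ?y] = D_br K 2 L (contraction s) (contraction t)"
  proof -
    note i = iter_br_closed'[OF ls(1)] iter_br_closed'[OF ls(2)]
    have "pure K L [br L (iter_br L ls) ?y] \<in> carrier ?T'"
      by (rule pure_closed[OF L singleton_vlists[OF bilinear_map_closed[OF br_bilinear i]]])
    \<comment> \<open>For arity 2 the sum that defines \<open>D_br\<close> has the single index
      0.\<close>
    then show ?thesis
      unfolding st contraction_pure[OF ls(1)] contraction_pure[OF ls(2)]
        L.D_br_pure[OF singleton_vlists[OF i(1)] singleton_vlists[OF i(2)]]
      by (simp add: lessThan_Suc T'.finsum_insert[simplified] T'.finsum_empty[simplified] T'.r_zero[simplified])
  qed
  finally show "contraction (D_br K n (U_alg L) s t) = D_br K 2 L (contraction s) (contraction t)" .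
qed

text \<open>On pure tensors both actions produce \<open>[l, y]\<close>, with \<open>y\<close> the
  iterated bracket of \<open>ls\<close>, and leave \<open>m\<close> alone. This is why the
  coefficient map can be the identity.\<close>

lemma contraction_D_ract:
  assumes "x \<in> carrier (tensor K M L)" "y \<in> carrier (tpow K L (n - 1))"
  shows "D_ract K n (U_alg L) M x y = D_ract K 2 L M x (contraction y)"
proof (rule bilinear_map_eqI[OF _ _ _ tensor_span[OF M L] tpow_span[OF L] _ _ _ assms])
  let ?T = "tpow K L (n - 1)" and ?X = "tensor K M L"
  show "module K ?T" "module K ?X" "module K ?X" by (rule tpow_module[OF L] tensor_module[OF M L])+
  note cl = linear_map_closed[OF contraction_linear]
  show "bilinear_map K ?X ?T ?X (D_ract K n (U_alg L) M)"
    using U.D_ract_bilinear by simp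
  show "bilinear_map K ?X ?T ?X (\<lambda>x y. D_ract K 2 L M x (contraction y))"
  proof (rule bilinear_mapI)
    show "linear_map K ?T ?X (\<lambda>y. D_ract K 2 L M x (contraction y))" if "x \<in> carrier ?X" for x
      by (rule linear_map_compose[OF contraction_linear bilinear_map_right[OF L.D_ract_bilinear that]])
    show "linear_map K ?X ?X (\<lambda>x. D_ract K 2 L M x (contraction y))" if "y \<in> carrier ?T" for y
      by (rule bilinear_map_left[OF L.D_ract_bilinear cl[OF that]])
  qed
  fix s t assume "s \<in> (\<lambda>(v, w). tens K M L v w) ` (carrier M \<times> carrier L)" "t \<in> pure K L ` vlists L (n - 1)"
  then obtain m l ls where *: "m \<in> carrier M" "l \<in> carrier L" "ls \<in> vlists L (n - 1)"
    and st: "s = tens K M L m l" "t = pure K L ls" by auto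
  have "D_ract K n (U_alg L) M s t = tens K M L m (br L l (iter_br L ls))"
    using U.D_ract_tens[of m l ls] * nbr_U_Cons[OF *(2,3)] by (simp add: st)
  then show "D_ract K n (U_alg L) M s t = D_ract K 2 L M s (contraction t)"
    by (simp add: st contraction_pure[OF *(3)]
        L.D_ract_tens[OF *(1,2) singleton_vlists[OF iter_br_closed'[OF *(3)]]])
qed

lemma contraction_D_lact:
  assumes "x \<in> carrier (tensor K M L)" "y \<in> carrier (tpow K L (n - 1))"
  shows "D_lact K n (U_alg L) M y x = D_lact K 2 L M (contraction y) x"
proof (rule bilinear_map_eqI[OF _ _ _ tpow_span[OF L] tensor_span[OF M L] _ _ _ assms(2,1)])
  let ?T = "tpow K L (n - 1)" and ?X = "tensor K M L"
  show "module K ?T" "module K ?X" "module K ?X" by (rule tpow_module[OF L] tensor_module[OF M L])+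
  note cl = linear_map_closed[OF contraction_linear]
  show "bilinear_map K ?T ?X ?X (D_lact K n (U_alg L) M)"
    using U.D_lact_bilinear by simp
  show "bilinear_map K ?T ?X ?X (\<lambda>y x. D_lact K 2 L M (contraction y) x)"
  proof (rule bilinear_mapI)
    show "linear_map K ?T ?X (\<lambda>y. D_lact K 2 L M (contraction y) x)" if "x \<in> carrier ?X" for x
      by (rule linear_map_compose[OF contraction_linear bilinear_map_left[OF L.D_lact_bilinear that]])
    show "linear_map K ?X ?X (\<lambda>x. D_lact K 2 L M (contraction y) x)" if "y \<in> carrier ?T" for y
      by (rule bilinear_map_right[OF L.D_lact_bilinear cl[OF that]])
  qed
  fix t s assume "s \<in> (\<lambda>(v, w). tens K M L v w) ` (carrier M \<times> carrier L)" "t \<in> pure K L ` vlists L (n - 1)"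
  then obtain m l ls where *: "m \<in> carrier M" "l \<in> carrier L" "ls \<in> vlists L (n - 1)"
    and st: "s = tens K M L m l" "t = pure K L ls" by auto
  have "D_lact K n (U_alg L) M t s = \<ominus>\<^bsub>?X\<^esub> tens K M L m (br L l (iter_br L ls))"
    using U.D_lact_tens[of m l ls] * nbr_U_Cons[OF *(2,3)] by (simp add: st)
  then show "D_lact K n (U_alg L) M t s = D_lact K 2 L M (contraction t) s"
    by (simp add: st contraction_pure[OF *(3)]
        L.D_lact_tens[OF *(1,2) singleton_vlists[OF iter_br_closed'[OF *(3)]]])
qed

sublocale hom: leibniz_coefficients_hom K "D_alg K n (U_alg L)" "D_corep K n (U_alg L) M"
  "D_alg K 2 L" "D_corep K 2 L M" contraction "\<lambda>x. x"
proof (rule leibniz_coefficients_hom.intro[OF U.leibniz.leibniz_coefficients_axioms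
      L.leibniz.leibniz_coefficients_axioms leibniz_coefficients_hom_axioms.intro])
  show "linear_map K (D_alg K n (U_alg L)) (D_alg K 2 L) contraction"
    using contraction_linear by simp
qed (use contraction_D_br contraction_D_ract contraction_D_lact in \<open>simp_all add: linear_map_ident\<close>)

section \<open>The chain map and its behaviour in degrees 0 and 1\<close>

abbreviation "C \<equiv> nCL K n (U_alg L) M"
abbreviation "C' \<equiv> nCL K 2 L M"

lemma map_contraction_pure:
  assumes "set lss \<subseteq> vlists L (n - 1)"
  shows "map contraction (map (pure K L) lss) = map (pure K L) (map (\<lambda>ls. [iter_br L ls]) lss)"
  using assms by (auto simp: contraction_pure)

text \<open>One map has both descriptions: on arbitrary entries \<open>ts\<close>, as compatibility
  with the boundary requires, and on the pure tensors \<open>ncl\<close> by which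
  \<open>h_map\<close> is chosen.\<close>

lemma h_map_exists:
  obtains f where "linear_map K (C k) (C' k) f"
    and "\<And>x ts. x \<in> carrier (tensor K M L) \<Longrightarrow> ts \<in> vlists (D_alg K n (U_alg L)) k \<Longrightarrow>
      f (cl K (D_alg K n (U_alg L)) (D_corep K n (U_alg L) M) x ts) =
      cl K (D_alg K 2 L) (D_corep K 2 L M) x (map contraction ts)"
    and "\<And>m l lss. m \<in> carrier M \<Longrightarrow> l \<in> carrier L \<Longrightarrow> length lss = k \<Longrightarrow> set lss \<subseteq> vlists L (n - 1) \<Longrightarrow>
      f (ncl K n (U_alg L) M m l lss) = ncl K 2 L M m l (map (\<lambda>ls. [iter_br L ls]) lss)"
proof -
  from hom.CL_map_exists[of k] obtain f where f: "linear_map K (C k) (C' k) f"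
    and fc: "\<And>x ts. x \<in> carrier (tensor K M L) \<Longrightarrow> ts \<in> vlists (D_alg K n (U_alg L)) k \<Longrightarrow>
      f (cl K (D_alg K n (U_alg L)) (D_corep K n (U_alg L) M) x ts) =
      cl K (D_alg K 2 L) (D_corep K 2 L M) x (map contraction ts)"
    by (auto simp: nCL_def)
  have "f (ncl K n (U_alg L) M m l lss) = ncl K 2 L M m l (map (\<lambda>ls. [iter_br L ls]) lss)"
    if "m \<in> carrier M" "l \<in> carrier L" "length lss = k" "set lss \<subseteq> vlists L (n - 1)" for m l lss
    using fc[OF bilinear_map_closed[OF tens_bilinear[OF M L] that(1,2)], of "map (pure K L) lss"]
      U.map_pure_vlists[of lss k] that(3,4)
    unfolding map_contraction_pure[OF that(4)] by (simp add: ncl_def pure_U_alg[abs_def] del: map_map)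
  with f fc that show thesis by blast
qed

lemma h_map_linear: "linear_map K (C k) (C' k) (h_map K n L M k)"
  and h_map_ncl: "m \<in> carrier M \<Longrightarrow> l \<in> carrier L \<Longrightarrow> length lss = k \<Longrightarrow> set lss \<subseteq> vlists L (n - 1) \<Longrightarrow>
    h_map K n L M k (ncl K n (U_alg L) M m l lss) = ncl K 2 L M m l (map (\<lambda>ls. [iter_br L ls]) lss)"
proof -
  have "\<exists>f. linear_map K (C k) (C' k) f \<and>
    (\<forall>x\<in>carrier M \<times> carrier L \<times> {lss. length lss = k \<and> set lss \<subseteq> vlists L (n - 1)}.
      f ((\<lambda>(m, l, lss). ncl K n (U_alg L) M m l lss) x) =
      (\<lambda>(m, l, lss). ncl K 2 L M m l (map (\<lambda>ls. [iter_br L ls]) lss)) x)"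
    by (rule h_map_exists[of k]) auto
  note s = lin_ext_spec[OF this, folded h_map_def]
  show "linear_map K (C k) (C' k) (h_map K n L M k)" by (rule s(1))
  show "m \<in> carrier M \<Longrightarrow> l \<in> carrier L \<Longrightarrow> length lss = k \<Longrightarrow> set lss \<subseteq> vlists L (n - 1) \<Longrightarrow>
    h_map K n L M k (ncl K n (U_alg L) M m l lss) = ncl K 2 L M m l (map (\<lambda>ls. [iter_br L ls]) lss)"
    using s(2)[of "(m, l, lss)"] by simp
qed

text \<open>\<open>h_map\<close> agrees with the functorial map on the \<open>ncl\<close>, which
  span, hence everywhere. It thereby inherits the values on arbitrary entries of
  \<open>D_alg\<close>.\<close>

lemma h_map_cl:
  assumes "x \<in> carrier (tensor K M L)" "ts \<in> vlists (D_alg K n (U_alg L)) k"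
  shows "h_map K n L M k (cl K (D_alg K n (U_alg L)) (D_corep K n (U_alg L) M) x ts) =
    cl K (D_alg K 2 L) (D_corep K 2 L M) x (map contraction ts)"
proof (rule h_map_exists[of k])
  fix f assume f: "linear_map K (C k) (C' k) f"
    and cl: "\<And>x ts. x \<in> carrier (tensor K M L) \<Longrightarrow> ts \<in> vlists (D_alg K n (U_alg L)) k \<Longrightarrow>
      f (cl K (D_alg K n (U_alg L)) (D_corep K n (U_alg L) M) x ts) =
      cl K (D_alg K 2 L) (D_corep K 2 L M) x (map contraction ts)"
    and ncl: "\<And>m l lss. m \<in> carrier M \<Longrightarrow> l \<in> carrier L \<Longrightarrow> length lss = k \<Longrightarrow> set lss \<subseteq> vlists L (n - 1) \<Longrightarrow>
      f (ncl K n (U_alg L) M m l lss) = ncl K 2 L M m l (map (\<lambda>ls. [iter_br L ls]) lss)"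
  have "h_map K n L M k (cl K (D_alg K n (U_alg L)) (D_corep K n (U_alg L) M) x ts) =
      f (cl K (D_alg K n (U_alg L)) (D_corep K n (U_alg L) M) x ts)"
  proof (rule linear_map_eqI[OF U.nCL_module L.nCL_module h_map_linear f U.ncl_span])
    show "cl K (D_alg K n (U_alg L)) (D_corep K n (U_alg L) M) x ts \<in> carrier (C k)"
      unfolding nCL_def by (rule U.leibniz.cl_closed) (use assms in simp_all)
  qed (auto simp: h_map_ncl ncl)
  then show ?thesis by (simp add: cl assms)
qed

sublocale chain: chain_map K C "nCL_d K n (U_alg L) M" C' "nCL_d K 2 L M" "h_map K n L M"
proof (rule chain_map.intro)
  show "linear_map K (C (Suc k)) (C k) (nCL_d K n (U_alg L) M (Suc k))" for k
    unfolding nCL_def nCL_d_def by (rule U.leibniz.CL_d_linear)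
  show "linear_map K (C' (Suc k)) (C' k) (nCL_d K 2 L M (Suc k))" for k
    unfolding nCL_def nCL_d_def by (rule L.leibniz.CL_d_linear)
  show "h_map K n L M k (nCL_d K n (U_alg L) M (Suc k) z) = nCL_d K 2 L M (Suc k) (h_map K n L M (Suc k) z)"
    if "z \<in> carrier (C (Suc k))" for k z
    unfolding nCL_d_def
    by (rule hom.CL_map_commute)
      (use that h_map_linear h_map_cl in \<open>simp_all add: nCL_def\<close>)
qed (rule U.nCL_module L.nCL_module h_map_linear)+

text \<open>In degree 0 the list of entries is empty, so there is nothing to contract.\<close>

lemma h_map_0: "z \<in> carrier (C 0) \<Longrightarrow> h_map K n L M 0 z = z"
proof (rule linear_map_eqI[OF U.nCL_module L.nCL_module h_map_linear])
  show "linear_map K (C 0) (C' 0) (\<lambda>z. z)" by (simp add: nCL_0 linear_map_ident)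
  show "lin_span K (C 0) {cl K (D_alg K n (U_alg L)) (D_corep K n (U_alg L) M) x ts | x ts.
      x \<in> carrier (D_corep K n (U_alg L) M) \<and> ts \<in> vlists (D_alg K n (U_alg L)) 0} = carrier (C 0)"
    unfolding nCL_def by (rule U.leibniz.CL_span)
  fix z assume "z \<in> {cl K (D_alg K n (U_alg L)) (D_corep K n (U_alg L) M) x ts | x ts.
      x \<in> carrier (D_corep K n (U_alg L) M) \<and> ts \<in> vlists (D_alg K n (U_alg L)) 0}"
  then obtain x where x: "x \<in> carrier (tensor K M L)"
    and z: "z = cl K (D_alg K n (U_alg L)) (D_corep K n (U_alg L) M) x []"
    by (auto simp: vlists_def)
  show "h_map K n L M 0 z = z"
    using h_map_cl[OF x, of "[]" 0] by (simp add: z cl_Nil vlists_def)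
qed

text \<open>The image is a submodule, so generators suffice. For fixed \<open>m\<close> and
  \<open>l\<close> they depend linearly on \<open>y\<close> and lie in the image when
  \<open>y\<close> is an iterated bracket of \<open>n - 1\<close> entries; such \<open>y\<close>
  span a perfect \<open>L\<close>.\<close>

lemma h_map_1_surj:
  assumes "perfect K L"
  shows "h_map K n L M 1 ` carrier (C 1) = carrier (C' 1)"
proof (rule linear_map_surjI[OF U.nCL_module L.nCL_module h_map_linear L.ncl_span], safe)
  fix m l and lss :: "'l list list"
  assume m: "m \<in> carrier M" and l: "l \<in> carrier L" and lss: "length lss = 1" "set lss \<subseteq> vlists L (2 - 1)"
  then obtain y where y: "lss = [[y]]" "y \<in> carrier L"
    by (auto simp: vlists_def length_Suc_conv)
  let ?I = "h_map K n L M 1 ` carrier (C 1)"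
  let ?c = "\<lambda>y. ncl K 2 L M m l [[y]]"
  interpret V: module K L by (rule L)
  have t: "tens K M L m l \<in> carrier (D_corep K 2 L M)"
    using bilinear_map_closed[OF tens_bilinear[OF M L] m l] by simp
  have pl: "linear_map K L (D_alg K 2 L) (\<lambda>x. pure K L [x])"
    using pure_singleton_linear by simp
  have "[pure K L [\<zero>\<^bsub>L\<^esub>]] \<in> vlists (D_alg K 2 L) 1"
    using linear_map_closed[OF pl V.zero_closed] by (simp add: vlists_def)
  from linear_map_compose[OF pl multilinear_mapD[OF L.leibniz.cl_multilinear[OF t] this, of 0]]
  have c: "linear_map K L (C' 1) ?c" by (simp add: ncl_def nCL_def)
  have I: "submodule ?I K (C' 1)"
    by (rule submodule_image[OF U.nCL_module L.nCL_module h_map_linear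
          module.carrier_is_submodule[OF U.nCL_module]])
  have "?c (iter_br L ls) \<in> ?I" if ls: "ls \<in> vlists L (n - 1)" for ls
  proof
    show "?c (iter_br L ls) = h_map K n L M 1 (ncl K n (U_alg L) M m l [ls])"
      using h_map_ncl[OF m l, of "[ls]" 1] ls by simp
    show "ncl K n (U_alg L) M m l [ls] \<in> carrier (C 1)"
      by (rule U.ncl_closed) (use m l ls in simp_all)
  qed
  then have "iter_br L ` vlists L (n - 1) \<subseteq> {y \<in> carrier L. ?c y \<in> ?I}"
    using iter_br_closed' by auto
  from lin_span_least[OF submodule_vimage[OF L L.nCL_module c I] this]
  show "ncl K 2 L M m l lss \<in> ?I"
    using y iter_br_span[OF assms, of "n - 2"] by (auto simp: Suc_pred)
qed

lemma cycles_1_surj: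
  assumes "perfect K L" "z' \<in> cycles C' (nCL_d K 2 L M) 1"
  shows "\<exists>z\<in>cycles C (nCL_d K n (U_alg L) M) 1. h_map K n L M 1 z = z'"
proof -
  have z': "z' \<in> carrier (C' 1)" "nCL_d K 2 L M 1 z' = \<zero>\<^bsub>C' 0\<^esub>"
    using assms(2) by (auto simp: cycles_def)
  have "z' \<in> h_map K n L M 1 ` carrier (C 1)"
    unfolding h_map_1_surj[OF assms(1)] by (rule z'(1))
  then obtain z where z: "z \<in> carrier (C 1)" "h_map K n L M 1 z = z'" by auto
  have dz: "nCL_d K n (U_alg L) M 1 z \<in> carrier (C 0)"
    using linear_map_closed[OF chain.d_linear[of 0]] z(1) by simp
  \<comment> \<open>Because \<open>h_map\<close> is the identity in degree 0, the boundary of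
    \<open>z\<close> may be computed after mapping, where it is the boundary of the cycle
    \<open>z'\<close>.\<close>
  have "nCL_d K n (U_alg L) M 1 z = h_map K n L M 0 (nCL_d K n (U_alg L) M 1 z)"
    by (rule h_map_0[OF dz, symmetric])
  also have "\<dots> = \<zero>\<^bsub>C 0\<^esub>"
    using chain.commute[of z 0] z z'(2) by (simp add: nCL_0)
  finally have "z \<in> cycles C (nCL_d K n (U_alg L) M) 1"
    using z(1) by (simp add: cycles_def)
  with z(2) show ?thesis by blast
qed

lemma boundaries_0:
  assumes "perfect K L"
  shows "boundaries C (nCL_d K n (U_alg L) M) 0 = boundaries C' (nCL_d K 2 L M) 0"
proof -
  have "lin_span K (U_alg L) (nbr (U_alg L) ` vlists (U_alg L) n) = carrier (U_alg L)"
  proof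
    have S: "iter_br L ` vlists L n \<subseteq> carrier L" using U.nbr_closed by auto
    then show "lin_span K (U_alg L) (nbr (U_alg L) ` vlists (U_alg L) n) \<subseteq> carrier (U_alg L)"
      by (intro lin_span_closed[OF U.A]) simp
    note W = lin_span_submodule[OF U.A, of "iter_br L ` vlists L n"]
    \<comment> \<open>\<open>U_alg L\<close> is another record on the same space, so the spans are
      compared through the identity map.\<close>
    have "linear_map K L (U_alg L) (\<lambda>x. x)" by (simp add: linear_map_def)
    from submodule_vimage[OF L U.A this W] S
    have "lin_span K L (iter_br L ` vlists L n) \<subseteq>
        {x \<in> carrier L. x \<in> lin_span K (U_alg L) (iter_br L ` vlists L n)}"
      by (intro lin_span_least) (auto intro: subsetD[OF lin_span_superset])
    then show "carrier (U_alg L) \<subseteq> lin_span K (U_alg L) (nbr (U_alg L) ` vlists (U_alg L) n)"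
      using iter_br_span[OF assms, of "n - 1", unfolded Suc_pred] by auto
  qed
  moreover have "nbr L ` vlists L 2 = {br L x y | x y. x \<in> carrier L \<and> y \<in> carrier L}"
    by (auto simp: vlists_def numeral_2_eq_2 length_Suc_conv image_iff) (metis)
  ultimately show ?thesis
    using U.boundaries_0_eq_carrier L.boundaries_0_eq_carrier assms by (simp add: perfect_def nCL_0)
qed

end

theorem mainTheorem5:
  fixes K :: "('k, 'r) ring_scheme"
    and L :: "('k, 'l, 'e) nleibniz_scheme"
    and M :: "('k, 'm, 'f) module_scheme"
    and n :: nat
  assumes "field K" and "n \<ge> 2" and "leibniz_algebra K L" and "module K M"
  shows
    "(\<forall>k. linear_map K (nCL K n (U_alg L) M k) (nCL K 2 L M k) (h_map K n L M k) \<and>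
          (\<forall>m\<in>carrier M. \<forall>l\<in>carrier L. \<forall>lss. length lss = k \<and> set lss \<subseteq> vlists L (n - 1) \<longrightarrow>
             h_map K n L M k (ncl K n (U_alg L) M m l lss) =
             ncl K 2 L M m l (map (\<lambda>ls. [iter_br L ls]) lss))) \<and>
     (\<forall>k. h_map K n L M k ` cycles (nCL K n (U_alg L) M) (nCL_d K n (U_alg L) M) k
            \<subseteq> cycles (nCL K 2 L M) (nCL_d K 2 L M) k \<and>
          h_map K n L M k ` boundaries (nCL K n (U_alg L) M) (nCL_d K n (U_alg L) M) k
            \<subseteq> boundaries (nCL K 2 L M) (nCL_d K 2 L M) k \<and>
          linear_map K (nHL K n (U_alg L) M k) (nHL K 2 L M k) (h_bar K n L M k) \<and>
          (\<forall>z\<in>cycles (nCL K n (U_alg L) M) (nCL_d K n (U_alg L) M) k.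
             h_bar K n L M k (hclass (nCL K n (U_alg L) M) (nCL_d K n (U_alg L) M) k z) =
             hclass (nCL K 2 L M) (nCL_d K 2 L M) k (h_map K n L M k z))) \<and>
     h_bar K n L M 0 ` carrier (nHL K n (U_alg L) M 0) = carrier (nHL K 2 L M 0) \<and>
     (perfect K L \<longrightarrow>
        nHL K n (U_alg L) M 0 = nHL K 2 L M 0 \<and>
        (\<forall>x\<in>carrier (nHL K n (U_alg L) M 0). h_bar K n L M 0 x = x) \<and>
        h_bar K n L M 1 ` carrier (nHL K n (U_alg L) M 1) = carrier (nHL K 2 L M 1))"
proof -
  interpret comparison K L M n
    using assms(2-4) by (simp add: comparison_def leibniz_alg_def comparison_axioms_def)
  let ?d = "nCL_d K n (U_alg L) M" and ?d' = "nCL_d K 2 L M"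
  have cyc: "z \<in> carrier (C k)" if "z \<in> cycles C ?d k" for z k
    using that by (simp add: cycles_def)
  have hb: "h_bar K n L M k (hclass C ?d k z) = hclass C' ?d' k (h_map K n L M k z)"
    if "z \<in> cycles C ?d k" for k z
    unfolding h_bar_def by (rule chain.induced_hclass[OF cyc[OF that]])
  have lin: "linear_map K (nHL K n (U_alg L) M k) (nHL K 2 L M k) (h_bar K n L M k)" for k
    unfolding h_bar_def nHL_def by (rule chain.induced_linear_map)
  have H: "carrier (nHL K n (U_alg L) M k) = hclass C ?d k ` cycles C ?d k"
    "carrier (nHL K 2 L M k) = hclass C' ?d' k ` cycles C' ?d' k" for k
    by (simp_all add: nHL_def homology_carrier)
  \<comment> \<open>Every homology class is represented by a cycle, so it is enough that cycles lift
    to cycles.\<close>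
  have surj: "h_bar K n L M k ` carrier (nHL K n (U_alg L) M k) = carrier (nHL K 2 L M k)"
    if "cycles C' ?d' k \<subseteq> h_map K n L M k ` cycles C ?d k" for k
  proof -
    have "h_map K n L M k ` cycles C ?d k = cycles C' ?d' k"
      using that chain.cycles_mono by blast
    then have "hclass C' ?d' k ` cycles C' ?d' k = (\<lambda>z. hclass C' ?d' k (h_map K n L M k z)) ` cycles C ?d k"
      by (metis image_image)
    then show ?thesis by (simp add: H image_image hb)
  qed
  have c0: "cycles C ?d 0 = carrier (C' 0)" "cycles C' ?d' 0 = carrier (C' 0)"
    by (simp_all add: cycles_def nCL_0)
  \<comment> \<open>In degree 0 every chain is a cycle and \<open>h_map\<close> is the identity, so
    each cycle is its own lift.\<close>
  have s0: "h_bar K n L M 0 ` carrier (nHL K n (U_alg L) M 0) = carrier (nHL K 2 L M 0)"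
    by (rule surj) (use h_map_0 in \<open>force simp: c0 nCL_0\<close>)
  have perf: "nHL K n (U_alg L) M 0 = nHL K 2 L M 0 \<and>
        (\<forall>x\<in>carrier (nHL K n (U_alg L) M 0). h_bar K n L M 0 x = x) \<and>
        h_bar K n L M 1 ` carrier (nHL K n (U_alg L) M 1) = carrier (nHL K 2 L M 1)"
    if p: "perfect K L"
  proof (intro conjI ballI)
    \<comment> \<open>Cycles and boundaries in degree 0 coincide as sets, so the two quotients are
      equal. Both are in fact zero, the boundaries being everything.\<close>
    show "nHL K n (U_alg L) M 0 = nHL K 2 L M 0"
      unfolding nHL_def by (rule homology_cong) (simp_all add: nCL_0 c0 boundaries_0[OF p])
    show "h_bar K n L M 0 x = x" if x: "x \<in> carrier (nHL K n (U_alg L) M 0)" for x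
    proof -
      obtain z where z: "z \<in> cycles C ?d 0" "x = hclass C ?d 0 z" using x by (auto simp: H)
      have "h_bar K n L M 0 x = hclass C' ?d' 0 z" using hb[OF z(1)] h_map_0[OF cyc[OF z(1)]] by (simp add: z(2))
      then show ?thesis by (simp add: z(2) hclass_def boundaries_0[OF p] nCL_0)
    qed
    show "h_bar K n L M 1 ` carrier (nHL K n (U_alg L) M 1) = carrier (nHL K 2 L M 1)"
      by (rule surj) (use cycles_1_surj[OF p] in blast)
  qed
  show ?thesis
    using h_map_linear h_map_ncl chain.cycles_mono chain.boundaries_mono lin hb s0 perf
    by (intro conjI allI ballI impI) auto
qed

end
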